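(* Let $m\in(0,1/2)$, let $\mathcal{E}(1,m)=\{(z_1,z_2)\in\mathbb{C}^2 \mid |z_1|^2+|z_2|^{2m}<1\}$, and let $k$ be a positive integer. Let $(a,b)\in\mathcal{E}(1,m)$ and $v\in\mathbb{C}^2$. Let $f\in X_{\mathcal{E}(1,m)}((a,b),v)$, i.e. $f$ is an extremal disc for the pair $((a,b),v)$. Then the map $\zeta\mapsto f(\zeta^k)$ is $k$-stationary in the $L^\infty$ sense.
   Context: $\mathbb{D}=\{\zeta\in\mathbb{C} \mid |\zeta|<1\}$ is the unit disc, with boundary $b\mathbb{D}$; $b\Omega$ denotes the boundary of a domain $\Omega$. Extremal discs: for a domain $\Omega\subset\mathbb{C}^n$, $p\in\Omega$ and $v\in T_p\Omega=\mathbb{C}^n$, a holomorphic disc $f:\mathbb{D}\to\Omega$ is an extremal disc for the pair $(p,v)$ if $f(0)=p$, $f'(0)=\lambda v$ with $\lambda>0$, and if whenever $g:\mathbb{D}\to\Omega$ is holomorphic with $g(0)=p$ and $g'(0)=\mu v$ with $\mu>0$, then $\mu\le\lambda$. The set of extremal discs for $(p,v)$ is denoted $X_\Omega(p,v)$. $k$-stationary discs: let $\Omega=\{\rho<0\}\subset\mathbb{C}^n$ be a smooth domain, where $\rho$ is a defining function, and set $\partial\rho=\left(\frac{\partial\rho}{\partial z_1},\ldots,\frac{\partial\rho}{\partial z_n}\right)$. Let $k$ be a positive integer. A bounded holomorphic map $f:\mathbb{D}\to\mathbb{C}^n$ is a $k$-stationary disc attached to $b\Omega$ in the $L^\infty$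 sense if $f(b\mathbb{D})\subset b\Omega$ a.e. and if there exists an $L^\infty$ function $c:b\mathbb{D}\to\mathbb{R}^+$ such that the function $\zeta\mapsto\zeta^k c(\zeta)\,\partial\rho(f(\zeta))\in\mathbb{C}^n$ defined on $b\mathbb{D}$ extends holomorphically to $\mathbb{D}$. In the claim, $k$-stationary is meant with respect to $\Omega=\mathcal{E}(1,m)$. *)

theory Defs
  imports "HOL-Complex_Analysis.Complex_Analysis"
begin

section \<open>Holomorphic discs and extremal discs\<close>

definition holomorphic_disc :: "(complex \<Rightarrow> complex^'n) \<Rightarrow> bool" where
  "holomorphic_disc f \<longleftrightarrow> (\<forall>j. (\<lambda>\<zeta>. f \<zeta> $ j) holomorphic_on ball 0 1)"

definition deriv_at_0 :: "(complex \<Rightarrow> complex^'n) \<Rightarrow> complex^'n" where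
  "deriv_at_0 f = (\<chi> j. deriv (\<lambda>\<zeta>. f \<zeta> $ j) 0)"

text \<open>Discs are total functions of which only the values on \<^term>\<open>ball 0 1 :: complex set\<close> matter.\<close>

definition extremal_discs ::
  "(complex^'n) set \<Rightarrow> complex^'n \<Rightarrow> complex^'n \<Rightarrow> (complex \<Rightarrow> complex^'n) set" where
  "extremal_discs \<Omega> p v =
    {f. holomorphic_disc f \<and> f ` ball 0 1 \<subseteq> \<Omega> \<and> f 0 = p \<and>
        (\<exists>l::real. l > 0 \<and> deriv_at_0 f = l *\<^sub>R v \<and>
          (\<forall>g. \<forall>\<mu>::real. holomorphic_disc g \<and> g ` ball 0 1 \<subseteq> \<Omega> \<and> g 0 = p \<and>
              \<mu> > 0 \<and> deriv_at_0 g = \<mu> *\<^sub>R v \<longrightarrow> \<mu> \<le> l))}"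

section \<open>Boundary values almost everywhere\<close>

text \<open>Arc length on the unit circle.\<close>

definition circle_measure :: "complex measure" where
  "circle_measure =
    distr (restrict_space lborel {0..<2*pi}) (restrict_space borel (sphere 0 1)) cis"

lemma space_circle_measure: "space circle_measure = sphere 0 1"
  by (simp add: circle_measure_def space_restrict_space)

lemma measurable_cis_circle:
  "cis \<in> measurable (restrict_space lborel {0..<2*pi}) (restrict_space borel (sphere 0 1))"
  by (intro measurable_restrict_space1 measurable_restrict_space2)
     (auto intro!: borel_measurable_continuous_onI continuous_intros)

lemma emeasure_circle_measure:
  "emeasure circle_measure (space circle_measure) = ennreal (2*pi)"
  unfolding space_circle_measure unfolding circle_measure_def
  apply (subst emeasure_distr[OF measurable_cis_circle])
   apply (simp add: sets_restrict_space)
   apply (metis image_eqI inf.idem UNIV_I Int_UNIV_right sets.top space_borel)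
  apply (simp add: space_restrict_space)
  apply (subst emeasure_restrict_space)
  apply (auto simp: Int_absorb1 subset_eq)
  done
text \<open>Radial limits. The predicate is only applied to bounded holomorphic discs, for which radial
  and non-tangential limits agree almost everywhere.\<close>

definition has_boundary_values ::
  "(complex \<Rightarrow> complex^'n) \<Rightarrow> (complex \<Rightarrow> complex^'n) \<Rightarrow> bool" where
  "has_boundary_values f fb \<longleftrightarrow>
    (AE \<zeta> in circle_measure. ((\<lambda>r::real. f (of_real r * \<zeta>)) \<longlongrightarrow> fb \<zeta>) (at_left 1))"

section \<open>Stationary discs\<close>

text \<open>A real directional derivative is set to 0 where it does not exist. This is relevant for
  defining functions that are not smooth everywhere, such as that of the ellipsoid below, which has
  no derivative in the directions of the second coordinate where that coordinate vanishes.\<close>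

definition dir_deriv :: "(complex^'n \<Rightarrow> real) \<Rightarrow> complex^'n \<Rightarrow> complex^'n \<Rightarrow> real" where
  "dir_deriv \<rho> z w =
    (if (\<lambda>t::real. \<rho> (z + t *\<^sub>R w)) differentiable (at 0)
     then deriv (\<lambda>t::real. \<rho> (z + t *\<^sub>R w)) 0 else 0)"

text \<open>The vector with components
  \<open>\<partial>\<rho>/\<partial>z\<^sub>j = (\<partial>\<rho>/\<partial>x\<^sub>j - \<i> \<partial>\<rho>/\<partial>y\<^sub>j) / 2\<close>, where \<open>z\<^sub>j = x\<^sub>j + \<i> y\<^sub>j\<close>.\<close>

definition complex_gradient :: "(complex^'n \<Rightarrow> real) \<Rightarrow> complex^'n \<Rightarrow> complex^'n" where
  "complex_gradient \<rho> z =
    (\<chi> j. (of_real (dir_deriv \<rho> z (axis j 1)) - \<i> * of_real (dir_deriv \<rho> z (axis j \<i>))) / 2)"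

text \<open>Here \<open>fb\<close> is the boundary function of the bounded disc \<open>f\<close> (unique almost everywhere), and
  holomorphic extension of a function on the circle means being the boundary function of a bounded
  holomorphic disc \<open>F\<close>. Boundedness of \<open>F\<close> cannot be dropped: every measurable function on the circle
  is almost everywhere the radial limit of some holomorphic function on the disc. Strict positivity
  of \<open>c\<close> is also needed, since \<open>c = 0\<close> would satisfy the extension condition trivially.\<close>

definition k_stationary_Linf ::
  "nat \<Rightarrow> (complex^'n \<Rightarrow> real) \<Rightarrow> (complex \<Rightarrow> complex^'n) \<Rightarrow> bool" where
  "k_stationary_Linf k \<rho> f \<longleftrightarrow>
    holomorphic_disc f \<and> bounded (f ` ball 0 1) \<and>
    (\<exists>fb. has_boundary_values f fb \<and>
      (AE \<zeta> in circle_measure. fb \<zeta> \<in> frontier {z. \<rho> z < 0}) \<and>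
      (\<exists>c :: complex \<Rightarrow> real.
        c \<in> borel_measurable circle_measure \<and>
        (\<exists>M. AE \<zeta> in circle_measure. c \<zeta> \<le> M) \<and>
        (\<forall>\<zeta>\<in>sphere 0 1. c \<zeta> > 0) \<and>
        (\<exists>F. holomorphic_disc F \<and> bounded (F ` ball 0 1) \<and>
          has_boundary_values F
            (\<lambda>\<zeta>. (\<zeta> ^ k * of_real (c \<zeta>)) *s complex_gradient \<rho> (fb \<zeta>)))))"

section \<open>The ellipsoid\<close>

definition ellipsoid :: "real \<Rightarrow> (complex^2) set" where
  "ellipsoid m = {z. (cmod (z $ 1))\<^sup>2 + cmod (z $ 2) powr (2 * m) < 1}"

definition ellipsoid_rho :: "real \<Rightarrow> complex^2 \<Rightarrow> real" where
  "ellipsoid_rho m z = (cmod (z $ 1))\<^sup>2 + cmod (z $ 2) powr (2 * m) - 1"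

lemma ellipsoid_eq_sublevel: "ellipsoid m = {z. ellipsoid_rho m z < 0}"
  by (simp add: ellipsoid_def ellipsoid_rho_def)

lemma dir_deriv_eqI:
  assumes "((\<lambda>t::real. \<rho> (z + t *\<^sub>R w)) has_real_derivative d) (at 0)"
  shows "dir_deriv \<rho> z w = d"
  using assms by (auto simp: dir_deriv_def DERIV_imp_deriv real_differentiable_def)

lemma cmod_line_deriv:
  fixes x w :: complex
  shows "((\<lambda>t::real. (cmod (x + t *\<^sub>R w))\<^sup>2) has_real_derivative 2 * Re (cnj x * w)) (at 0)"
  unfolding cmod_power2 by (auto intro!: derivative_eq_intros)

lemma cmod_powr_line_deriv:
  fixes x w :: complex assumes "x \<noteq> 0"
  shows "((\<lambda>t::real. cmod (x + t *\<^sub>R w) powr (2*m)) has_real_derivative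
     2 * m * cmod x powr (2*m - 2) * Re (cnj x * w)) (at 0)"
proof -
  have *: "cmod y powr (2*m) = ((cmod y)\<^sup>2) powr m" for y
    by (cases "y = 0") (simp_all add: powr_powr flip: powr_numeral) 
  have "((\<lambda>t::real. ((cmod (x + t *\<^sub>R w))\<^sup>2) powr m) has_real_derivative
     m * ((cmod x)\<^sup>2) powr (m - 1) * (2 * Re (cnj x * w))) (at 0)"
    using DERIV_fun_powr[OF cmod_line_deriv[of x w], of m] assms by simp
  moreover have "((cmod x)\<^sup>2) powr (m - 1) = cmod x powr (2*m-2)"
    using assms by (simp add: powr_powr algebra_simps flip: powr_numeral)
  ultimately show ?thesis unfolding * by (simp add: algebra_simps)
qed

lemma not_differentiable_abs_powr:
  assumes "0 < m" "m < 1/2"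
  shows "\<not> (\<lambda>t::real. C + \<bar>t\<bar> powr (2*m) - 1) differentiable (at 0)"
proof
  assume "(\<lambda>t::real. C + \<bar>t\<bar> powr (2*m) - 1) differentiable (at 0)"
  then obtain D where "((\<lambda>t::real. C + \<bar>t\<bar> powr (2*m) - 1) has_real_derivative D) (at 0)"
    by (auto simp: real_differentiable_def)
  then have "((\<lambda>h::real. (\<bar>h\<bar> powr (2*m)) / h) \<longlongrightarrow> D) (at_right 0)"
    using assms by (auto simp: DERIV_def intro: tendsto_within_subset[of _ _ _ UNIV])
  moreover have "filterlim (\<lambda>h::real. (\<bar>h\<bar> powr (2*m)) / h) at_top (at_right 0)"
    using assms by real_asymp
  ultimately show False
    using not_tendsto_and_filterlim_at_infinity[OF _ _ filterlim_at_top_imp_at_infinity]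
    by (metis trivial_limit_at_right_real)
qed

text \<open>Where the second coordinate vanishes, the second component below is 0.\<close>

lemma complex_gradient_ellipsoid_rho:
  assumes "0 < m" "m < 1/2"
  shows "complex_gradient (ellipsoid_rho m) z =
    vector [cnj (z $ 1), of_real (m * cmod (z $ 2) powr (2*m - 2)) * cnj (z $ 2)]"
proof -
  have 1: "dir_deriv (ellipsoid_rho m) z (axis 1 w) = 2 * Re (cnj (z$1) * w)" for w
  proof (rule dir_deriv_eqI)
    have "(\<lambda>t. ellipsoid_rho m (z + t *\<^sub>R axis 1 w)) =
        (\<lambda>t. (cmod (z$1 + t *\<^sub>R w))\<^sup>2 + (cmod (z$2) powr (2*m) - 1))"
      by (auto simp: ellipsoid_rho_def axis_def)
    then show "((\<lambda>t. ellipsoid_rho m (z + t *\<^sub>R axis 1 w)) has_real_derivative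
        2 * Re (cnj (z$1) * w)) (at 0)"
      using DERIV_add[OF cmod_line_deriv DERIV_const] by simp
  qed
  have 2: "dir_deriv (ellipsoid_rho m) z (axis 2 w)
      = 2 * m * cmod (z$2) powr (2*m - 2) * Re (cnj (z$2) * w)" if w: "cmod w = 1" for w
  proof (cases "z $ 2 = 0")
    case True
    then show ?thesis using not_differentiable_abs_powr[OF assms, of "(cmod (z$1))\<^sup>2"] w
      by (simp add: dir_deriv_def ellipsoid_rho_def axis_def norm_mult)
  next
    case False
    show ?thesis
    proof (rule dir_deriv_eqI)
      have "(\<lambda>t. ellipsoid_rho m (z + t *\<^sub>R axis 2 w)) =
          (\<lambda>t. cmod (z$2 + t *\<^sub>R w) powr (2*m) + ((cmod (z$1))\<^sup>2 - 1))"
        by (auto simp: ellipsoid_rho_def axis_def)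
      then show "((\<lambda>t. ellipsoid_rho m (z + t *\<^sub>R axis 2 w)) has_real_derivative
          2 * m * cmod (z$2) powr (2*m - 2) * Re (cnj (z$2) * w)) (at 0)"
        using DERIV_add[OF cmod_powr_line_deriv[OF False] DERIV_const] by simp
    qed
  qed
  show ?thesis
    by (auto simp: complex_gradient_def vec_eq_iff forall_2 1 2 complex_eq_iff)
qed

end

theory Submission
  imports Defs
begin

text \<open>The automorphisms of the ellipsoid move the centre of the disc to \<open>(0, b)\<close>. For \<open>b = 0\<close>
  the domain is balanced and the extremal discs are linear. For \<open>b \<noteq> 0\<close> write the second component
  as \<open>B G\<close> with \<open>\<bar>B\<bar> \<le> 1\<close> and \<open>G\<close> free of zeros, so that \<open>(f\<^sub>1, G\<^sup>m)\<close> is a disc in the ball.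
  The Schwarz-Pick lemma for \<open>B\<close> and the Schwarz lemma of the ball for \<open>(f\<^sub>1, G\<^sup>m)\<close> bound the
  derivative at the centre by that of an explicit competitor, which has two parameters:
  \<open>\<bar>B 0\<bar> = exp (- x)\<close> and the slope \<open>t\<close> of a complex line. An extremal disc therefore attains both
  bounds, and varying \<open>(x, t)\<close> forces either \<open>B\<close> constant and \<open>t < 1\<close>, or \<open>t = exp (- x)\<close>, which
  means that the zero of \<open>B\<close> is the reflection of the zero of \<open>G\<^sup>m\<close>. Both
  exclude a zero of \<open>f\<^sub>2\<close> on the circle, where for \<open>m < 1/2\<close> the second component of the gradient
  blows up, so the stationarity multiplier can be written down.\<close>

section \<open>The maximum principle for the ellipsoid\<close>

text \<open>For m < 1/2 the domain is not convex, so extremality cannot be turned into stationarity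
  by duality; it has to be exploited by comparison with discs that can be written down. For a
  centred disc with nonzero second component only the moduli L and R of \<open>f\<^sub>1' 0\<close>
  and \<open>f\<^sub>2' 0 / f\<^sub>2 0\<close> matter, because the competitor accepts arbitrary
  arguments for both. The question becomes planar: L^2 \<le> P x t and R \<le> E x t hold at the
  point (x, t) of the disc, and no admissible point may beat both targets at once. Two places resist
  a first-order variation. Competitors exist only for t \<le> 1, since for |\<omega>| = 1 and t > 1
  the factor 1 + t \<omega> z has a zero inside the disc; a disc with t > 1 therefore needs a
  separate sharp bound for zero-free components. At the corner x = 0, t = 1 the variation
  degenerates, and there the inequality 2 m < 1 decides.\<close>

lemma continuous_on_norm_powr:
  fixes f :: "complex \<Rightarrow> complex"
  assumes "0 < m" "continuous_on S f"
  shows "continuous_on S (\<lambda>z. cmod (f z) powr m)"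
  using assms by (intro continuous_on_powr' continuous_on_norm continuous_on_const) auto

text \<open>Keeping the exponent a parameter lets one maximum principle serve the ellipsoid and,
  with m = 1, the ball.\<close>

definition egauge :: "real \<Rightarrow> complex \<Rightarrow> complex \<Rightarrow> real" where
  "egauge m z w = (cmod z)\<^sup>2 + cmod w powr (2 * m)"

text \<open>If g \<xi> \<noteq> 0, a local branch h of the m-th power of g makes (f, h) a map whose
  Euclidean norm is maximal at \<xi>, and strict convexity of the ball forces constancy. If g \<xi>
  = 0, then f alone has maximal modulus at \<xi>.\<close>

lemma egauge_strict_max:
  assumes m: "0 < m" and f: "f holomorphic_on ball 0 R" and g: "g holomorphic_on ball 0 R"
    and \<xi>: "\<xi> \<in> ball 0 R"
    and le: "\<And>z. z \<in> ball 0 R \<Longrightarrow> egauge m (f z) (g z) \<le> egauge m (f \<xi>) (g \<xi>)"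
    and z: "z \<in> ball 0 R"
  shows "f z = f \<xi>" and "g z = g \<xi>"
proof -
  have const: "h z = h \<xi>"
    if h: "h holomorphic_on ball 0 R" and U: "open U" "U \<subseteq> ball 0 R" "\<xi> \<in> U"
      and hle: "\<And>w. w \<in> U \<Longrightarrow> cmod (h w) \<le> cmod (h \<xi>)" for h :: "complex \<Rightarrow> complex" and U
  proof -
    have "h constant_on ball 0 R"
      by (rule maximum_modulus_principle[OF h _ _ U]) (use hle in auto)
    then show ?thesis using \<xi> z by (metis constant_on_def)
  qed
  have "f z = f \<xi> \<and> g z = g \<xi>"
  proof (cases "g \<xi> = 0")
    case True
    have "f z = f \<xi>"
    proof (rule const[OF f, of "ball 0 R"])
      fix z :: complex assume "z \<in> ball 0 R"
      from le[OF this] have "(cmod (f z))\<^sup>2 + cmod (g z) powr (2*m) \<le> (cmod (f \<xi>))\<^sup>2"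
        using True by (simp add: egauge_def)
      moreover have "0 \<le> cmod (g z) powr (2*m)" by simp
      ultimately have "(cmod (f z))\<^sup>2 \<le> (cmod (f \<xi>))\<^sup>2" by linarith
      then show "cmod (f z) \<le> cmod (f \<xi>)" by (rule power2_le_imp_le) auto
    qed (use \<xi> in auto)
    moreover have "cmod (g z) powr (2*m) \<le> 0"
      using le[OF z] True \<open>f z = f \<xi>\<close> by (simp add: egauge_def)
    then have "cmod (g z) powr (2*m) = 0" using powr_ge_zero[of "cmod (g z)" "2*m"] by linarith
    then have "g z = 0" by simp
    ultimately show ?thesis using True by simp
  next
    case False
    have opn: "open (ball 0 R \<inter> g -` (- {0}))"
      using continuous_open_preimage[OF holomorphic_on_imp_continuous_on[OF g] open_ball, of "- {0}"]
      by auto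
    then obtain e where e: "e > 0" "ball \<xi> e \<subseteq> ball 0 R \<inter> g -` (- {0})"
      using openE[OF opn, of \<xi>] False \<xi> by auto
    define U where "U = ball \<xi> e"
    have U: "open U" "U \<subseteq> ball 0 R" "\<xi> \<in> U" "convex U" and gnz: "\<And>z. z \<in> U \<Longrightarrow> g z \<noteq> 0"
      using e by (auto simp: U_def)
    obtain l where l: "l holomorphic_on U" "\<And>z. z \<in> U \<Longrightarrow> exp (l z) = g z"
      using holomorphic_logarithm_exists[OF U(4) U(1) holomorphic_on_subset[OF g U(2)] gnz U(3)] by blast
    define h where "h z = exp (m * l z)" for z
    have h: "h holomorphic_on U" unfolding h_def by (intro holomorphic_intros l)
    have hn: "(cmod (h z))\<^sup>2 = cmod (g z) powr (2*m)" if "z \<in> U" for z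
    proof -
      have "cmod (g z) = exp (Re (l z))" using l(2)[OF that] by (metis norm_exp_eq_Re)
      then show ?thesis by (simp add: h_def powr_def flip: exp_double)
    qed
    \<comment> \<open>The Hermitian product with the value at \<xi>. Its modulus is largest at
      \<xi>, so it is constant, and the identity \<open>id\<close> then bounds the distance of (f,
      h) from its value at \<xi> by 0.\<close>
    define \<phi> where "\<phi> z = cnj (f \<xi>) * f z + cnj (h \<xi>) * h z" for z
    have fU: "f holomorphic_on U" using holomorphic_on_subset[OF f U(2)] .
    have ph: "\<phi> holomorphic_on U" unfolding \<phi>_def by (intro holomorphic_intros fU h)
    have id: "(cmod (f z - f \<xi>))\<^sup>2 + (cmod (h z - h \<xi>))\<^sup>2 =
      ((cmod (f z))\<^sup>2 + (cmod (h z))\<^sup>2) + ((cmod (f \<xi>))\<^sup>2 + (cmod (h \<xi>))\<^sup>2) - 2 * Re (\<phi> z)" for z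
      unfolding \<phi>_def cmod_power2 by (simp add: power2_eq_square algebra_simps)
    have u: "(cmod (f z))\<^sup>2 + (cmod (h z))\<^sup>2 \<le> (cmod (f \<xi>))\<^sup>2 + (cmod (h \<xi>))\<^sup>2" if "z \<in> U" for z
      using le[of z] that hn[OF that] hn[OF U(3)] U(2) by (auto simp: egauge_def)
    have ph\<xi>: "\<phi> \<xi> = of_real ((cmod (f \<xi>))\<^sup>2 + (cmod (h \<xi>))\<^sup>2)"
      unfolding \<phi>_def by (simp add: complex_norm_square mult.commute del: of_real_power)
    have "cmod (\<phi> z) \<le> cmod (\<phi> \<xi>)" if "z \<in> U" for z
    proof -
      have "cmod (\<phi> z) \<le> cmod (f \<xi>) * cmod (f z) + cmod (h \<xi>) * cmod (h z)"
        unfolding \<phi>_def by (rule order_trans[OF norm_triangle_ineq]) (simp add: norm_mult)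
      also have "\<dots> \<le> (cmod (f \<xi>))\<^sup>2 + (cmod (h \<xi>))\<^sup>2"
        using u[OF that] sum_squares_bound[of "cmod (f \<xi>)" "cmod (f z)"] sum_squares_bound[of "cmod (h \<xi>)" "cmod (h z)"]
        by linarith
      also have "\<dots> = cmod (\<phi> \<xi>)" unfolding ph\<xi> norm_of_real by simp
      finally show ?thesis .
    qed
    then have "\<phi> constant_on U"
      by (intro maximum_modulus_principle[OF ph U(1) convex_connected[OF U(4)] U(1) order_refl U(3)])
    then have "\<phi> z = \<phi> \<xi>" if "z \<in> U" for z using that U(3) by (metis constant_on_def)
    then have "(cmod (f z - f \<xi>))\<^sup>2 + (cmod (h z - h \<xi>))\<^sup>2 \<le> 0" if "z \<in> U" for z
      using id[of z] u[OF that] that ph\<xi> by simp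
    then have "f z = f \<xi> \<and> h z = h \<xi>" if "z \<in> U" for z
      using that by (simp add: sum_power2_le_zero_iff)
    then have fU': "f z = f \<xi>" and pU: "cmod (g z) powr (2*m) = cmod (g \<xi>) powr (2*m)" if "z \<in> U" for z
      using that hn[OF that] hn[OF U(3)] by auto
    have "cmod (g z) = cmod (g \<xi>)" if "z \<in> U" for z
    proof -
      have "(cmod (g z) powr (2*m)) powr (1/(2*m)) = (cmod (g \<xi>) powr (2*m)) powr (1/(2*m))"
        using pU[OF that] by simp
      then show ?thesis using m by (simp add: powr_powr)
    qed
    with fU' show ?thesis by (intro conjI const[OF f U(1-3)] const[OF g U(1-3)]) auto
  qed
  then show "f z = f \<xi>" "g z = g \<xi>" by auto
qed

lemma continuous_on_egauge:
  fixes f g :: "complex \<Rightarrow> complex"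
  assumes "0 < m" "continuous_on S f" "continuous_on S g"
  shows "continuous_on S (\<lambda>z. egauge m (f z) (g z))"
  unfolding egauge_def using assms continuous_on_norm_powr[of "2*m" S g]
  by (intro continuous_on_add continuous_on_power continuous_on_norm) auto

text \<open>If the maximum over a closed disc is attained in its interior, both functions are
  constant there, so the maximal value is also taken at points of modulus above \<open>r0\<close>,
  where the bound is assumed.\<close>

lemma egauge_le_1_if_boundary:
  assumes m: "0 < m" and f: "f holomorphic_on ball 0 1" and g: "g holomorphic_on ball 0 1"
    and bd: "\<And>e. e > 0 \<Longrightarrow> \<exists>r0<1. \<forall>z. r0 < cmod z \<and> cmod z < 1 \<longrightarrow> egauge m (f z) (g z) \<le> 1 + e"
    and z: "cmod z < 1"
  shows "egauge m (f z) (g z) \<le> 1"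
proof (rule field_le_epsilon)
  fix e :: real assume "e > 0"
  from bd[OF this] obtain r0 where r0: "r0 < 1"
    "\<And>z. r0 < cmod z \<Longrightarrow> cmod z < 1 \<Longrightarrow> egauge m (f z) (g z) \<le> 1 + e" by auto
  obtain r where r: "max r0 (cmod z) < r" "r < 1" using r0 z by (metis dense max_less_iff_conj)
  have rpos: "0 < r" using r by (smt (verit) norm_ge_zero)
  have sub: "cball 0 r \<subseteq> ball (0::complex) 1" using r by auto
  have cf: "continuous_on (cball 0 r) f" "continuous_on (cball 0 r) g"
    using holomorphic_on_imp_continuous_on[OF f] holomorphic_on_imp_continuous_on[OF g] sub
    by (auto intro: continuous_on_subset)
  obtain \<xi> where \<xi>: "\<xi> \<in> cball 0 r" "\<And>z. z \<in> cball 0 r \<Longrightarrow> egauge m (f z) (g z) \<le> egauge m (f \<xi>) (g \<xi>)"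
    using continuous_attains_sup[OF compact_cball _ continuous_on_egauge[OF m cf]] rpos by auto
  show "egauge m (f z) (g z) \<le> 1 + e"
  proof (cases "cmod \<xi> = r")
    case True
    then show ?thesis using r0(2)[of \<xi>] r \<xi>(2)[of z] by auto
  next
    case False
    then have \<xi>': "\<xi> \<in> ball 0 r" using \<xi> by auto
    have sub': "ball 0 r \<subseteq> ball (0::complex) 1" using r by auto
    have c: "f w = f \<xi> \<and> g w = g \<xi>" if "w \<in> ball 0 r" for w
      using egauge_strict_max[OF m holomorphic_on_subset[OF f sub'] holomorphic_on_subset[OF g sub'] \<xi>' _ that] \<xi>(2)
      by auto
    obtain r' where r': "max r0 (cmod z) < r'" "r' < r" using r by (metis dense)
    have "r' > 0" using r' by (smt (verit) norm_ge_zero)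
    then have "egauge m (f z) (g z) = egauge m (f (of_real r')) (g (of_real r'))"
      using c[of z] c[of "of_real r'"] r r' by (auto simp: norm_of_real)
    then show ?thesis using r0(2)[of "of_real r'"] r r' \<open>r' > 0\<close> by auto
  qed
qed

section \<open>Splitting off the zeros of the second component\<close>

lemma moebius_identity:
  "(cmod (1 - cnj a * z))\<^sup>2 - (cmod (z - a))\<^sup>2 = (1 - (cmod a)\<^sup>2) * (1 - (cmod z)\<^sup>2)"
  unfolding cmod_power2 by (simp add: power2_eq_square algebra_simps)

lemma one_minus_mult_neq_0:
  fixes a z :: complex
  assumes "cmod a < 1" "cmod z \<le> 1"
  shows "1 - a * z \<noteq> 0"
proof -
  have "cmod (a * z) \<le> cmod a" using assms by (simp add: norm_mult mult_left_le)
  then show ?thesis using assms by auto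
qed

lemma one_plus_mult_neq_0:
  fixes a z :: complex
  assumes "cmod a < 1" "cmod z \<le> 1"
  shows "1 + a * z \<noteq> 0"
  using one_minus_mult_neq_0[of "-a" z] assms by simp

lemma norm_moebius_less_1:
  assumes "cmod a < 1" "cmod z < 1"
  shows "cmod ((z - a) / (1 - cnj a * z)) < 1"
proof -
  have "(1 - (cmod a)\<^sup>2) * (1 - (cmod z)\<^sup>2) > 0" using assms by (simp add: power_less_one_iff)
  then have "(cmod (z - a))\<^sup>2 < (cmod (1 - cnj a * z))\<^sup>2" using moebius_identity[of a z] by linarith
  then have "cmod (z - a) < cmod (1 - cnj a * z)" by (rule power2_less_imp_less) auto
  then show ?thesis by (simp add: norm_divide divide_simps)
qed

lemma norm_less_1_or_constant:
  assumes h: "h holomorphic_on ball 0 1" and le: "\<And>z. cmod z < 1 \<Longrightarrow> cmod (h z) \<le> 1"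
  shows "(\<forall>z. cmod z < 1 \<longrightarrow> cmod (h z) < 1) \<or> (\<forall>z. cmod z < 1 \<longrightarrow> h z = h 0) \<and> cmod (h 0) = 1"
proof (rule disjCI)
  assume nc: "\<not> ((\<forall>z. cmod z < 1 \<longrightarrow> h z = h 0) \<and> cmod (h 0) = 1)"
  show "\<forall>z. cmod z < 1 \<longrightarrow> cmod (h z) < 1"
  proof (rule ccontr)
    assume "\<not> ?thesis"
    then obtain w where w: "cmod w < 1" "cmod (h w) = 1" using le by fastforce
    have "h constant_on ball 0 1"
      by (rule maximum_modulus_principle[OF h, where U = "ball 0 1" and \<xi> = w]) (use w le in auto)
    then obtain c where "\<And>z. cmod z < 1 \<Longrightarrow> h z = c" by (auto simp: constant_on_def)
    then have "(\<forall>z. cmod z < 1 \<longrightarrow> h z = h 0) \<and> cmod (h 0) = 1" using w by simp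
    with nc show False by blast
  qed
qed

text \<open>The Schwarz lemma applies to h followed by the Moebius map that takes \<open>h 0\<close>
  to 0; solving \<open>p z = \<omega> * z\<close> for h gives the equality case. If |h 0| = 1, then
  h is constant and both sides of the bound vanish.\<close>

lemma Schwarz_Pick_at_0:
  assumes h: "h holomorphic_on ball 0 1" and le: "\<And>z. cmod z < 1 \<Longrightarrow> cmod (h z) \<le> 1"
  shows "cmod (deriv h 0) \<le> 1 - (cmod (h 0))\<^sup>2"
    and "cmod (deriv h 0) = 1 - (cmod (h 0))\<^sup>2 \<Longrightarrow> cmod (h 0) < 1 \<Longrightarrow>
      \<exists>\<omega>. cmod \<omega> = 1 \<and> (\<forall>z. cmod z < 1 \<longrightarrow> h z = (h 0 + \<omega> * z) / (1 + cnj (h 0) * \<omega> * z))"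
proof -
  have "cmod (deriv h 0) \<le> 1 - (cmod (h 0))\<^sup>2 \<and> (cmod (deriv h 0) = 1 - (cmod (h 0))\<^sup>2 \<longrightarrow> cmod (h 0) < 1 \<longrightarrow>
      (\<exists>\<omega>. cmod \<omega> = 1 \<and> (\<forall>z. cmod z < 1 \<longrightarrow> h z = (h 0 + \<omega> * z) / (1 + cnj (h 0) * \<omega> * z))))"
  proof (rule disjE[OF norm_less_1_or_constant[OF h le]])
    assume const: "(\<forall>z. cmod z < 1 \<longrightarrow> h z = h 0) \<and> cmod (h 0) = 1"
    have "(h has_field_derivative 0) (at 0)"
    proof (rule has_field_derivative_transform_within[OF DERIV_const[of "h 0"] zero_less_one])
      fix z :: complex assume "dist z 0 < 1"
      then show "h 0 = h z" using const[THEN conjunct1, rule_format, of z] by (metis dist_0_norm dist_commute)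
    qed simp
    then have "deriv h 0 = 0" by (rule DERIV_imp_deriv)
    then show ?thesis using const[THEN conjunct2] by simp
  next
    assume 1: "\<forall>z. cmod z < 1 \<longrightarrow> cmod (h z) < 1"
    define c where "c = h 0"
    have c: "cmod c < 1" using 1 by (auto simp: c_def)
    then have c1: "0 < 1 - (cmod c)\<^sup>2" by (simp add: power_less_one_iff)
    define p where "p z = (h z - c) / (1 - cnj c * h z)" for z
    have nz: "1 - cnj c * h z \<noteq> 0" if "cmod z < 1" for z
      using one_minus_mult_neq_0[of "cnj c" "h z"] c 1 that by (auto simp: less_imp_le)
    have p: "p holomorphic_on ball 0 1" unfolding p_def by (intro holomorphic_intros h) (use nz in auto)
    have p0: "p 0 = 0" by (simp add: p_def c_def)
    have pl: "cmod (p z) < 1" if "cmod z < 1" for z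
      unfolding p_def using 1 that c by (intro norm_moebius_less_1) auto
    have d: "(h has_field_derivative deriv h 0) (at 0)"
      by (rule holomorphic_derivI[OF h]) auto
    have cc: "1 - cnj c * c = of_real (1 - (cmod c)\<^sup>2)"
      by (simp add: complex_norm_square mult.commute del: of_real_power)
    have nz0: "1 - cnj c * c \<noteq> 0" using nz[of 0] by (simp add: c_def)
    have "(p has_field_derivative (deriv h 0 * (1 - cnj c * c) - (c - c) * (- (cnj c * deriv h 0))) / ((1 - cnj c * c) * (1 - cnj c * c))) (at 0)"
      unfolding p_def
    proof (rule DERIV_cong[OF DERIV_divide])
      show "((\<lambda>z. h z - c) has_field_derivative deriv h 0) (at 0)"
        using DERIV_diff[OF d DERIV_const[of c]] by simp
      show "((\<lambda>z. 1 - cnj c * h z) has_field_derivative - (cnj c * deriv h 0)) (at 0)"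
        using DERIV_diff[OF DERIV_const[of 1] DERIV_cmult[OF d, of "cnj c"]] by simp
    qed (use nz0 in \<open>simp_all add: c_def\<close>)
    then have "(p has_field_derivative deriv h 0 / (1 - cnj c * c)) (at 0)"
      using nz0 by simp
    then have "deriv p 0 = deriv h 0 / of_real (1 - (cmod c)\<^sup>2)"
      unfolding cc by (rule DERIV_imp_deriv)
    then have pd: "cmod (deriv p 0) = cmod (deriv h 0) / (1 - (cmod c)\<^sup>2)"
      using c1 by (simp add: norm_divide del: of_real_diff of_real_power)
    have "cmod 0 < 1" by simp
    note S = Schwarz_Lemma[OF p p0 pl this]
    have "cmod (deriv h 0) \<le> 1 - (cmod c)\<^sup>2" using S(2) c1 unfolding pd by (simp add: divide_simps)
    moreover have "\<exists>\<omega>. cmod \<omega> = 1 \<and> (\<forall>z. cmod z < 1 \<longrightarrow> h z = (c + \<omega> * z) / (1 + cnj c * \<omega> * z))"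
      if "cmod (deriv h 0) = 1 - (cmod c)\<^sup>2"
    proof -
      have "cmod (deriv p 0) = 1" using that c1 by (simp add: pd)
      then obtain \<omega> where \<omega>: "\<And>z. cmod z < 1 \<Longrightarrow> p z = \<omega> * z" "cmod \<omega> = 1" using S(3)[OF _ disjI2] by blast
      have "h z = (c + \<omega> * z) / (1 + cnj c * \<omega> * z)" if z: "cmod z < 1" for z
      proof -
        have "h z - c = \<omega> * z * (1 - cnj c * h z)" using \<omega>(1)[OF z] nz[OF z] by (simp add: p_def divide_simps)
        then have "h z * (1 + cnj c * \<omega> * z) = c + \<omega> * z" by (simp add: algebra_simps)
        moreover have "1 + cnj c * (\<omega> * z) \<noteq> 0"
          using c z \<omega>(2) by (intro one_plus_mult_neq_0) (auto simp: norm_mult)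
        ultimately show ?thesis by (simp add: divide_simps mult.assoc)
      qed
      then show ?thesis using \<omega>(2) by blast
    qed
    ultimately show ?thesis by (simp add: c_def)
  qed
  then show "cmod (deriv h 0) \<le> 1 - (cmod (h 0))\<^sup>2" "cmod (deriv h 0) = 1 - (cmod (h 0))\<^sup>2 \<Longrightarrow> cmod (h 0) < 1 \<Longrightarrow>
      \<exists>\<omega>. cmod \<omega> = 1 \<and> (\<forall>z. cmod z < 1 \<longrightarrow> h z = (h 0 + \<omega> * z) / (1 + cnj (h 0) * \<omega> * z))"
    by blast+
qed

lemma egauge_le_1D:
  assumes "0 < m" "egauge m z w \<le> 1" shows "cmod z \<le> 1" "cmod w \<le> 1"
proof -
  have "(cmod z)\<^sup>2 \<le> 1" "cmod w powr (2*m) \<le> 1"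
    using assms powr_ge_zero[of "cmod w" "2*m"] zero_le_power2[of "cmod z"] unfolding egauge_def by linarith+
  then show "cmod z \<le> 1" by (simp add: abs_square_le_1)
  show "cmod w \<le> 1"
    using gr_one_powr[of "cmod w" "2*m"] \<open>cmod w powr (2*m) \<le> 1\<close> assms(1) by linarith
qed

text \<open>The Moebius factor with zero \<beta> has modulus tending to 1 uniformly at the circle,
  so division by it preserves the gauge bound up to any e near the circle, and the maximum principle
  removes e.\<close>

lemma divide_out_zero:
  assumes m: "0 < m" and f: "f holomorphic_on ball 0 1" and g: "g holomorphic_on ball 0 1"
    and le: "\<And>z. cmod z < 1 \<Longrightarrow> egauge m (f z) (g z) \<le> 1"
    and \<beta>: "cmod \<beta> < 1" "g \<beta> = 0"
  obtains q where "q holomorphic_on ball 0 1"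
    "\<And>z. cmod z < 1 \<Longrightarrow> g z = (z - \<beta>) / (1 - cnj \<beta> * z) * q z"
    "\<And>z. cmod z < 1 \<Longrightarrow> egauge m (f z) (q z) \<le> 1"
proof -
  define q0 where "q0 z = (if z = \<beta> then deriv g \<beta> else g z / (z - \<beta>))" for z
  have q0: "q0 holomorphic_on ball 0 1"
    by (rule pole_theorem_open_0[OF g, of \<beta>]) (auto simp: q0_def \<beta>)
  define q where "q z = (1 - cnj \<beta> * z) * q0 z" for z
  have q: "q holomorphic_on ball 0 1" unfolding q_def by (intro holomorphic_intros q0)
  have nz: "1 - cnj \<beta> * z \<noteq> 0" if "cmod z < 1" for z
    using one_minus_mult_neq_0[of "cnj \<beta>" z] \<beta> that by auto
  have gq: "g z = (z - \<beta>) / (1 - cnj \<beta> * z) * q z" if "cmod z < 1" for z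
    using nz[OF that] \<beta>(2) by (simp add: q_def q0_def)
  \<comment> \<open>Comes from |1 - cnj \<beta> z| \<ge> 1 - |\<beta>|: one minus the squared
    modulus of the factor is at most C (1 - |z|^2).\<close>
  define C where "C = (1 - (cmod \<beta>)\<^sup>2) / (1 - cmod \<beta>)\<^sup>2"
  have C: "C > 0" using \<beta> by (auto simp: C_def power_less_one_iff intro!: divide_pos_pos)
  have mo: "1 - C * (1 - (cmod z)\<^sup>2) \<le> (cmod ((z - \<beta>) / (1 - cnj \<beta> * z)))\<^sup>2" if z: "cmod z < 1" for z
  proof -
    have "1 - cmod \<beta> \<le> cmod (1 - cnj \<beta> * z)"
    proof -
      have "cmod (cnj \<beta> * z) \<le> cmod \<beta>" using z by (simp add: norm_mult mult_left_le)
      then show ?thesis using norm_triangle_ineq2[of 1 "cnj \<beta> * z"] by simp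
    qed
    then have "(1 - cmod \<beta>)\<^sup>2 \<le> (cmod (1 - cnj \<beta> * z))\<^sup>2" using \<beta> by (intro power_mono) auto
    then have "(1 - (cmod \<beta>)\<^sup>2) * (1 - (cmod z)\<^sup>2) / (cmod (1 - cnj \<beta> * z))\<^sup>2 \<le> C * (1 - (cmod z)\<^sup>2)"
      unfolding C_def times_divide_eq_left using \<beta> z
      by (intro divide_left_mono mult_pos_pos) (auto simp: power_less_one_iff power_le_one nz intro!: mult_nonneg_nonneg)
    moreover have "(cmod ((z - \<beta>) / (1 - cnj \<beta> * z)))\<^sup>2 = 1 - (1 - (cmod \<beta>)\<^sup>2) * (1 - (cmod z)\<^sup>2) / (cmod (1 - cnj \<beta> * z))\<^sup>2"
      unfolding moebius_identity[symmetric] using nz[OF z] by (simp add: norm_divide divide_simps)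
    ultimately show ?thesis by linarith
  qed
  have "egauge m (f z) (q z) \<le> 1" if "cmod z < 1" for z
  proof (rule egauge_le_1_if_boundary[OF m f q _ that])
    fix e :: real assume e: "e > 0"
    have "((\<lambda>r. (1 - C * (1 - r\<^sup>2)) powr (-m)) \<longlongrightarrow> (1 - C * (1 - 1\<^sup>2)) powr (-m)) (at_left (1::real))"
      by (intro tendsto_intros) auto
    then have "\<forall>\<^sub>F r in at_left (1::real). (1 - C * (1 - r\<^sup>2)) powr (-m) < 1 + e"
      using e by (intro order_tendstoD) auto
    moreover have "((\<lambda>r. (1 - C * (1 - r\<^sup>2))) \<longlongrightarrow> (1 - C * (1 - 1\<^sup>2))) (at_left (1::real))"
      by (intro tendsto_intros)
    then have "\<forall>\<^sub>F r in at_left (1::real). 1 - C * (1 - r\<^sup>2) > 0"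
      by (intro order_tendstoD) auto
    ultimately have "\<forall>\<^sub>F r in at_left (1::real). (1 - C * (1 - r\<^sup>2)) powr (-m) < 1 + e \<and> 1 - C * (1 - r\<^sup>2) > 0"
      by eventually_elim auto
    then obtain r0 where r0: "r0 < 1" "\<And>r. r0 < r \<Longrightarrow> r < 1 \<Longrightarrow>
        (1 - C * (1 - r\<^sup>2)) powr (-m) < 1 + e \<and> 1 - C * (1 - r\<^sup>2) > 0"
      unfolding eventually_at_left_field by blast
    have "egauge m (f z) (q z) \<le> 1 + e" if z: "r0 < cmod z" "cmod z < 1" for z
    proof -
      define \<mu> where "\<mu> = cmod ((z - \<beta>) / (1 - cnj \<beta> * z))"
      have 1: "(1 - C * (1 - (cmod z)\<^sup>2)) powr (-m) < 1 + e" "1 - C * (1 - (cmod z)\<^sup>2) > 0" using r0(2)[OF z] by auto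
      have mu2: "1 - C * (1 - (cmod z)\<^sup>2) \<le> \<mu>\<^sup>2" using mo[OF z(2)] by (simp add: \<mu>_def)
      have mu: "0 < \<mu>" using mu2 1(2) by (cases "\<mu> = 0") (auto simp: \<mu>_def)
      have mu1: "\<mu> < 1" unfolding \<mu>_def using norm_moebius_less_1[OF \<beta>(1) z(2)] .
      have gz: "cmod (g z) powr (2*m) = \<mu> powr (2*m) * cmod (q z) powr (2*m)"
        unfolding gq[OF z(2)] norm_mult \<mu>_def by (simp add: powr_mult)
      have mp: "0 < \<mu> powr (2*m)" "\<mu> powr (2*m) \<le> 1" using mu mu1 m by (auto simp: powr_le1)
      \<comment> \<open>The factor belongs to the second term only; since
        \<open>\<mu> powr (2*m)\<close> is at most 1, applying it to the first term as well only
        decreases the sum.\<close>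
      have "\<mu> powr (2*m) * egauge m (f z) (q z) \<le> egauge m (f z) (g z)"
        unfolding egauge_def gz using mp by (simp add: algebra_simps mult_left_le mult_left_le_one_le)
      also have "\<dots> \<le> 1" using le z by auto
      finally have "egauge m (f z) (q z) \<le> \<mu> powr (-(2*m))"
        using mp by (simp add: powr_minus divide_simps mult.commute)
      also have "\<mu> powr (-(2*m)) = (\<mu>\<^sup>2) powr (-m)" using mu by (simp add: powr_powr flip: powr_numeral)
      also have "\<dots> \<le> (1 - C * (1 - (cmod z)\<^sup>2)) powr (-m)"
        using mu2 1(2) m by (intro powr_mono2') auto
      finally show ?thesis using 1(1) by simp
    qed
    then show "\<exists>r0<1. \<forall>z. r0 < cmod z \<and> cmod z < 1 \<longrightarrow> egauge m (f z) (q z) \<le> 1 + e" using r0(1) by blast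
  qed
  then show ?thesis using that q gq by blast
qed

text \<open>The compactness that makes an optimal factorization exist; pointwise convergence is
  enough to pass all its constraints to the limit.\<close>

lemma Montel_unit_ball:
  fixes \<F> :: "nat \<Rightarrow> complex \<Rightarrow> complex"
  assumes "\<And>n. \<F> n holomorphic_on ball 0 1" "\<And>n z. cmod z < 1 \<Longrightarrow> cmod (\<F> n z) \<le> 1"
  obtains g r where "g holomorphic_on ball 0 1" "strict_mono (r :: nat \<Rightarrow> nat)"
    "\<And>z. cmod z < 1 \<Longrightarrow> (\<lambda>n. \<F> (r n) z) \<longlonglongrightarrow> g z"
proof (rule Montel[of "ball 0 1" "{h. h holomorphic_on ball 0 1 \<and> (\<forall>z\<in>ball 0 1. cmod (h z) \<le> 1)}" \<F>])
  fix K :: "complex set" assume "K \<subseteq> ball 0 1"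
  then show "\<exists>B. \<forall>h\<in>{h. h holomorphic_on ball 0 1 \<and> (\<forall>z\<in>ball 0 1. cmod (h z) \<le> 1)}. \<forall>z\<in>K. cmod (h z) \<le> B"
    by (intro exI[of _ 1]) blast
qed (use assms that in auto)

text \<open>Among all factorizations \<open>F = B G\<close> with these bounds, one that maximizes \<open>|G 0|\<close> has no
  zeros left in \<open>G\<close>: a zero could be moved to \<open>B\<close>. This replaces the Blaschke product.\<close>

lemma zero_free_factor:
  assumes m: "0 < m" and f: "f holomorphic_on ball 0 1" and F: "F holomorphic_on ball 0 1"
    and le: "\<And>z. cmod z < 1 \<Longrightarrow> egauge m (f z) (F z) \<le> 1" and F0: "F 0 \<noteq> 0"
  obtains B G where "B holomorphic_on ball 0 1" "G holomorphic_on ball 0 1"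
    "\<And>z. cmod z < 1 \<Longrightarrow> F z = B z * G z" "\<And>z. cmod z < 1 \<Longrightarrow> cmod (B z) \<le> 1"
    "\<And>z. cmod z < 1 \<Longrightarrow> G z \<noteq> 0" "\<And>z. cmod z < 1 \<Longrightarrow> egauge m (f z) (G z) \<le> 1"
proof -
  define Q where "Q B G \<longleftrightarrow> B holomorphic_on ball 0 1 \<and> G holomorphic_on ball 0 1 \<and>
    (\<forall>z. cmod z < 1 \<longrightarrow> F z = B z * G z \<and> cmod (B z) \<le> 1 \<and> egauge m (f z) (G z) \<le> 1)" for B G
  define S where "S = {cmod (G 0) | B G. Q B G}"
  have "Q (\<lambda>_. 1) F" unfolding Q_def using F le by auto
  then have FS: "cmod (F 0) \<in> S" unfolding S_def by blast
  have bdd: "bdd_above S"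
    by (rule bdd_aboveI[of _ 1]) (use egauge_le_1D(2)[OF m, of "f 0"] in \<open>auto simp: S_def Q_def\<close>)
  have "\<exists>B G. Q B G \<and> Sup S - inverse (Suc n) < cmod (G 0)" for n
  proof -
    have "\<exists>y\<in>S. Sup S - inverse (Suc n) < y"
      using FS bdd by (subst less_cSup_iff[symmetric]) auto
    then show ?thesis by (auto simp: S_def)
  qed
  then obtain Bn Gn where BG: "\<And>n. Q (Bn n) (Gn n)" "\<And>n. Sup S - inverse (Suc n) < cmod (Gn n 0)"
    by metis
  have Gb: "Gn n holomorphic_on ball 0 1" "cmod z < 1 \<Longrightarrow> cmod (Gn n z) \<le> 1" for n z
    using BG(1)[of n] egauge_le_1D(2)[OF m, of "f z" "Gn n z"] by (auto simp: Q_def)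
  have Bb: "Bn n holomorphic_on ball 0 1" "cmod z < 1 \<Longrightarrow> cmod (Bn n z) \<le> 1" for n z
    using BG(1)[of n] by (auto simp: Q_def)
  obtain B r where B: "B holomorphic_on ball 0 1" "strict_mono r" "\<And>z. cmod z < 1 \<Longrightarrow> (\<lambda>n. Bn (r n) z) \<longlonglongrightarrow> B z"
    using Montel_unit_ball[of Bn] Bb by blast
  \<comment> \<open>The second extraction runs along the first subsequence, so that B and G are
    limits along common indices.\<close>
  obtain G r' where G: "G holomorphic_on ball 0 1" "strict_mono r'" "\<And>z. cmod z < 1 \<Longrightarrow> (\<lambda>n. Gn (r (r' n)) z) \<longlonglongrightarrow> G z"
    using Montel_unit_ball[of "\<lambda>n. Gn (r n)"] Gb by blast
  have B': "(\<lambda>n. Bn (r (r' n)) z) \<longlonglongrightarrow> B z" if "cmod z < 1" for z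
    using LIMSEQ_subseq_LIMSEQ[OF B(3)[OF that] G(2)] by (simp add: o_def)
  have QBG: "Q B G" unfolding Q_def
  proof (intro conjI allI impI B G)
    fix z :: complex assume z: "cmod z < 1"
    have "(\<lambda>n. Bn (r (r' n)) z * Gn (r (r' n)) z) \<longlonglongrightarrow> B z * G z" by (intro tendsto_mult B' G z)
    moreover have "Bn (r (r' n)) z * Gn (r (r' n)) z = F z" for n using BG(1) z by (auto simp: Q_def)
    ultimately show "F z = B z * G z" by (simp add: LIMSEQ_const_iff)
    show "cmod (B z) \<le> 1"
      by (rule LIMSEQ_le_const2[OF tendsto_norm[OF B'[OF z]]]) (use BG(1) z in \<open>auto simp: Q_def\<close>)
    have "(\<lambda>n. egauge m (f z) (Gn (r (r' n)) z)) \<longlonglongrightarrow> egauge m (f z) (G z)"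
      unfolding egauge_def using m
      by (intro tendsto_add tendsto_const tendsto_powr' tendsto_norm G z) auto
    then show "egauge m (f z) (G z) \<le> 1"
      by (rule LIMSEQ_le_const2) (use BG(1) z in \<open>auto simp: Q_def\<close>)
  qed
  have "(\<lambda>n. Sup S - inverse (Suc (r (r' n)))) \<longlonglongrightarrow> Sup S - 0"
    using LIMSEQ_subseq_LIMSEQ[OF LIMSEQ_inverse_real_of_nat strict_mono_o[OF B(2) G(2)]]
    by (intro tendsto_intros) (simp add: o_def)
  then have "Sup S \<le> cmod (G 0)"
    by (intro LIMSEQ_le[OF _ tendsto_norm[OF G(3)[of 0]], of _ "Sup S"])
       (use less_imp_le[OF BG(2)] in \<open>simp_all only: diff_0_right norm_zero zero_less_one, blast\<close>)
  then have max: "cmod (G' 0) \<le> cmod (G 0)" if "Q B' G'" for B' G'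
    using cSup_upper[OF _ bdd, of "cmod (G' 0)"] that by (force simp: S_def)
  have "G \<beta> \<noteq> 0" if \<beta>: "cmod \<beta> < 1" for \<beta>
  proof
    assume "G \<beta> = 0"
    then obtain q where q: "q holomorphic_on ball 0 1"
      "\<And>z. cmod z < 1 \<Longrightarrow> G z = (z - \<beta>) / (1 - cnj \<beta> * z) * q z"
      "\<And>z. cmod z < 1 \<Longrightarrow> egauge m (f z) (q z) \<le> 1"
      using divide_out_zero[OF m f G(1) _ \<beta>] QBG by (auto simp: Q_def)
    have nz: "1 - cnj \<beta> * z \<noteq> 0" if "cmod z < 1" for z
      using one_minus_mult_neq_0[of "cnj \<beta>" z] \<beta> that by auto
    have "Q (\<lambda>z. B z * ((z - \<beta>) / (1 - cnj \<beta> * z))) q"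
      unfolding Q_def
    proof (intro conjI allI impI q)
      show "(\<lambda>z. B z * ((z - \<beta>) / (1 - cnj \<beta> * z))) holomorphic_on ball 0 1"
        by (intro holomorphic_intros B) (use nz in auto)
      fix z :: complex assume z: "cmod z < 1"
      show "F z = B z * ((z - \<beta>) / (1 - cnj \<beta> * z)) * q z"
        using QBG q(2)[OF z] z by (simp add: Q_def)
      show "cmod (B z * ((z - \<beta>) / (1 - cnj \<beta> * z))) \<le> 1"
        using QBG z norm_moebius_less_1[OF \<beta> z] unfolding norm_mult
        by (intro mult_le_one) (auto simp: Q_def)
    qed
    \<comment> \<open>Since G 0 = - \<beta> q 0, maximality reads |q 0| \<le> |\<beta>| |q 0|, which
      is impossible for q 0 \<noteq> 0 and |\<beta>| < 1.\<close>
    from max[OF this] have "cmod (q 0) \<le> cmod \<beta> * cmod (q 0)" using q(2)[of 0] by (simp add: norm_mult)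
    moreover have "q 0 \<noteq> 0" using F0 QBG q(2)[of 0] by (auto simp: Q_def)
    ultimately show False using \<beta> by (simp add: mult_le_cancel_right1)
  qed
  with that QBG show ?thesis by (auto simp: Q_def)
qed

section \<open>Schwarz lemmas for the ball and for zero-free components\<close>

lemma egauge_1: "egauge 1 z w = (cmod z)\<^sup>2 + (cmod w)\<^sup>2"
  by (cases "w = 0") (simp_all add: egauge_def)

text \<open>Dividing f and g by z multiplies the squared norm by 1 / |z|^2, which tends to 1, so the
  quotients still map into the closed ball. Equality at 0 makes them constant by the strict maximum
  principle.\<close>

lemma ball_Schwarz_at_0:
  assumes f: "f holomorphic_on ball 0 1" and g: "g holomorphic_on ball 0 1"
    and f0: "f 0 = 0" and g0: "g 0 = 0"
    and le: "\<And>z. cmod z < 1 \<Longrightarrow> (cmod (f z))\<^sup>2 + (cmod (g z))\<^sup>2 \<le> 1"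
  shows "(cmod (deriv f 0))\<^sup>2 + (cmod (deriv g 0))\<^sup>2 \<le> 1"
    and "(cmod (deriv f 0))\<^sup>2 + (cmod (deriv g 0))\<^sup>2 = 1 \<Longrightarrow> cmod z < 1 \<Longrightarrow>
      f z = deriv f 0 * z \<and> g z = deriv g 0 * z"
proof -
  obtain \<phi> where \<phi>: "\<phi> holomorphic_on ball 0 1" "\<And>z. cmod z < 1 \<Longrightarrow> f z = z * \<phi> z" "deriv f 0 = \<phi> 0"
    using Schwarz3[OF f f0] by blast
  obtain \<gamma> where \<gamma>: "\<gamma> holomorphic_on ball 0 1" "\<And>z. cmod z < 1 \<Longrightarrow> g z = z * \<gamma> z" "deriv g 0 = \<gamma> 0"
    using Schwarz3[OF g g0] by blast
  have le1: "egauge 1 (\<phi> z) (\<gamma> z) \<le> 1" if "cmod z < 1" for z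
  proof (rule egauge_le_1_if_boundary[OF _ \<phi>(1) \<gamma>(1) _ that])
    fix e :: real assume e: "e > 0"
    have "((\<lambda>r. 1 / r\<^sup>2) \<longlongrightarrow> 1 / 1\<^sup>2) (at_left (1::real))" by (intro tendsto_intros) auto
    then have "\<forall>\<^sub>F r in at_left (1::real). 1 / r\<^sup>2 < 1 + e" using e by (intro order_tendstoD) auto
    then obtain r0 where r0: "r0 < 1" "\<And>r. r0 < r \<Longrightarrow> r < 1 \<Longrightarrow> 1 / r\<^sup>2 < 1 + e"
      by (auto simp: eventually_at_left_field)
    have "egauge 1 (\<phi> z) (\<gamma> z) \<le> 1 + e" if z: "max r0 0 < cmod z" "cmod z < 1" for z
    proof -
      have "(cmod z)\<^sup>2 * egauge 1 (\<phi> z) (\<gamma> z) \<le> 1"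
        using le[OF z(2)] \<phi>(2)[OF z(2)] \<gamma>(2)[OF z(2)]
        by (simp add: egauge_1 norm_mult power_mult_distrib distrib_left)
      then have "egauge 1 (\<phi> z) (\<gamma> z) \<le> 1 / (cmod z)\<^sup>2" using z by (simp add: field_simps)
      then show ?thesis using r0(2)[of "cmod z"] z by simp
    qed
    then show "\<exists>r0<1. \<forall>z. r0 < cmod z \<and> cmod z < 1 \<longrightarrow> egauge 1 (\<phi> z) (\<gamma> z) \<le> 1 + e"
      using r0(1) by (intro exI[of _ "max r0 0"]) auto
  qed simp
  have eg: "egauge 1 (\<phi> 0) (\<gamma> 0) = (cmod (deriv f 0))\<^sup>2 + (cmod (deriv g 0))\<^sup>2"
    unfolding \<phi>(3) \<gamma>(3) egauge_1 ..
  show "(cmod (deriv f 0))\<^sup>2 + (cmod (deriv g 0))\<^sup>2 \<le> 1" using le1[of 0] eg by simp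
  assume eq: "(cmod (deriv f 0))\<^sup>2 + (cmod (deriv g 0))\<^sup>2 = 1" and z: "cmod z < 1"
  have "\<phi> z = \<phi> 0" "\<gamma> z = \<gamma> 0"
    using egauge_strict_max[OF zero_less_one \<phi>(1) \<gamma>(1), of 0 z] le1 eg eq z by auto
  then show "f z = deriv f 0 * z \<and> g z = deriv g 0 * z" using \<phi> \<gamma> z by auto
qed

text \<open>Reduces to \<open>ball_Schwarz_at_0\<close> by the involution
  \<open>(z\<^sub>1, z\<^sub>2) \<mapsto> (\<surd>(1 - s) z\<^sub>1, q - z\<^sub>2) / (1 - cnj q z\<^sub>2)\<close>, an automorphism of the ball that exchanges
  \<open>(0, q)\<close> and the origin.\<close>

lemma ball_Schwarz:
  assumes f: "f holomorphic_on ball 0 1" and g: "g holomorphic_on ball 0 1"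
    and f0: "f 0 = 0" and q: "g 0 = q" and s: "s = (cmod q)\<^sup>2" "s < 1"
    and le: "\<And>z. cmod z < 1 \<Longrightarrow> (cmod (f z))\<^sup>2 + (cmod (g z))\<^sup>2 \<le> 1"
  shows "(cmod (deriv f 0))\<^sup>2 / (1 - s) + (cmod (deriv g 0))\<^sup>2 / (1 - s)\<^sup>2 \<le> 1"
    and "(cmod (deriv f 0))\<^sup>2 / (1 - s) + (cmod (deriv g 0))\<^sup>2 / (1 - s)\<^sup>2 = 1 \<Longrightarrow>
      \<exists>u w. (cmod u)\<^sup>2 + (cmod w)\<^sup>2 = 1 \<and> (\<forall>z. cmod z < 1 \<longrightarrow>
        f z = of_real (sqrt (1 - s)) * u * z / (1 - cnj q * w * z) \<and> g z = (q - w * z) / (1 - cnj q * w * z))"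
proof -
  have q1: "cmod q < 1" using s by (simp add: abs_square_less_1)
  have s1: "0 < 1 - s" using s by simp
  have g1: "cmod (g z) \<le> 1" if "cmod z < 1" for z
    using egauge_le_1D(2)[OF zero_less_one, of "f z" "g z"] le[OF that] unfolding egauge_1 by simp
  have nz: "1 - cnj q * g z \<noteq> 0" if "cmod z < 1" for z
    using one_minus_mult_neq_0[of "cnj q" "g z"] q1 g1[OF that] by simp
  define F G where "F z = sqrt (1 - s) * f z / (1 - cnj q * g z)" and "G z = (q - g z) / (1 - cnj q * g z)" for z
  have F: "F holomorphic_on ball 0 1" and G: "G holomorphic_on ball 0 1"
    unfolding F_def G_def by (intro holomorphic_intros f g; use nz in auto)+
  have F0: "F 0 = 0" and G0: "G 0 = 0" by (auto simp: F_def G_def f0 q)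
  have FG: "(cmod (F z))\<^sup>2 + (cmod (G z))\<^sup>2 \<le> 1" if z: "cmod z < 1" for z
  proof -
    \<comment> \<open>The involution maps the ball into itself: replace |f|^2 by 1 - |g|^2 and apply
      the Moebius identity to q and g z.\<close>
    have "(1 - s) * (cmod (f z))\<^sup>2 + (cmod (g z - q))\<^sup>2 \<le> (cmod (1 - cnj q * g z))\<^sup>2"
      using mult_left_mono[OF le[OF z], of "1 - s"] s1 moebius_identity[of q "g z"] s(1)
      by (simp add: algebra_simps)
    moreover have "0 < (cmod (1 - cnj q * g z))\<^sup>2" using nz[OF z] by simp
    ultimately show ?thesis unfolding F_def G_def norm_divide norm_mult power_divide power_mult_distrib
      using s1 by (simp add: norm_minus_commute flip: add_divide_distrib)
  qed
  have df: "(f has_field_derivative deriv f 0) (at 0)" and dg: "(g has_field_derivative deriv g 0) (at 0)"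
    by (rule holomorphic_derivI[OF f] holomorphic_derivI[OF g]; simp)+
  have qq: "1 - cnj q * q = of_real (1 - s)"
    using s(1) by (simp add: complex_norm_square mult.commute del: of_real_power)
  have dd: "((\<lambda>z. 1 - cnj q * g z) has_field_derivative - (cnj q * deriv g 0)) (at 0)"
    using DERIV_diff[OF DERIV_const[of 1] DERIV_cmult[OF dg, of "cnj q"]] by simp
  have "deriv F 0 = ((sqrt (1 - s) * deriv f 0) * (1 - cnj q * g 0) - (sqrt (1 - s) * f 0) * (- (cnj q * deriv g 0))) / ((1 - cnj q * g 0) * (1 - cnj q * g 0))"
    unfolding F_def by (rule DERIV_imp_deriv[OF DERIV_divide[OF DERIV_cmult[OF df] dd]]) (use nz[of 0] in simp)
  then have dF: "deriv F 0 = of_real (sqrt (1 - s)) * deriv f 0 / of_real (1 - s)"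
    unfolding q f0 qq using s1 by (simp del: of_real_diff)
  have "deriv G 0 = ((0 - deriv g 0) * (1 - cnj q * g 0) - (q - g 0) * (- (cnj q * deriv g 0))) / ((1 - cnj q * g 0) * (1 - cnj q * g 0))"
    unfolding G_def by (rule DERIV_imp_deriv[OF DERIV_divide[OF DERIV_diff[OF DERIV_const dg] dd]]) (use nz[of 0] in simp)
  then have dG: "deriv G 0 = - deriv g 0 / of_real (1 - s)"
    unfolding q qq using s1 by (simp del: of_real_diff)
  have nF: "(cmod (deriv F 0))\<^sup>2 = (cmod (deriv f 0))\<^sup>2 / (1 - s)"
    unfolding dF using s1 by (simp add: norm_divide norm_mult power_divide power_mult_distrib del: of_real_diff) (simp add: power2_eq_square)
  have nG: "(cmod (deriv G 0))\<^sup>2 = (cmod (deriv g 0))\<^sup>2 / (1 - s)\<^sup>2"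
    unfolding dG using s1 by (simp add: norm_divide power_divide del: of_real_diff)
  note S = ball_Schwarz_at_0[OF F G F0 G0 FG]
  show "(cmod (deriv f 0))\<^sup>2 / (1 - s) + (cmod (deriv g 0))\<^sup>2 / (1 - s)\<^sup>2 \<le> 1"
    using S(1) unfolding nF nG by blast
  assume "(cmod (deriv f 0))\<^sup>2 / (1 - s) + (cmod (deriv g 0))\<^sup>2 / (1 - s)\<^sup>2 = 1"
  then have eq: "(cmod (deriv F 0))\<^sup>2 + (cmod (deriv G 0))\<^sup>2 = 1" unfolding nF nG .
  define u w where "u = deriv F 0" and "w = deriv G 0"
  have "f z = sqrt (1 - s) * u * z / (1 - cnj q * w * z) \<and> g z = (q - w * z) / (1 - cnj q * w * z)" if z: "cmod z < 1" for z
  proof -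
    have Fz: "F z = u * z" and Gz: "G z = w * z" using S(2)[OF _ eq z] by (auto simp: u_def w_def)
    define d where "d = 1 - cnj q * g z"
    have d: "d \<noteq> 0" using nz[OF z] by (simp add: d_def)
    have "q - g z = w * z * d" using Gz d by (simp add: G_def d_def[symmetric] divide_simps)
    then have gz: "g z * (1 - cnj q * w * z) = q - w * z" unfolding d_def by (simp add: algebra_simps)
    have "cmod (w * z) \<le> 1"
    proof -
      have "(cmod w)\<^sup>2 \<le> 1" using eq zero_le_power2[of "cmod u"] unfolding u_def w_def by linarith
      then have "cmod w \<le> 1" by (simp add: abs_square_le_1)
      then show ?thesis using z by (simp add: norm_mult mult_le_one)
    qed
    then have nw: "1 - cnj q * w * z \<noteq> 0" using one_minus_mult_neq_0[of "cnj q" "w * z"] q1 by (simp add: mult.assoc)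
    \<comment> \<open>The involution is its own inverse, so the denominators at g z and at its image
      w z multiply to 1 - s.\<close>
    have dw: "d * (1 - cnj q * w * z) = of_real (1 - s)"
    proof -
      have "d * (1 - cnj q * w * z) = (1 - cnj q * w * z) - cnj q * (g z * (1 - cnj q * w * z))" by (simp add: d_def algebra_simps)
      also have "\<dots> = 1 - cnj q * q" unfolding gz by (simp add: algebra_simps)
      finally show ?thesis unfolding qq .
    qed
    define r where "r = complex_of_real (sqrt (1 - s))"
    have r: "r \<noteq> 0" "r * r = of_real (1 - s)" using s1 unfolding r_def of_real_mult[symmetric] by auto
    have "r * f z = u * z * d" using Fz d by (simp add: F_def d_def[symmetric] r_def divide_simps)
    then have "r * f z * (1 - cnj q * w * z) = u * z * (d * (1 - cnj q * w * z))" by (simp add: mult.assoc)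
    also have "\<dots> = u * z * (r * r)" unfolding dw r(2) ..
    finally have "r * f z * (1 - cnj q * w * z) = u * z * (r * r)" .
    then have "f z * (1 - cnj q * w * z) = r * u * z" using r(1) by (simp add: ac_simps)
    then show ?thesis using gz nw by (simp add: r_def nonzero_eq_divide_eq)
  qed
  then show "\<exists>u w. (cmod u)\<^sup>2 + (cmod w)\<^sup>2 = 1 \<and> (\<forall>z. cmod z < 1 \<longrightarrow>
        f z = of_real (sqrt (1 - s)) * u * z / (1 - cnj q * w * z) \<and> g z = (q - w * z) / (1 - cnj q * w * z))"
    using eq unfolding u_def w_def by blast
qed

section \<open>A sharp bound for the logarithmic derivative of a zero-free component\<close>

lemma ex_rotation: "\<exists>u. cmod u = 1 \<and> u * a = of_real (cmod a)"
proof (cases "a = 0")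
  case True
  then show ?thesis by (intro exI[of _ 1]) simp
next
  case False
  then show ?thesis
    by (intro exI[of _ "cnj a / of_real (cmod a)"])
       (simp add: norm_divide complex_norm_square[symmetric] mult.commute power2_eq_square flip: of_real_power)
qed

lemma Re_one_minus_pos: "cmod z < 1 \<Longrightarrow> 0 < Re (1 - z)"
  using abs_Re_le_cmod[of z] by auto

lemma Re_one_plus_pos: "cmod z < 1 \<Longrightarrow> 0 < Re (1 + z)"
  using abs_Re_le_cmod[of z] by auto

lemma Re_of_real_mult: "Re (of_real a * z) = a * Re z"
  by simp

lemma nonzero_if_Re_pos: "0 < Re z \<Longrightarrow> z \<noteq> 0"
  by auto

lemma not_nonpos_Reals_if_Re_pos: "0 < Re z \<Longrightarrow> z \<notin> \<real>\<^sub>\<le>\<^sub>0"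
  by (auto simp: complex_nonpos_Reals_iff)

lemma Re_nonneg_at_0_if_circle:
  assumes \<Phi>: "\<Phi> holomorphic_on ball 0 1" and r: "0 < r" "r < 1"
    and le: "\<And>z. cmod z = r \<Longrightarrow> 0 \<le> Re (\<Phi> z)"
  shows "0 \<le> Re (\<Phi> 0)"
proof -
  have sub: "cball 0 r \<subseteq> ball (0::complex) 1" using r by auto
  have "Re (- \<Phi> 0) \<le> 0"
  proof (rule maximum_real_frontier[where S = "ball 0 r" and f = "\<lambda>z. - \<Phi> z" and \<xi> = 0])
    show "(\<lambda>z. - \<Phi> z) holomorphic_on interior (ball 0 r)"
      using \<Phi> r by (intro holomorphic_on_minus) (auto elim: holomorphic_on_subset)
    show "continuous_on (closure (ball 0 r)) (\<lambda>z. - \<Phi> z)"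
      using holomorphic_on_imp_continuous_on[OF \<Phi>] r sub
      by (intro continuous_on_minus) (auto elim: continuous_on_subset)
  qed (use r le in auto)
  then show ?thesis by simp
qed

text \<open>Tangent to \<open>|w\<^sub>1|\<^sup>2 + exp (2 Re w\<^sub>2) \<le> 1\<close> at the disc
  \<open>z \<mapsto> (L z / (1 - \<sigma> z), \<surd>\<sigma> (1 - z) / (1 - \<sigma> z))\<close> with \<open>\<sigma> = 1 - L\<close>, written multiplicatively
  in the second coordinate. On \<open>|z| = r\<close> the resulting inequality says that the real part of a
  function which is holomorphic in the disc is nonnegative.\<close>

lemma zero_free_bound_normalized:
  fixes L y :: real
  assumes f: "f holomorphic_on ball 0 1" and h: "h holomorphic_on ball 0 1"
    and f0: "f 0 = 0" and df: "deriv f 0 = of_real L" and dh: "deriv h 0 = - of_real y"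
    and L: "0 \<le> L" "L < 1"
    and le: "\<And>z. cmod z < 1 \<Longrightarrow> (cmod (f z))\<^sup>2 + exp (2 * Re (h z)) \<le> 1"
  shows "y \<le> L + ln (1 - L) - 2 * Re (h 0)"
proof -
  define \<sigma> where "\<sigma> = 1 - L"
  have \<sigma>: "0 < \<sigma>" "\<sigma> \<le> 1" using L by (auto simp: \<sigma>_def)
  obtain \<phi> where \<phi>: "\<phi> holomorphic_on ball 0 1" "\<And>z. cmod z < 1 \<Longrightarrow> f z = z * \<phi> z" "\<phi> 0 = of_real L"
    by (rule Schwarz3[OF f f0]) (use df that in auto)
  have \<sigma>z: "cmod (of_real \<sigma> * z) < 1" if "cmod z < 1" for z :: complex
    using that \<sigma> mult_left_le_one_le[of "cmod z" \<sigma>] by (simp add: norm_mult)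
  \<comment> \<open>Logarithm of the second model coordinate without the factor \<surd>\<sigma>.
    Thus \<open>k = h - l\<close> measures the deviation from the model, for which 2 Re k is the
    constant ln \<sigma>.\<close>
  define l where "l z = Ln (1 - z) - Ln (1 - of_real \<sigma> * z)" for z
  have pos: "0 < Re (1 - z)" "0 < Re (1 - of_real \<sigma> * z)" if "cmod z < 1" for z
    using Re_one_minus_pos[OF that] Re_one_minus_pos[OF \<sigma>z[OF that]] by auto
  note cut = not_nonpos_Reals_if_Re_pos[OF pos(1)] not_nonpos_Reals_if_Re_pos[OF pos(2)]
  define k where "k z = h z - l z" for z
  have l: "l holomorphic_on ball 0 1" unfolding l_def
    by (intro holomorphic_intros) (use cut in auto)
  have k: "k holomorphic_on ball 0 1" unfolding k_def by (intro holomorphic_intros h l)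
  have dl: "(l has_field_derivative - of_real L) (at 0)"
    unfolding l_def by (auto intro!: derivative_eq_intros simp: \<sigma>_def)
  have dh0: "(h has_field_derivative - of_real y) (at 0)"
    using holomorphic_derivI[OF h open_ball, of 0] dh by simp
  have "(k has_field_derivative - of_real y + of_real L) (at 0)"
    unfolding k_def using DERIV_diff[OF dh0 dl] by simp
  from DERIV_diff[OF this DERIV_const[of "k 0"]]
  have dk: "((\<lambda>z. k z - k 0) has_field_derivative - of_real y + of_real L) (at 0)" by simp
  have k0: "k 0 = h 0" by (simp add: k_def l_def)
  obtain \<kappa> where \<kappa>: "\<kappa> holomorphic_on ball 0 1" "\<And>z. cmod z < 1 \<Longrightarrow> k z - k 0 = z * \<kappa> z"
    "\<kappa> 0 = - of_real y + of_real L"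
  proof (rule Schwarz3[of "\<lambda>z. k z - k 0" 1])
    show "(\<lambda>z. k z - k 0) holomorphic_on ball 0 1" by (intro holomorphic_intros k)
  qed (use DERIV_imp_deriv[OF dk] that in auto)
  have main: "0 \<le> 1 + \<sigma>\<^sup>2 * r\<^sup>2 - L\<^sup>2 * r\<^sup>2 - \<sigma> * (1 - ln \<sigma>) * (1 + r\<^sup>2) - 2 * \<sigma> * ((1 + r\<^sup>2) * Re (h 0) - r\<^sup>2 * (L - y))"
    if r: "0 < r" "r < 1" for r
  proof -
    \<comment> \<open>The product 2 Re z * Re (k z) is not the real part of a holomorphic function
      as it stands. On |z| = r, however, cnj z * k z = cnj z * k 0 + r^2 \<kappa> z, and cnj z * k 0
      has the real part of cnj (k 0) * z; these substitutes make \<Phi> holomorphic.\<close>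
    define \<Phi> where "\<Phi> z = of_real (1 + \<sigma>\<^sup>2 * r\<^sup>2 + L\<^sup>2 * r\<^sup>2) - of_real (2 * \<sigma>) * z - of_real (2 * L * r\<^sup>2) * ((1 - of_real \<sigma> * z) * \<phi> z)
      - of_real (\<sigma> * (1 - ln \<sigma>)) * (of_real (1 + r\<^sup>2) - of_real 2 * z)
      - of_real (2 * \<sigma>) * (of_real (1 + r\<^sup>2) * k z - (z * k z + of_real (r\<^sup>2) * \<kappa> z + cnj (k 0) * z))" for z
    have "\<Phi> holomorphic_on ball 0 1" unfolding \<Phi>_def by (intro holomorphic_intros \<phi>(1) k \<kappa>(1))
    moreover have "0 \<le> Re (\<Phi> z)" if z: "cmod z = r" for z
    proof -
      have z1: "cmod z < 1" using z r by simp
      have zz: "z * cnj z = of_real (r\<^sup>2)" using z by (simp add: complex_norm_square[symmetric] del: of_real_power)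
      define A where "A = (1 - of_real \<sigma> * z) * \<phi> z"
      have n1: "(cmod (1 - of_real \<sigma> * z))\<^sup>2 = 1 + \<sigma>\<^sup>2 * r\<^sup>2 - 2 * \<sigma> * Re z"
        unfolding z[symmetric] cmod_power2 by (simp add: power2_eq_square algebra_simps)
      have n2: "(cmod (1 - z))\<^sup>2 = 1 + r\<^sup>2 - 2 * Re z"
        unfolding z[symmetric] cmod_power2 by (simp add: power2_eq_square algebra_simps)
      \<comment> \<open>Tangent to the square at L, the constant value of A on the model
        disc.\<close>
      have a: "2 * L * r\<^sup>2 * Re A - L\<^sup>2 * r\<^sup>2 \<le> (cmod (1 - of_real \<sigma> * z))\<^sup>2 * (cmod (f z))\<^sup>2"
      proof -
        have "(cmod (1 - of_real \<sigma> * z))\<^sup>2 * (cmod (f z))\<^sup>2 = r\<^sup>2 * (cmod A)\<^sup>2"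
          unfolding \<phi>(2)[OF z1] A_def norm_mult power_mult_distrib z by simp
        moreover have "2 * L * Re A - L\<^sup>2 \<le> (cmod A)\<^sup>2"
          using zero_le_power2[of "Re A - L"] zero_le_power2[of "Im A"] unfolding cmod_power2 power2_diff
          by (simp only: algebra_simps)
        then have "r\<^sup>2 * (2 * L * Re A - L\<^sup>2) \<le> r\<^sup>2 * (cmod A)\<^sup>2" by (intro mult_left_mono) auto
        ultimately show ?thesis by (simp add: algebra_simps)
      qed
      \<comment> \<open>Tangent to exp at ln \<sigma>, the value of 2 Re k on the model
        disc.\<close>
      have b: "\<sigma> * (1 - ln \<sigma> + 2 * Re (k z)) * (cmod (1 - z))\<^sup>2 \<le> (cmod (1 - of_real \<sigma> * z))\<^sup>2 * exp (2 * Re (h z))"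
      proof -
        have nz: "1 - z \<noteq> 0" "1 - of_real \<sigma> * z \<noteq> 0" by (intro nonzero_if_Re_pos pos z1)+
        have "exp (2 * Re (h z)) = exp (2 * Re (k z)) * exp (2 * Re (l z))" by (simp add: k_def flip: exp_add)
        also have "exp (2 * Re (l z)) = (cmod (1 - z))\<^sup>2 / (cmod (1 - of_real \<sigma> * z))\<^sup>2"
          unfolding l_def using nz by (simp add: exp_double exp_diff power_divide)
        finally have 1: "(cmod (1 - of_real \<sigma> * z))\<^sup>2 * exp (2 * Re (h z)) = exp (2 * Re (k z)) * (cmod (1 - z))\<^sup>2"
          using nz by simp
        have "1 + (2 * Re (k z) - ln \<sigma>) \<le> exp (2 * Re (k z) - ln \<sigma>)" by (rule exp_ge_add_one_self)
        then have "\<sigma> * (1 - ln \<sigma> + 2 * Re (k z)) \<le> exp (2 * Re (k z))"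
          using \<sigma> by (simp add: exp_diff divide_simps algebra_simps)
        then show ?thesis unfolding 1 by (intro mult_right_mono) auto
      qed
      have "(cmod (1 - of_real \<sigma> * z))\<^sup>2 * ((cmod (f z))\<^sup>2 + exp (2 * Re (h z))) \<le> (cmod (1 - of_real \<sigma> * z))\<^sup>2 * 1"
        using le[OF z1] by (intro mult_left_mono) auto
      then have c: "0 \<le> 1 + \<sigma>\<^sup>2 * r\<^sup>2 - 2 * \<sigma> * Re z - (2 * L * r\<^sup>2 * Re A - L\<^sup>2 * r\<^sup>2)
           - \<sigma> * (1 - ln \<sigma> + 2 * Re (k z)) * (1 + r\<^sup>2 - 2 * Re z)"
        using a b[unfolded n2] n1 unfolding distrib_left mult_1_right by linarith
      have "2 * Re z * Re (k z) = Re (z * k z) + Re (cnj z * k z)" by simp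
      also have "cnj z * k z = cnj z * k 0 + of_real (r\<^sup>2) * \<kappa> z"
      proof -
        have "k z = k 0 + z * \<kappa> z" using \<kappa>(2)[OF z1] by (simp add: algebra_simps)
        then have "cnj z * k z = cnj z * k 0 + (z * cnj z) * \<kappa> z" by (simp add: algebra_simps)
        then show ?thesis unfolding zz .
      qed
      also have "Re (\<dots>) = Re (cnj (k 0) * z) + r\<^sup>2 * Re (\<kappa> z)" by simp
      finally have "2 * Re z * Re (k z) = Re (z * k z) + (Re (cnj (k 0) * z) + r\<^sup>2 * Re (\<kappa> z))" .
      moreover have "Re (of_real (r\<^sup>2) * \<kappa> z) = r\<^sup>2 * Re (\<kappa> z)" by simp
      ultimately have d: "2 * Re z * Re (k z) = Re (z * k z + of_real (r\<^sup>2) * \<kappa> z + cnj (k 0) * z)"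
        unfolding plus_complex.sel by linarith
      have "Re (\<Phi> z) = 1 + \<sigma>\<^sup>2 * r\<^sup>2 + L\<^sup>2 * r\<^sup>2 - 2 * \<sigma> * Re z - 2 * L * r\<^sup>2 * Re A
          - \<sigma> * (1 - ln \<sigma>) * (1 + r\<^sup>2 - 2 * Re z) - 2 * \<sigma> * ((1 + r\<^sup>2) * Re (k z) - 2 * Re z * Re (k z))"
      proof -
        define Q where "Q = z * k z + of_real (r\<^sup>2) * \<kappa> z + cnj (k 0) * z"
        have "\<Phi> z = of_real (1 + \<sigma>\<^sup>2 * r\<^sup>2 + L\<^sup>2 * r\<^sup>2) - of_real (2 * \<sigma>) * z - of_real (2 * L * r\<^sup>2) * A
          - of_real (\<sigma> * (1 - ln \<sigma>)) * (of_real (1 + r\<^sup>2) - of_real 2 * z) - of_real (2 * \<sigma>) * (of_real (1 + r\<^sup>2) * k z - Q)"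
          by (simp only: \<Phi>_def A_def Q_def)
        then show ?thesis unfolding d Q_def[symmetric]
          by (simp only: minus_complex.sel Re_of_real_mult Re_complex_of_real)
      qed
      also have "\<dots> = 1 + \<sigma>\<^sup>2 * r\<^sup>2 - 2 * \<sigma> * Re z - (2 * L * r\<^sup>2 * Re A - L\<^sup>2 * r\<^sup>2)
           - \<sigma> * (1 - ln \<sigma> + 2 * Re (k z)) * (1 + r\<^sup>2 - 2 * Re z)" by (simp only: algebra_simps)
      finally show ?thesis using c by linarith
    qed
    ultimately have "0 \<le> Re (\<Phi> 0)" using Re_nonneg_at_0_if_circle[OF _ r] by blast
    also have "Re (\<Phi> 0) = 1 + \<sigma>\<^sup>2 * r\<^sup>2 - L\<^sup>2 * r\<^sup>2 - \<sigma> * (1 - ln \<sigma>) * (1 + r\<^sup>2) - 2 * \<sigma> * ((1 + r\<^sup>2) * Re (h 0) - r\<^sup>2 * (L - y))"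
    proof -
      have "\<kappa> 0 = of_real (L - y)" by (simp add: \<kappa>(3))
      then have "\<Phi> 0 = of_real (1 + \<sigma>\<^sup>2 * r\<^sup>2 + L\<^sup>2 * r\<^sup>2) - of_real (2 * L * r\<^sup>2) * of_real L
          - of_real (\<sigma> * (1 - ln \<sigma>)) * of_real (1 + r\<^sup>2) - of_real (2 * \<sigma>) * (of_real (1 + r\<^sup>2) * h 0 - of_real (r\<^sup>2) * of_real (L - y))"
        by (simp only: \<Phi>_def \<phi>(3) k0 mult_zero_right mult_zero_left diff_zero add_0_right add_0_left mult_1_left)
      then have "Re (\<Phi> 0) = (1 + \<sigma>\<^sup>2 * r\<^sup>2 + L\<^sup>2 * r\<^sup>2) - 2 * L * r\<^sup>2 * L
          - \<sigma> * (1 - ln \<sigma>) * (1 + r\<^sup>2) - 2 * \<sigma> * ((1 + r\<^sup>2) * Re (h 0) - r\<^sup>2 * (L - y))"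
        by (simp only: minus_complex.sel Re_of_real_mult Re_complex_of_real)
      moreover have "2 * L * r\<^sup>2 * L = 2 * (L\<^sup>2 * r\<^sup>2)" by (simp add: power2_eq_square)
      ultimately show ?thesis by linarith
    qed
    finally show ?thesis .
  qed
  have lim: "((\<lambda>r. 1 + \<sigma>\<^sup>2 * r\<^sup>2 - L\<^sup>2 * r\<^sup>2 - \<sigma> * (1 - ln \<sigma>) * (1 + r\<^sup>2) - 2 * \<sigma> * ((1 + r\<^sup>2) * Re (h 0) - r\<^sup>2 * (L - y)))
     \<longlongrightarrow> 1 + \<sigma>\<^sup>2 * 1\<^sup>2 - L\<^sup>2 * 1\<^sup>2 - \<sigma> * (1 - ln \<sigma>) * (1 + 1\<^sup>2) - 2 * \<sigma> * ((1 + 1\<^sup>2) * Re (h 0) - 1\<^sup>2 * (L - y))) (at_left (1::real))"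
    by (intro tendsto_intros)
  have "\<forall>\<^sub>F r in at_left (1::real). 0 < r \<and> r < 1"
    by (auto simp: eventually_at_left_field intro!: exI[of _ 0])
  then have ev: "\<forall>\<^sub>F r in at_left (1::real). 0 \<le> 1 + \<sigma>\<^sup>2 * r\<^sup>2 - L\<^sup>2 * r\<^sup>2 - \<sigma> * (1 - ln \<sigma>) * (1 + r\<^sup>2) - 2 * \<sigma> * ((1 + r\<^sup>2) * Re (h 0) - r\<^sup>2 * (L - y))"
    by eventually_elim (use main in blast)
  have "0 \<le> 1 + \<sigma>\<^sup>2 * 1\<^sup>2 - L\<^sup>2 * 1\<^sup>2 - \<sigma> * (1 - ln \<sigma>) * (1 + 1\<^sup>2) - 2 * \<sigma> * ((1 + 1\<^sup>2) * Re (h 0) - 1\<^sup>2 * (L - y))"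
    by (rule tendsto_lowerbound[OF lim ev]) simp
  \<comment> \<open>1 + \<sigma>^2 - L^2 = 2 \<sigma> because \<sigma> = 1 - L, so every term
    carries the factor 2 \<sigma>.\<close>
  also have "\<dots> = 2 * \<sigma> * (L + ln (1 - L) - 2 * Re (h 0) - y)"
    unfolding \<sigma>_def by (simp add: power2_eq_square algebra_simps)
  finally show ?thesis using \<sigma> by (simp add: zero_le_mult_iff)
qed

text \<open>Rotating z makes the derivative of h at 0 nonpositive, its sign on the model disc. The
  constraint sees only |f|, so the values of f can be rotated independently to make its derivative
  nonnegative.\<close>

lemma zero_free_bound:
  assumes f: "f holomorphic_on ball 0 1" and h: "h holomorphic_on ball 0 1"
    and f0: "f 0 = 0" and L: "cmod (deriv f 0) < 1"
    and le: "\<And>z. cmod z < 1 \<Longrightarrow> (cmod (f z))\<^sup>2 + exp (2 * Re (h z)) \<le> 1"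
  shows "cmod (deriv h 0) \<le> cmod (deriv f 0) + ln (1 - cmod (deriv f 0)) - 2 * Re (h 0)"
proof -
  obtain v where v: "cmod v = 1" "v * deriv h 0 = of_real (cmod (deriv h 0))" using ex_rotation by blast
  define u where "u = - v"
  have u: "cmod u = 1" "u * deriv h 0 = - of_real (cmod (deriv h 0))" using v by (auto simp: u_def)
  obtain w where w: "cmod w = 1" "w * (u * deriv f 0) = of_real (cmod (deriv f 0))"
    using ex_rotation[of "u * deriv f 0"] u(1) by (auto simp: norm_mult)
  have uz: "cmod (u * z) = cmod z" for z using u(1) by (simp add: norm_mult)
  have df: "(f has_field_derivative deriv f 0) (at (u * 0))" and dh: "(h has_field_derivative deriv h 0) (at (u * 0))"
    using holomorphic_derivI[OF f open_ball, of 0] holomorphic_derivI[OF h open_ball, of 0] by simp_all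
  have du: "((\<lambda>z. u * z) has_field_derivative u) (at 0)" by (auto intro!: derivative_eq_intros)
  have hol: "(\<lambda>z. p (u * z)) holomorphic_on ball 0 1" if "p holomorphic_on ball 0 1" for p
    by (rule holomorphic_on_compose_gen[OF _ that, of "\<lambda>z. u * z", unfolded o_def])
       (auto intro!: holomorphic_intros simp: uz)
  have "cmod (deriv h 0) \<le> cmod (deriv f 0) + ln (1 - cmod (deriv f 0)) - 2 * Re (h (u * 0))"
  proof (rule zero_free_bound_normalized[of "\<lambda>z. w * f (u * z)" "\<lambda>z. h (u * z)"])
    show "(\<lambda>z. w * f (u * z)) holomorphic_on ball 0 1" "(\<lambda>z. h (u * z)) holomorphic_on ball 0 1"
      by (intro holomorphic_intros hol f h)+
    show "deriv (\<lambda>z. w * f (u * z)) 0 = of_real (cmod (deriv f 0))"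
      using DERIV_imp_deriv[OF DERIV_cmult[OF DERIV_chain2[OF df du], of w]] w(2) by (simp add: mult_ac)
    show "deriv (\<lambda>z. h (u * z)) 0 = - of_real (cmod (deriv h 0))"
      using DERIV_imp_deriv[OF DERIV_chain2[OF dh du]] u(2) by (simp add: mult_ac)
    show "(cmod (w * f (u * z)))\<^sup>2 + exp (2 * Re (h (u * z))) \<le> 1" if "cmod z < 1" for z
      using le[of "u * z"] that uz[of z] w(1) u(1) by (simp add: norm_mult)
  qed (use f0 L in auto)
  then show ?thesis by simp
qed

section \<open>Competitors and the two-parameter optimization\<close>

definition edisc :: "real \<Rightarrow> (complex \<Rightarrow> complex) \<Rightarrow> (complex \<Rightarrow> complex) \<Rightarrow> bool" where
  "edisc m f g \<longleftrightarrow> f holomorphic_on ball 0 1 \<and> g holomorphic_on ball 0 1 \<and>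
    (\<forall>z. cmod z < 1 \<longrightarrow> egauge m (f z) (g z) < 1)"

text \<open>\<open>exp ((Ln a - Ln b) / m)\<close> is the branch of (a / b) powr (1 / m) used
  throughout; it is holomorphic in a and b as long as both stay in the right half-plane.\<close>

lemma cmod_exp_Ln_diff_powr:
  assumes "0 < m" "a \<noteq> 0" "b \<noteq> 0"
  shows "cmod (exp ((Ln a - Ln b) / of_real m)) powr (2 * m) = (cmod a / cmod b)\<^sup>2"
proof -
  have "cmod (exp ((Ln a - Ln b) / of_real m)) powr (2 * m) = exp (2 * (ln (cmod a) - ln (cmod b)))"
    using assms by (simp add: powr_def)
  also have "\<dots> = (cmod a / cmod b)\<^sup>2"
    using assms by (simp add: exp_double exp_diff power_divide)
  finally show ?thesis .
qed

text \<open>The disc is \<open>z \<mapsto> (X z / (1 + s t \<omega> z), b J z / \<tau> ((1 + t \<omega> z) / (1 + s t \<omega> z)) powr (1 / m))\<close>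
  with the Moebius factor \<open>J z = (\<tau> + \<omega> z) / (1 + \<tau> \<omega> z)\<close>. Shrinking and rotating \<open>\<omega>\<close> yields
  every smaller value of the derivative.\<close>

lemma edisc_through_point:
  fixes m \<tau> s t :: real and b X Z :: complex
  assumes m: "0 < m" and \<tau>: "0 < \<tau>" "\<tau> \<le> 1" and s: "0 < s" "s < 1" and t: "0 \<le> t" "t \<le> 1"
    and b: "cmod b powr (2 * m) = s * \<tau> powr (2 * m)"
    and X: "(cmod X)\<^sup>2 \<le> (1 - s) * (1 - s * t\<^sup>2)"
    and Z: "cmod Z \<le> 1 / \<tau> - \<tau> + (1 - s) * t / m"
  shows "\<exists>f g. edisc m f g \<and> f 0 = 0 \<and> g 0 = b \<and> deriv f 0 = X \<and> deriv g 0 = b * Z"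
proof -
  define R where "R = 1 / \<tau> - \<tau> + (1 - s) * t / m"
  \<comment> \<open>\<omega> carries the argument of Z and the ratio |Z| / R, so every admissible Z
    is reached. If R = 0, then Z = 0, and division by zero gives \<omega> = 0.\<close>
  define \<omega> where "\<omega> = Z / of_real R"
  have tau1: "\<tau> \<le> 1 / \<tau>" using \<tau> by (simp add: divide_simps mult_le_one)
  have R0: "0 \<le> R" using tau1 s t m by (simp add: R_def)
  have Z\<omega>: "Z = of_real R * \<omega>" using Z by (cases "R = 0") (auto simp: \<omega>_def R_def[symmetric])
  have \<omega>1: "cmod \<omega> \<le> 1" using Z R0 by (cases "R = 0") (auto simp: \<omega>_def R_def[symmetric] norm_divide)
  define c where "c = of_real t * \<omega>"
  have c1: "cmod c \<le> 1" using \<omega>1 t by (simp add: c_def norm_mult mult_le_one)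
  have le1: "cmod (a * z) < 1" if "cmod a \<le> 1" "cmod z < 1" for a z :: complex
    using that mult_left_le_one_le[of "cmod z" "cmod a"] by (simp add: norm_mult)
  have sc1: "cmod (of_real s * c) \<le> 1" using c1 s by (simp add: norm_mult mult_le_one)
  have tw1: "cmod (of_real \<tau> * \<omega>) \<le> 1" using \<omega>1 \<tau> by (simp add: norm_mult mult_le_one)
  have pos: "0 < Re (1 + c * z)" "0 < Re (1 + of_real s * c * z)" "0 < Re (1 + of_real \<tau> * \<omega> * z)" if "cmod z < 1" for z
    using Re_one_plus_pos[OF le1[OF c1 that]] Re_one_plus_pos[OF le1[OF sc1 that]] Re_one_plus_pos[OF le1[OF tw1 that]] by auto
  have nz: "1 + c * z \<noteq> 0" "1 + of_real s * c * z \<noteq> 0" "1 + of_real \<tau> * \<omega> * z \<noteq> 0" if "cmod z < 1" for z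
    by (intro nonzero_if_Re_pos pos that)+
  note cut = not_nonpos_Reals_if_Re_pos[OF pos(1)] not_nonpos_Reals_if_Re_pos[OF pos(2)]
  define f where "f z = X * z / (1 + of_real s * c * z)" for z
  define J where "J z = (of_real \<tau> + \<omega> * z) / (1 + of_real \<tau> * \<omega> * z)" for z
  define M where "M z = exp ((Ln (1 + c * z) - Ln (1 + of_real s * c * z)) / of_real m)" for z
  define g where "g z = b / of_real \<tau> * (J z * M z)" for z
  have hol: "f holomorphic_on ball 0 1" "J holomorphic_on ball 0 1" "M holomorphic_on ball 0 1"
    unfolding f_def J_def M_def by (intro holomorphic_intros; use nz cut m in auto)+
  have J1: "cmod (J z) \<le> 1" if "cmod z < 1" for z
  proof -
    have id: "(cmod (1 + of_real \<tau> * w))\<^sup>2 - (cmod (of_real \<tau> + w))\<^sup>2 = (1 - \<tau>\<^sup>2) * (1 - (cmod w)\<^sup>2)" for w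
      unfolding cmod_power2 by (simp add: power2_eq_square algebra_simps)
    have "0 \<le> (1 - \<tau>\<^sup>2) * (1 - (cmod (\<omega> * z))\<^sup>2)"
      using \<tau> le1[OF \<omega>1 that] by (intro mult_nonneg_nonneg) (auto simp: power_le_one)
    then have "(cmod (of_real \<tau> + \<omega> * z))\<^sup>2 \<le> (cmod (1 + of_real \<tau> * (\<omega> * z)))\<^sup>2"
      using id[of "\<omega> * z"] by linarith
    then have "cmod (of_real \<tau> + \<omega> * z) \<le> cmod (1 + of_real \<tau> * \<omega> * z)"
      by (simp add: mult.assoc)
    then show ?thesis using nz(3)[OF that] by (simp add: J_def norm_divide divide_simps)
  qed
  have "egauge m (f z) (g z) < 1" if z: "cmod z < 1" for z
  proof -
    define d where "d = (cmod (1 + of_real s * c * z))\<^sup>2"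
    have d: "d > 0" using nz(2)[OF z] by (simp add: d_def)
    have "cmod (g z) powr (2 * m) = s * (cmod (J z) powr (2 * m) * cmod (M z) powr (2 * m))"
      unfolding g_def norm_mult norm_divide using \<tau> b by (simp add: powr_mult powr_divide)
    also have "\<dots> \<le> s * (1 * cmod (M z) powr (2 * m))"
      using J1[OF z] s m by (intro mult_left_mono mult_right_mono) (auto intro: powr_le1)
    also have "cmod (M z) powr (2 * m) = (cmod (1 + c * z))\<^sup>2 / d"
      unfolding M_def d_def power_divide[symmetric] by (rule cmod_exp_Ln_diff_powr[OF m nz(1)[OF z] nz(2)[OF z]])
    finally have 1: "cmod (g z) powr (2 * m) \<le> s * (cmod (1 + c * z))\<^sup>2 / d" by simp
    \<comment> \<open>Room left for the first component: for |w| \<le> t the right-hand side is at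
      least the bound assumed for |X|^2.\<close>
    have id: "(cmod (1 + of_real s * w))\<^sup>2 - s * (cmod (1 + w))\<^sup>2 = (1 - s) * (1 - s * (cmod w)\<^sup>2)" for w
      unfolding cmod_power2 by (simp add: power2_eq_square algebra_simps)
    have cz: "cmod (c * z) \<le> t"
    proof -
      have "cmod (\<omega> * z) \<le> 1" using le1[OF \<omega>1 z] by simp
      then show ?thesis using t by (simp add: c_def norm_mult mult_left_le mult.assoc)
    qed
    have t2: "t\<^sup>2 \<le> 1" using t by (simp add: power_le_one)
    have "s * t\<^sup>2 < 1" using s t2 by (smt (verit) mult_left_le)
    then have Ppos: "0 < (1 - s) * (1 - s * t\<^sup>2)" using s by (intro mult_pos_pos) auto
    have "(cmod X)\<^sup>2 * (cmod z)\<^sup>2 \<le> ((1 - s) * (1 - s * t\<^sup>2)) * (cmod z)\<^sup>2"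
      using X by (intro mult_right_mono) auto
    also have "\<dots> < ((1 - s) * (1 - s * t\<^sup>2)) * 1"
      using z Ppos by (intro mult_strict_left_mono) (auto simp: power_less_one_iff)
    also have "\<dots> \<le> (1 - s) * (1 - s * (cmod (c * z))\<^sup>2)"
      using s cz by (auto intro!: mult_left_mono power_mono)
    also have "\<dots> = d - s * (cmod (1 + c * z))\<^sup>2" unfolding id[symmetric] d_def by (simp add: mult.assoc)
    finally have 2: "(cmod X)\<^sup>2 * (cmod z)\<^sup>2 + s * (cmod (1 + c * z))\<^sup>2 < d" by linarith
    have "(cmod (f z))\<^sup>2 = (cmod X)\<^sup>2 * (cmod z)\<^sup>2 / d"
      by (simp add: f_def d_def norm_divide norm_mult power_divide power_mult_distrib)
    then have "egauge m (f z) (g z) \<le> ((cmod X)\<^sup>2 * (cmod z)\<^sup>2 + s * (cmod (1 + c * z))\<^sup>2) / d"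
      using 1 unfolding egauge_def add_divide_distrib by simp
    also have "\<dots> < 1" using 2 d by simp
    finally show ?thesis .
  qed
  then have ed: "edisc m f g" unfolding edisc_def g_def using hol by (auto intro!: holomorphic_intros)
  have df: "deriv f 0 = X"
    unfolding f_def by (rule DERIV_imp_deriv) (auto intro!: derivative_eq_intros)
  have dJ: "(J has_field_derivative \<omega> * (1 - of_real \<tau> * of_real \<tau>)) (at 0)"
    unfolding J_def by (auto intro!: derivative_eq_intros simp: algebra_simps)
  have dM: "(M has_field_derivative c * (1 - of_real s) / of_real m) (at 0)"
    unfolding M_def using m by (auto intro!: derivative_eq_intros simp: field_simps)
  have J0: "J 0 = of_real \<tau>" and M0: "M 0 = 1" by (auto simp: J_def M_def)
  \<comment> \<open>Logarithmic derivatives add: \<omega> (1 / \<tau> - \<tau>) from J and c (1 - s)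
    / m from M sum to \<omega> R = Z.\<close>
  have "deriv g 0 = b / of_real \<tau> * (\<omega> * (1 - of_real \<tau> * of_real \<tau>) * M 0 + c * (1 - of_real s) / of_real m * J 0)"
    unfolding g_def by (rule DERIV_imp_deriv[OF DERIV_cmult[OF DERIV_mult[OF dJ dM]]])
  also have "\<dots> = b * Z"
    unfolding Z\<omega> R_def c_def J0 M0 using \<tau> m by (simp add: field_simps)
  finally have dg: "deriv g 0 = b * Z" .
  show ?thesis using ed df dg J0 M0 \<tau> by (intro exI[of _ f] exI[of _ g]) (auto simp: f_def g_def)
qed

text \<open>\<open>L\<close> stands for \<open>\<bar>f\<^sub>1' 0\<bar>\<close> and \<open>R\<close> for \<open>\<bar>f\<^sub>2' 0 / f\<^sub>2 0\<bar>\<close>. By \<open>edisc_through_point\<close> with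
  \<open>\<tau> = exp (- x)\<close> and \<open>s = sg x\<close>, the values \<open>L = \<surd>(P x t)\<close> and \<open>R = E x t\<close> are attained.\<close>

locale two_parameter_region =
  fixes m s0 L R :: real
  assumes m: "0 < m" "m < 1/2" and s0: "0 < s0" and L: "0 \<le> L"
begin

text \<open>For g = B G with |B 0| = exp (- x) this is |G 0| powr (2 m), the squared distance from
  the origin at which (f, G^m) starts in the ball.\<close>

definition sg :: "real \<Rightarrow> real" where "sg x = s0 * exp (2 * m * x)"
text \<open>The Schwarz lemma of the ball, solved for the squared modulus of the derivative of the
  first component.\<close>

definition P :: "real \<Rightarrow> real \<Rightarrow> real" where "P x t = (1 - sg x) * (1 - sg x * t\<^sup>2)"
text \<open>\<open>2 * sinh x\<close> is (1 - \<tau>^2) / \<tau> for \<tau> = exp (- x), the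
  Schwarz-Pick bound for |B' 0 / B 0|; the other term is |G' 0 / G 0|.\<close>

definition E :: "real \<Rightarrow> real \<Rightarrow> real" where "E x t = 2 * sinh x + (1 - sg x) * t / m"

text \<open>A dominating point must be strictly better in both respects, so that a factor slightly
  above 1 still fits under P and E. In this form maximality of a disc enters.\<close>

definition undominated :: bool where
  "undominated \<longleftrightarrow> (\<forall>x t. 0 \<le> x \<longrightarrow> 0 \<le> t \<longrightarrow> t \<le> 1 \<longrightarrow> sg x < 1 \<longrightarrow> P x t \<le> L\<^sup>2 \<or> E x t \<le> R)"

lemma undominatedD: "undominated \<Longrightarrow> 0 \<le> x \<Longrightarrow> 0 \<le> t \<Longrightarrow> t \<le> 1 \<Longrightarrow> sg x < 1 \<Longrightarrow> L\<^sup>2 < P x t \<Longrightarrow> E x t \<le> R"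
  unfolding undominated_def by force

lemma sg_pos: "0 < sg x" using s0 by (simp add: sg_def)

lemma eventually_gt_right:
  fixes p :: "real \<Rightarrow> real"
  assumes d: "(p has_real_derivative D) (at 0)" and "c < p 0 \<or> c \<le> p 0 \<and> 0 < D"
  shows "\<forall>\<^sub>F e in at_right 0. c < p e"
  using assms(2)
proof (elim disjE conjE)
  assume "c < p 0"
  moreover have "(p \<longlongrightarrow> p 0) (at_right 0)"
    using DERIV_isCont[OF d] by (simp add: isCont_def filterlim_at_split)
  ultimately show ?thesis by (intro order_tendstoD)
next
  assume c: "c \<le> p 0" "0 < D"
  obtain b where "b > 0" "\<And>h. 0 < h \<Longrightarrow> h < b \<Longrightarrow> p 0 < p (0 + h)"
    using DERIV_pos_inc_right[OF d c(2)] by auto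
  then show ?thesis unfolding eventually_at_right_field using c(1) by (intro exI[of _ b]) force
qed

text \<open>First variation along the segment from (x, t) in direction (dx, dt): each of P and E
  exceeds its target already or increases to first order. The conditions \<open>dir\<close> keep the
  segment inside x \<ge> 0 and 0 \<le> t \<le> 1.\<close>

lemma path_dominates:
  assumes nd: "undominated" and pt: "0 \<le> x" "0 \<le> t" "t \<le> 1" "sg x < 1"
    and dir: "dx < 0 \<Longrightarrow> 0 < x" "dt < 0 \<Longrightarrow> 0 < t" "0 < dt \<Longrightarrow> t < 1"
    and P: "L\<^sup>2 < P x t \<or> L\<^sup>2 \<le> P x t \<and> 0 < - 2 * m * sg x * (1 + t\<^sup>2 - 2 * sg x * t\<^sup>2) * dx - 2 * sg x * t * (1 - sg x) * dt"
    and E: "R < E x t \<or> R \<le> E x t \<and> 0 < (2 * cosh x - 2 * sg x * t) * dx + (1 - sg x) / m * dt"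
  shows False
proof -
  have dP: "((\<lambda>e. P (x + e * dx) (t + e * dt)) has_real_derivative
     - 2 * m * sg x * (1 + t\<^sup>2 - 2 * sg x * t\<^sup>2) * dx - 2 * sg x * t * (1 - sg x) * dt) (at 0)"
    unfolding P_def sg_def
    by (rule derivative_eq_intros refl | simp)+ (simp add: algebra_simps power2_eq_square)
  have dE: "((\<lambda>e. E (x + e * dx) (t + e * dt)) has_real_derivative
     (2 * cosh x - 2 * sg x * t) * dx + (1 - sg x) / m * dt) (at 0)"
    unfolding E_def sg_def using m(1)
    by (auto intro!: derivative_eq_intros simp: field_simps)
  have 1: "\<forall>\<^sub>F e in at_right 0. L\<^sup>2 < P (x + e * dx) (t + e * dt)"
    using eventually_gt_right[OF dP, of "L\<^sup>2"] P by simp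
  have 2: "\<forall>\<^sub>F e in at_right 0. R < E (x + e * dx) (t + e * dt)"
    using eventually_gt_right[OF dE, of R] E by simp
  have lim: "((\<lambda>e. y + e * d) \<longlongrightarrow> y) (at_right 0)" for y d :: real
    by (auto intro!: tendsto_eq_intros)
  have nn: "\<forall>\<^sub>F e in at_right 0. 0 \<le> y + e * d" if "0 \<le> y" "d < 0 \<Longrightarrow> 0 < y" for y d :: real
  proof (cases "0 < y")
    case True
    from order_tendstoD(1)[OF lim[of y d] True] show ?thesis by (rule eventually_mono) simp
  next
    case False
    then have "y = 0" "d \<ge> 0" using that by force+
    then show ?thesis by (auto intro!: eventually_at_right_less[THEN eventually_mono])
  qed
  have 3: "\<forall>\<^sub>F e in at_right 0. 0 \<le> x + e * dx" "\<forall>\<^sub>F e in at_right 0. 0 \<le> t + e * dt"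
    by (intro nn; use pt dir in auto)+
  have "\<forall>\<^sub>F e in at_right 0. 0 \<le> (1 - t) + e * (- dt)"
    by (intro nn; use pt dir in auto)
  then have 4: "\<forall>\<^sub>F e in at_right 0. t + e * dt \<le> 1" by eventually_elim simp
  have "((\<lambda>e. sg (x + e * dx)) \<longlongrightarrow> sg x) (at_right 0)"
    unfolding sg_def by (intro tendsto_intros lim)
  from order_tendstoD(2)[OF this pt(4)] 1 2 3 4
  have "\<forall>\<^sub>F e in at_right (0::real). False"
    by eventually_elim (use undominatedD[OF nd] in force)
  then show False by simp
qed

lemma sg_t_lt_cosh:
  assumes "0 \<le> t" "t \<le> 1" "sg x < 1"
  shows "sg x * t < cosh x"
proof -
  have "sg x * t \<le> sg x" using assms sg_pos[of x] by (simp add: mult_left_le)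
  then show ?thesis using cosh_real_ge_1[of x] assms by linarith
qed

lemma P_factor_pos:
  assumes "0 \<le> t" "t \<le> 1" "sg x < 1"
  shows "0 < 1 + t\<^sup>2 - 2 * sg x * t\<^sup>2"
proof -
  have "t\<^sup>2 \<le> 1" using assms by (simp add: power_le_one)
  moreover have "sg x * t\<^sup>2 \<le> t\<^sup>2" using assms sg_pos[of x] by (simp add: mult_left_le_one_le)
  moreover have "sg x * t\<^sup>2 < 1"
    using assms \<open>t\<^sup>2 \<le> 1\<close> sg_pos[of x] by (smt (verit) mult_left_le)
  ultimately show ?thesis by linarith
qed

text \<open>Slack in P would allow x to grow, which increases E because
  \<open>sg x * t < cosh x\<close>.\<close>

lemma undominated_P_eq:
  assumes nd: "undominated" and pt: "0 \<le> x" "0 \<le> t" "t \<le> 1" "sg x < 1"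
    and le: "L\<^sup>2 \<le> P x t" "R \<le> E x t"
  shows "L\<^sup>2 = P x t"
proof (rule ccontr)
  assume "L\<^sup>2 \<noteq> P x t"
  then show False
    using path_dominates[OF nd pt, of 1 0] le sg_t_lt_cosh[OF pt(2-4)] by auto
qed

text \<open>Slack in E can be spent on decreasing x, or t when x = 0, and either raises P. If both
  are 0, then E vanishes and leaves no slack over R \<ge> 0.\<close>

lemma undominated_E_eq:
  assumes nd: "undominated" and pt: "0 \<le> x" "0 \<le> t" "t \<le> 1" "sg x < 1"
    and le: "L\<^sup>2 \<le> P x t" "R \<le> E x t" and R: "0 \<le> R"
  shows "R = E x t"
proof (rule ccontr)
  assume "R \<noteq> E x t"
  then have lt: "R < E x t" using le by simp
  show False
  proof (cases "x = 0")
    case False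
    then show False
      using path_dominates[OF nd pt, of "-1" 0] le lt pt P_factor_pos[OF pt(2-4)] sg_pos[of x] m by auto
  next
    case True
    then have "t > 0" using lt R pt m by (cases "t = 0") (auto simp: E_def)
    then show False
      using path_dominates[OF nd pt, of 0 "-1"] le lt pt sg_pos[of x] by auto
  qed
qed

text \<open>Along the curves on which \<open>P\<close> is constant, \<open>dE / dx = (exp x + exp (- x)) - (t + 1 / t)\<close>.\<close>

lemma undominated_stationary:
  assumes nd: "undominated" and pt: "0 < x" "0 \<le> t" "t \<le> 1" "sg x < 1"
    and le: "L\<^sup>2 \<le> P x t" "R \<le> E x t"
  shows "t = exp (- x)"
proof (rule ccontr)
  assume ne: "t \<noteq> exp (- x)"
  have x0: "0 \<le> x" using pt by simp
  have fac: "- (1 + t\<^sup>2) + 2 * t * cosh x = (t - exp (- x)) * (exp x - t)"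
    by (simp add: cosh_field_def algebra_simps power2_eq_square flip: exp_add)
  have et: "t < exp x" using pt by (smt (verit) one_less_exp_iff)
  \<comment> \<open>Above the critical curve t = exp (- x) the parameter x must grow, below it must
    shrink, for E to gain along the level curve of P.\<close>
  define d where "d = (if t < exp (- x) then -1 else (1::real))"
  have d: "0 < (- (1 + t\<^sup>2) + 2 * t * cosh x) * d"
    unfolding fac d_def using ne et by (auto simp: mult_neg_pos)
  define A where "A = 2 * m * sg x * (- (1 + t\<^sup>2) + 2 * t * cosh x) * d"
  have A: "A > 0" using d m sg_pos[of x] unfolding A_def by (simp add: mult.assoc)
  define B where "B = 2 * cosh x - 2 * sg x * t"
  have B: "B > 0" unfolding B_def using sg_t_lt_cosh[OF pt(2-4)] by simp
  define K where "K = 2 * sg x * t * m"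
  have K: "K \<ge> 0" unfolding K_def using sg_pos[of x] pt m by simp
  \<comment> \<open>The gain is shared: E is made to increase at rate \<eta>, which leaves P the
    rate A - K \<eta> > 0. The bound \<eta> < B keeps the sign of \<open>dt\<close> opposite to that
    of d, so t stays in [0, 1].\<close>
  define \<eta> where "\<eta> = min (B/2) (A / (2 * (K + 1)))"
  have eta: "0 < \<eta>" "\<eta> < B" "K * \<eta> < A"
  proof -
    show "0 < \<eta>" "\<eta> < B" using A B K by (auto simp: \<eta>_def)
    have "K * \<eta> \<le> K * (A / (2 * (K + 1)))" using K by (intro mult_left_mono) (auto simp: \<eta>_def)
    also have "\<dots> < A" using A K by (simp add: divide_simps algebra_simps add_strict_increasing)
    finally show "K * \<eta> < A" .
  qed
  define dt where "dt = m / (1 - sg x) * (\<eta> - B * d)"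
  have s1: "0 < 1 - sg x" using pt by simp
  have dE: "B * d + (1 - sg x) / m * dt = \<eta>" unfolding dt_def using s1 m by (simp add: field_simps)
  have dP: "- 2 * m * sg x * (1 + t\<^sup>2 - 2 * sg x * t\<^sup>2) * d - 2 * sg x * t * (1 - sg x) * dt = A - K * \<eta>"
    unfolding A_def K_def dt_def B_def using s1 m by (simp add: field_simps power2_eq_square)
  have "dt < 0 \<Longrightarrow> 0 < t"
  proof -
    assume "dt < 0"
    then have "\<eta> < B * d" using m s1 mult_nonneg_nonneg[of "m / (1 - sg x)" "\<eta> - B * d"]
      by (simp only: dt_def) (smt (verit) divide_pos_pos)
    then have "\<not> t < exp (- x)" using eta(1) B by (auto simp: d_def split: if_splits)
    then show "0 < t" by (meson exp_gt_zero less_le_trans not_less)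
  qed
  moreover have "0 < dt \<Longrightarrow> t < 1"
  proof -
    assume "0 < dt"
    then have "\<eta> > B * d" using m s1 mult_nonneg_nonneg[of "m / (1 - sg x)" "B * d - \<eta>"]
      by (simp only: dt_def) (smt (verit) divide_pos_pos mult_minus_right)
    then have "t < exp (- x)" using eta(2) by (auto simp: d_def split: if_splits)
    moreover have "exp (- x) \<le> 1" using pt by simp
    ultimately show "t < 1" by linarith
  qed
  moreover have dPpos: "0 < - 2 * m * sg x * (1 + t\<^sup>2 - 2 * sg x * t\<^sup>2) * d - 2 * sg x * t * (1 - sg x) * dt"
    using dP eta by linarith
  have dEpos: "0 < (2 * cosh x - 2 * sg x * t) * d + (1 - sg x) / m * dt"
    using dE eta unfolding B_def by linarith
  ultimately show False
    using path_dominates[OF nd x0 pt(2-4) _ _ _ disjI2[OF conjI[OF le(1) dPpos]] disjI2[OF conjI[OF le(2) dEpos]]] pt(1)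
    by blast
qed

lemma DERIV_pos_local_increasing:
  fixes p :: "real \<Rightarrow> real"
  assumes "(p has_real_derivative D) (at 0)" "0 < D"
  obtains b where "0 < b" "\<And>x. 0 < x \<Longrightarrow> x < b \<Longrightarrow> p 0 < p x"
  using DERIV_pos_inc_right[OF assms] that by auto

text \<open>At \<open>x = 0\<close>, \<open>t = 1\<close> the first variation vanishes; keeping \<open>P\<close> fixed exactly, \<open>E\<close> increases to
  third order in \<open>x\<close> because \<open>2 m < 1\<close>.\<close>

lemma undominated_not_cusp:
  assumes nd: "undominated" and s: "s0 < 1" and le: "L = 1 - s0" "R \<le> (1 - s0) / m"
  shows False
proof -
  \<comment> \<open>The value of t^2 on the level curve P x t = L^2.\<close>
  define W where "W x = (1 - L\<^sup>2 / (1 - sg x)) / sg x" for x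
  have sg0: "sg 0 = s0" by (simp add: sg_def)
  have dsg: "(sg has_real_derivative 2 * m * sg x) (at x)" for x
    unfolding sg_def by (auto intro!: derivative_eq_intros)
  have dW: "(W has_real_derivative 2 * m * sg x * (- L\<^sup>2 / ((1 - sg x)\<^sup>2 * sg x) - (1 - L\<^sup>2 / (1 - sg x)) / (sg x)\<^sup>2)) (at x)"
    if "sg x < 1" for x
  proof -
    have nz: "1 - sg x \<noteq> 0" "sg x \<noteq> 0" using that sg_pos[of x] by auto
    have "((\<lambda>x. L\<^sup>2 / (1 - sg x)) has_real_derivative L\<^sup>2 * (2 * m * sg x) / (1 - sg x)\<^sup>2) (at x)"
      by (rule derivative_eq_intros dsg refl nz | simp add: power2_eq_square)+
    note D = DERIV_divide[OF DERIV_diff[OF DERIV_const[of 1] this] dsg nz(2)]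
    show ?thesis unfolding W_def
      by (rule DERIV_cong[OF D]) (use nz in \<open>simp add: divide_simps, simp add: algebra_simps power2_eq_square\<close>)
  qed
  have W0: "W 0 = 1" unfolding W_def sg0 le using s s0 by (simp add: power2_eq_square field_simps)
  have dW0: "(W has_real_derivative - 4 * m) (at 0)"
  proof (rule DERIV_cong[OF dW])
    define u where "u = 1 - s0"
    have "u \<noteq> 0" using s by (simp add: u_def)
    then have "2 * m * s0 * (- u\<^sup>2 / (u\<^sup>2 * s0) - (1 - u\<^sup>2 / u) / s0\<^sup>2) = 2 * m * s0 * (- 1 / s0 - (1 - u) / s0\<^sup>2)"
      by (simp add: power2_eq_square)
    also have "\<dots> = - 4 * m" using s0 by (simp add: u_def power2_eq_square)
    finally show "2 * m * sg 0 * (- L\<^sup>2 / ((1 - sg 0)\<^sup>2 * sg 0) - (1 - L\<^sup>2 / (1 - sg 0)) / (sg 0)\<^sup>2) = - 4 * m"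
      by (simp only: sg0 le u_def)
  qed (use s sg0 in simp)
  have "((\<lambda>x. - W x) has_real_derivative 4 * m) (at 0)" using DERIV_minus[OF dW0] by simp
  from DERIV_pos_local_increasing[OF this] obtain b1 where b1: "0 < b1" "\<And>x. 0 < x \<Longrightarrow> x < b1 \<Longrightarrow> W x < 1"
    using m W0 by auto
  \<comment> \<open>Here 2 m < 1 enters: W starts with slope - 4 m, above the slope - 2 of exp (- 2
    x), so near the corner the level curve runs above t = exp (- x).\<close>
  have "((\<lambda>x. W x - exp (- 2 * x)) has_real_derivative - 4 * m + 2) (at 0)"
    by (rule derivative_eq_intros dW0 refl | simp)+
  from DERIV_pos_local_increasing[OF this] obtain b2 where b2: "0 < b2" "\<And>x. 0 < x \<Longrightarrow> x < b2 \<Longrightarrow> exp (- 2 * x) < W x"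
    using m W0 by auto
  have "((\<lambda>x. 1 - sg x) \<longlongrightarrow> 1 - sg 0) (at_right 0)"
    using DERIV_isCont[OF dsg, of 0] by (auto simp: isCont_def filterlim_at_split intro!: tendsto_intros)
  from order_tendstoD(1)[OF this, of 0] obtain b3 where b3: "0 < b3" "\<And>x. 0 < x \<Longrightarrow> x < b3 \<Longrightarrow> sg x < 1"
    using s sg0 by (auto simp: eventually_at_right_field)
  define b where "b = min b1 (min b2 b3) / 2"
  have b: "0 < b" "\<And>x. 0 < x \<Longrightarrow> x \<le> b \<Longrightarrow> W x < 1 \<and> exp (- 2 * x) < W x \<and> sg x < 1"
    using b1 b2 b3 by (auto simp: b_def)
  define t where "t x = sqrt (W x)" for x
  have P: "P x (t x) = L\<^sup>2" if "0 < x" "x \<le> b" for x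
  proof -
    have "0 < W x" using b(2)[OF that] by (smt (verit) exp_gt_zero)
    then have "(t x)\<^sup>2 = W x" by (simp add: t_def)
    then show ?thesis unfolding P_def W_def using b(2)[OF that] sg_pos[of x] by (simp add: field_simps)
  qed
  have t: "exp (- x) < t x" "t x < 1" if "0 < x" "x \<le> b" for x
  proof -
    have "exp (- x) = sqrt (exp (- 2 * x))"
      by (rule real_sqrt_unique[symmetric]) (auto simp flip: exp_double)
    then show "exp (- x) < t x" unfolding t_def using b(2)[OF that] by (simp only: real_sqrt_less_iff)
    show "t x < 1" unfolding t_def using b(2)[OF that] by simp
  qed
  have dE: "((\<lambda>x. E x (t x)) has_real_derivative 2 * cosh x - (t x + 1 / t x)) (at x)" if x: "0 < x" "x < b" for x
  proof -
    have Wx: "0 < W x" "sg x < 1" using b(2)[of x] x by (smt (verit) exp_gt_zero)+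
    have tx: "t x > 0" "(t x)\<^sup>2 = W x" using Wx by (auto simp: t_def)
    have LW: "L\<^sup>2 = (1 - sg x) * (1 - sg x * (t x)\<^sup>2)" using P[of x] x by (simp add: P_def)
    define D where "D = - 2 * m * (1 + (t x)\<^sup>2 - 2 * sg x * (t x)\<^sup>2) / (1 - sg x)"
    have "2 * m * sg x * (- L\<^sup>2 / ((1 - sg x)\<^sup>2 * sg x) - (1 - L\<^sup>2 / (1 - sg x)) / (sg x)\<^sup>2) = D"
    proof -
      define u v where "u = 1 - sg x" and "v = sg x"
      have nz: "u \<noteq> 0" "v \<noteq> 0" using Wx sg_pos[of x] by (auto simp: u_def v_def)
      have "2 * m * v * (- (u * (1 - v * (t x)\<^sup>2)) / (u\<^sup>2 * v) - (1 - u * (1 - v * (t x)\<^sup>2) / u) / v\<^sup>2)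
        = - 2 * m * ((1 - v * (t x)\<^sup>2) / u + (t x)\<^sup>2)"
        using nz by (simp add: power2_eq_square algebra_simps diff_divide_distrib)
      also have "\<dots> = - 2 * m * (1 + (t x)\<^sup>2 - 2 * v * (t x)\<^sup>2) / u"
        using nz by (simp add: divide_simps) (simp add: u_def v_def algebra_simps)
      finally show ?thesis unfolding LW D_def by (simp only: u_def v_def)
    qed
    then have dWx: "(W has_real_derivative D) (at x)" using dW[OF Wx(2)] by simp
    have "(t has_real_derivative D * (inverse (t x) / 2)) (at x)"
      unfolding t_def using DERIV_chain2[OF DERIV_real_sqrt[OF Wx(1)] dWx] by (simp add: mult.commute)
    then have "((\<lambda>x. E x (t x)) has_real_derivative 2 * cosh x + ((1 - sg x) * (D * (inverse (t x) / 2)) - 2 * m * sg x * t x) / m) (at x)"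
      unfolding E_def using m by (auto intro!: derivative_eq_intros dsg)
    moreover have "((1 - sg x) * (D * (inverse (t x) / 2)) - 2 * m * sg x * t x) / m = - (t x + 1 / t x)"
      unfolding D_def using Wx tx(1) m by (simp add: field_simps power2_eq_square)
    ultimately show ?thesis by (simp only: diff_conv_add_uminus)
  qed
  have "E 0 (t 0) < E b (t b)"
  proof (rule DERIV_pos_imp_increasing_open[OF b(1)])
    fix x assume x: "0 < x" "x < b"
    have "(t x + 1 / t x) < 2 * cosh x"
    proof -
      have tx: "exp (- x) < t x" "t x < 1" using t[of x] x by auto
      then have t0: "0 < t x" by (meson exp_gt_zero less_trans)
      have "1 < exp x" using x by simp
      then have "0 < (t x - exp (- x)) * (exp x - t x)" using tx by (intro mult_pos_pos) linarith+
      also have "\<dots> = t x * (2 * cosh x) - ((t x)\<^sup>2 + 1)"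
        by (simp add: cosh_field_def algebra_simps power2_eq_square flip: exp_add)
      finally have "(t x)\<^sup>2 + 1 < t x * (2 * cosh x)" by simp
      then show ?thesis using t0 by (simp add: field_simps power2_eq_square)
    qed
    then show "\<exists>y. ((\<lambda>x. E x (t x)) has_real_derivative y) (at x) \<and> 0 < y"
      using dE[OF x] by (intro exI[of _ "2 * cosh x - (t x + 1 / t x)"]) auto
  next
    have "isCont W x" if "0 \<le> x" "x \<le> b" for x
      using that b(2)[of x] dW[of x] s sg0 by (cases "x = 0") (auto intro: DERIV_isCont)
    then have "continuous_on {0..b} W" by (auto intro: continuous_at_imp_continuous_on)
    then show "continuous_on {0..b} (\<lambda>x. E x (t x))" unfolding E_def t_def sg_def using m
      by (intro continuous_intros) auto
  qed
  moreover have "E 0 (t 0) = (1 - s0) / m" by (simp add: E_def t_def W0 sg0)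
  ultimately have lt: "R < E b (t b)" using le by simp
  have tb: "0 < t b" "t b < 1" using t[of b] b(1) by (auto intro: less_trans[OF exp_gt_zero])
  \<comment> \<open>E now has slack while P still equals L^2; lowering t gives slack in P as
    well.\<close>
  show False
    using path_dominates[OF nd, of b "t b" 0 "-1"] lt P[of b] b tb sg_pos[of b] by auto
qed

text \<open>The zero-free bound corresponds to a singular inner factor; a Moebius factor with the same value at the
  origin is better because \<open>sinh (x + d) - sinh x > d\<close>.\<close>

lemma undominated_t_le_1:
  assumes nd: "undominated" and x: "0 \<le> x" and s: "sg x < 1" and t: "1 < t"
    and le: "L\<^sup>2 \<le> P x t" "R \<le> E x t"
    and zf: "(1 - sg x) * t \<le> L + ln ((1 - L) / sg x)"
  shows False
proof -
  have "1 < t\<^sup>2" using t by (simp add: one_less_power)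
  then have "sg x * 1 < sg x * t\<^sup>2" using sg_pos[of x] by (intro mult_strict_left_mono) auto
  then have "P x t < (1 - sg x)\<^sup>2"
    unfolding P_def power2_eq_square using s by (intro mult_strict_left_mono) auto
  then have L1: "L < 1 - sg x" using le s L by (smt (verit) power2_le_imp_le)
  \<comment> \<open>The increase of x after which \<open>sg\<close> equals 1 - L; there the
    competitor with slope 1 has P equal to L^2.\<close>
  define d where "d = ln ((1 - L) / sg x) / (2 * m)"
  have d: "0 < d" unfolding d_def using L1 sg_pos[of x] m by (auto simp: field_simps)
  have "exp (2 * m * d) = (1 - L) / sg x" using L1 sg_pos[of x] m by (simp add: d_def)
  moreover have "sg (x + d) = sg x * exp (2 * m * d)"
    by (simp add: sg_def distrib_left exp_add)
  ultimately have sgd: "sg (x + d) = 1 - L" using sg_pos[of x] by simp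
  have "sinh (x + d) - sinh x > d"
  proof -
    have "sinh x - x < sinh (x + d) - (x + d)"
    proof (rule DERIV_pos_imp_increasing_open[where f = "\<lambda>u. sinh u - u"])
      fix u assume "x < u" "u < x + d"
      then have "1 < cosh u" using x cosh_real_ge_1[of u] cosh_real_one_iff[of u] by linarith
      then show "\<exists>y. ((\<lambda>u. sinh u - u) has_real_derivative y) (at u) \<and> 0 < y"
        by (intro exI[of _ "cosh u - 1"]) (auto intro!: derivative_eq_intros)
    qed (use d in \<open>auto intro!: continuous_intros\<close>)
    then show ?thesis by simp
  qed
  moreover have "R \<le> 2 * sinh x + 2 * d + L / m"
  proof -
    have "(1 - sg x) * t / m \<le> (L + 2 * m * d) / m"
      using zf m by (intro divide_right_mono) (auto simp: d_def)
    then show ?thesis using le m unfolding E_def by (simp add: add_divide_distrib)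
  qed
  ultimately have R: "R < E (x + d) 1" unfolding E_def sgd by simp
  have "isCont (\<lambda>u. E u 1) (x + d)" unfolding E_def sg_def using m by (intro continuous_intros) auto
  then have "((\<lambda>u. E u 1) \<longlongrightarrow> E (x + d) 1) (at_left (x + d))" by (simp add: isCont_def filterlim_at_split)
  from order_tendstoD(1)[OF this R] obtain u0 where u0: "u0 < x + d" "\<And>u. u0 < u \<Longrightarrow> u < x + d \<Longrightarrow> R < E u 1"
    by (auto simp: eventually_at_left_field)
  \<comment> \<open>At x + d itself P only equals L^2. Stepping back makes it strictly larger, and E
    stays above R by continuity.\<close>
  obtain u where u: "max x u0 < u" "u < x + d" using u0 d by (metis dense less_add_same_cancel1 max_less_iff_conj)
  have sgu: "sg u < 1 - L" using u(2) m s0 sgd by (simp add: sg_def flip: sgd)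
  then have "L\<^sup>2 < (1 - sg u)\<^sup>2" using L by (intro power_strict_mono) auto
  then have "L\<^sup>2 < P u 1" by (simp add: P_def power2_eq_square)
  then have "E u 1 \<le> R" using u x sgu L by (intro undominatedD[OF nd]) auto
  then show False using u0(2)[of u] u by auto
qed

text \<open>The hypothesis \<open>zf\<close> covers t > 1, where no competitor has the same slope;
  the corner x = 0, t = 1 falls to the third-order argument, and every other point to a first
  variation.\<close>

theorem undominated_parameters:
  assumes nd: "undominated" and x: "0 \<le> x" and s: "sg x < 1" and t: "0 \<le> t" and R: "0 \<le> R"
    and le: "L\<^sup>2 \<le> P x t" "R \<le> E x t"
    and zf: "1 < t \<Longrightarrow> (1 - sg x) * t \<le> L + ln ((1 - L) / sg x)"
  shows "t \<le> 1" "L\<^sup>2 = P x t" "R = E x t" "x = 0 \<Longrightarrow> t < 1" "0 < x \<Longrightarrow> t = exp (- x)"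
proof -
  show t1: "t \<le> 1" using undominated_t_le_1[OF nd x s _ le] zf by force
  show LP: "L\<^sup>2 = P x t" using undominated_P_eq[OF nd x t t1 s le] .
  show RE: "R = E x t" using undominated_E_eq[OF nd x t t1 s le R] .
  show "t = exp (- x)" if "0 < x" using undominated_stationary[OF nd that t t1 s le] .
  show "t < 1" if "x = 0"
  proof (rule ccontr)
    assume "\<not> t < 1"
    then have "t = 1" using t1 by simp
    moreover have "sg x = s0" using that by (simp add: sg_def)
    ultimately have "L\<^sup>2 = (1 - s0)\<^sup>2" "R = (1 - s0) / m"
      using LP RE that by (auto simp: P_def E_def power2_eq_square)
    then show False using undominated_not_cusp[OF nd] s L \<open>sg x = s0\<close> by (simp add: power2_eq_iff_nonneg)
  qed
qed

end

section \<open>Explicit discs\<close>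

text \<open>The discs obtained extend continuously to the closed disc, so their boundary values are
  genuine limits at every point of the circle.\<close>

definition disc_algebra :: "(complex \<Rightarrow> complex) set" where
  "disc_algebra = {h. continuous_on (cball 0 1) h \<and> h holomorphic_on ball 0 1}"

lemma disc_algebra_const: "(\<lambda>z. c) \<in> disc_algebra"
  and disc_algebra_ident: "(\<lambda>z. z) \<in> disc_algebra"
  and disc_algebra_add: "p \<in> disc_algebra \<Longrightarrow> q \<in> disc_algebra \<Longrightarrow> (\<lambda>z. p z + q z) \<in> disc_algebra"
  and disc_algebra_diff: "p \<in> disc_algebra \<Longrightarrow> q \<in> disc_algebra \<Longrightarrow> (\<lambda>z. p z - q z) \<in> disc_algebra"
  and disc_algebra_mult: "p \<in> disc_algebra \<Longrightarrow> q \<in> disc_algebra \<Longrightarrow> (\<lambda>z. p z * q z) \<in> disc_algebra"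
  and disc_algebra_exp: "p \<in> disc_algebra \<Longrightarrow> (\<lambda>z. exp (p z)) \<in> disc_algebra"
  unfolding disc_algebra_def by (auto intro!: continuous_intros holomorphic_intros)

lemma disc_algebra_divide:
  "p \<in> disc_algebra \<Longrightarrow> q \<in> disc_algebra \<Longrightarrow> (\<And>z. cmod z \<le> 1 \<Longrightarrow> q z \<noteq> 0) \<Longrightarrow> (\<lambda>z. p z / q z) \<in> disc_algebra"
  unfolding disc_algebra_def by (auto intro!: continuous_intros holomorphic_intros)

lemma disc_algebra_Ln:
  "p \<in> disc_algebra \<Longrightarrow> (\<And>z. cmod z \<le> 1 \<Longrightarrow> 0 < Re (p z)) \<Longrightarrow> (\<lambda>z. Ln (p z)) \<in> disc_algebra"
  unfolding disc_algebra_def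
  by (auto intro!: continuous_on_Ln' holomorphic_on_Ln' not_nonpos_Reals_if_Re_pos simp: less_imp_le)

lemmas disc_algebra_intros = disc_algebra_const disc_algebra_ident disc_algebra_add disc_algebra_diff
  disc_algebra_mult disc_algebra_exp

text \<open>\<open>PS\<close> and \<open>DS\<close> are the reflections \<open>z cnj (P (1 / cnj z))\<close> and \<open>z cnj (D (1 / cnj z))\<close> of the
  affine functions \<open>P\<close> and \<open>D\<close>, and \<open>|D|\<^sup>2\<close> is the stationarity multiplier.\<close>

definition explicit_disc :: "real \<Rightarrow> (complex \<Rightarrow> complex) \<Rightarrow> (complex \<Rightarrow> complex) \<Rightarrow> bool" where
  "explicit_disc m f g \<longleftrightarrow> (\<exists>P D PS DS S F. {P, D, PS, DS, S, F} \<subseteq> disc_algebra \<and>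
    (\<forall>z. cmod z \<le> 1 \<longrightarrow> D z \<noteq> 0) \<and>
    (\<forall>z. cmod z = 1 \<longrightarrow> z * cnj (P z) = PS z \<and> z * cnj (D z) = DS z \<and> egauge m (P z / D z) (S z) = 1 \<and>
      z * of_real (m * (cmod (D z))\<^sup>2 * cmod (S z) powr (2 * m - 2)) * cnj (S z) = F z) \<and>
    (\<forall>z. cmod z < 1 \<longrightarrow> f z = P z / D z \<and> g z = S z))"

lemma explicit_discI:
  assumes "P \<in> disc_algebra" "D \<in> disc_algebra" "PS \<in> disc_algebra" "DS \<in> disc_algebra"
    "S \<in> disc_algebra" "F \<in> disc_algebra"
    "\<And>z. cmod z \<le> 1 \<Longrightarrow> D z \<noteq> 0"
    "\<And>z. cmod z = 1 \<Longrightarrow> z * cnj (P z) = PS z" "\<And>z. cmod z = 1 \<Longrightarrow> z * cnj (D z) = DS z"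
    "\<And>z. cmod z = 1 \<Longrightarrow> egauge m (P z / D z) (S z) = 1"
    "\<And>z. cmod z = 1 \<Longrightarrow> z * of_real (m * (cmod (D z))\<^sup>2 * cmod (S z) powr (2 * m - 2)) * cnj (S z) = F z"
    "\<And>z. cmod z < 1 \<Longrightarrow> f z = P z / D z" "\<And>z. cmod z < 1 \<Longrightarrow> g z = S z"
  shows "explicit_disc m f g"
  unfolding explicit_disc_def
  by (rule exI[of _ P], rule exI[of _ D], rule exI[of _ PS], rule exI[of _ DS], rule exI[of _ S], rule exI[of _ F],
      intro conjI allI impI, simp add: assms(1-6), (erule assms)+)

lemma mult_cnj_eq_1: "cmod z = 1 \<Longrightarrow> z * cnj z = 1"
  by (metis complex_norm_square of_real_1 power_one)

lemma mult_mult_cnj: "cmod z = 1 \<Longrightarrow> z * (a * cnj z) = a"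
  using mult_cnj_eq_1[of z] by (metis mult.left_commute mult.right_neutral)

text \<open>Brings the second gradient component into a form in which the conjugate of S is gone and
  |S| powr (2 m) is explicit on the circle.\<close>

lemma powr_mult_cnj:
  assumes "S \<noteq> 0" shows "of_real (cmod S powr (2 * m - 2)) * cnj S = of_real (cmod S powr (2 * m)) / S"
proof -
  have "of_real (cmod S powr (2 * m - 2)) * (S * cnj S) = complex_of_real (cmod S powr (2 * m - 2) * (cmod S)\<^sup>2)"
    by (simp only: complex_norm_square of_real_mult)
  also have "cmod S powr (2 * m - 2) * (cmod S)\<^sup>2 = cmod S powr (2 * m)"
    using assms by (simp add: powr_diff)
  finally show ?thesis using assms by (simp add: nonzero_eq_divide_eq mult_ac)
qed

text \<open>With D = 1 the factor z cancels against the conjugates on the circle, so both extensions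
  are constants, \<open>cnj x\<close> and \<open>e\<close>.\<close>

lemma explicit_disc_linear:
  assumes "0 < m" "(cmod x)\<^sup>2 + cmod y powr (2 * m) = 1"
    and f: "\<And>z. cmod z < 1 \<Longrightarrow> f z = x * z" and g: "\<And>z. cmod z < 1 \<Longrightarrow> g z = y * z"
  shows "explicit_disc m f g"
proof -
  define e where "e = of_real (m * cmod y powr (2 * m - 2)) * cnj y"
  have "z * of_real (m * (cmod 1)\<^sup>2 * cmod (y * z) powr (2 * m - 2)) * cnj (y * z) = e" if z: "cmod z = 1" for z
  proof -
    have "z * of_real (m * (cmod 1)\<^sup>2 * cmod (y * z) powr (2 * m - 2)) * cnj (y * z) = z * (e * cnj z)"
      using z by (simp add: e_def norm_mult)
    then show ?thesis unfolding mult_mult_cnj[OF z] .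
  qed
  moreover have "z * cnj (x * z) = cnj x" if "cmod z = 1" for z
    using mult_mult_cnj[OF that, of "cnj x"] by simp
  moreover have "egauge m (x * z / 1) (y * z) = 1" if "cmod z = 1" for z
    using assms(2) that by (simp add: egauge_def norm_mult)
  ultimately show ?thesis
    by (intro explicit_discI[of "\<lambda>z. x * z" "\<lambda>z. 1" "\<lambda>z. cnj x" "\<lambda>z. z" "\<lambda>z. y * z" "\<lambda>z. e"] disc_algebra_intros)
       (simp_all add: f g)
qed

text \<open>|S| = 1 on the circle, so only the denominator of cnj S has to be cleared. D = M does
  it, because z cnj (N z) = cnj \<omega> M z.\<close>

lemma explicit_disc_vertical:
  assumes "0 < m" "cmod c = 1" "cmod \<omega> = 1" "cmod b < 1"
    and f: "\<And>z. cmod z < 1 \<Longrightarrow> f z = 0" and g: "\<And>z. cmod z < 1 \<Longrightarrow> g z = c * ((b + \<omega> * z) / (1 + cnj b * \<omega> * z))"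
  shows "explicit_disc m f g"
proof -
  define M where "M z = 1 + cnj b * \<omega> * z" for z
  define N where "N z = b + \<omega> * z" for z
  have nz: "M z \<noteq> 0" if "cmod z \<le> 1" for z
    using one_plus_mult_neq_0[of "cnj b * \<omega>" z] that assms by (simp add: M_def norm_mult)
  have zM: "z * cnj (M z) = z + b * cnj \<omega>" and zN: "z * cnj (N z) = cnj \<omega> * M z" if "cmod z = 1" for z
  proof -
    show "z * cnj (M z) = z + b * cnj \<omega>" using that by (simp add: M_def distrib_left mult_mult_cnj)
    have "cnj \<omega> * (cnj b * \<omega> * z) = (\<omega> * cnj \<omega>) * (z * cnj b)" by (simp only: mult_ac)
    then have "cnj \<omega> * (cnj b * \<omega> * z) = z * cnj b" unfolding mult_cnj_eq_1[OF assms(3)] by simp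
    moreover have "z * cnj (N z) = z * cnj b + cnj \<omega>" using that by (simp add: N_def distrib_left mult_mult_cnj)
    ultimately show "z * cnj (N z) = cnj \<omega> * M z" by (simp only: M_def distrib_left mult_1_right add.commute)
  qed
  have MN: "cmod (N z) = cmod (M z)" if z: "cmod z = 1" for z
  proof -
    have "cmod (z * cnj (N z)) = cmod (cnj \<omega> * M z)" using zN[OF z] by simp
    then show ?thesis using z assms(3) by (simp add: norm_mult)
  qed
  have S1: "cmod (c * (N z / M z)) = 1" if z: "cmod z = 1" for z
    using MN[OF z] nz[of z] z assms(2) by (simp add: norm_mult norm_divide)
  have F: "z * of_real (m * (cmod (M z))\<^sup>2 * cmod (c * (N z / M z)) powr (2 * m - 2)) * cnj (c * (N z / M z))
     = of_real m * cnj c * cnj \<omega> * (M z * M z)" if z: "cmod z = 1" for z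
  proof -
    have "z * of_real (m * (cmod (M z))\<^sup>2 * cmod (c * (N z / M z)) powr (2 * m - 2)) * cnj (c * (N z / M z))
      = of_real m * (M z * cnj (M z)) * cnj c * ((z * cnj (N z)) / cnj (M z))"
      unfolding S1[OF z] complex_norm_square[symmetric] by simp
    also have "\<dots> = of_real m * cnj c * cnj \<omega> * (M z * M z)" unfolding zN[OF z] using nz[of z] z by simp
    finally show ?thesis .
  qed
  have M: "M \<in> disc_algebra" "N \<in> disc_algebra" unfolding M_def N_def by (intro disc_algebra_intros)+
  show ?thesis
  proof (rule explicit_discI[of "\<lambda>z. 0" M "\<lambda>z. 0" "\<lambda>z. z + b * cnj \<omega>" "\<lambda>z. c * (N z / M z)"
        "\<lambda>z. of_real m * cnj c * cnj \<omega> * (M z * M z)"])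
    show "egauge m (0 / M z) (c * (N z / M z)) = 1" if "cmod z = 1" for z
      using S1[OF that] by (simp add: egauge_def)
    show "f z = 0 / M z" if "cmod z < 1" for z using f[OF that] by simp
    show "g z = c * (N z / M z)" if "cmod z < 1" for z using g[OF that] by (simp only: M_def N_def)
  qed (intro disc_algebra_intros disc_algebra_divide M nz zM F | assumption | simp)+
qed

text \<open>With the multiplier |D|^2 the second component becomes m s M (z + cnj \<nu>) / (B G),
  where z + cnj \<nu> is the reflection of M. A zero of B must be cancelled by z + cnj \<nu>, which
  is what K records; |\<nu>| < 1 keeps G continuous and free of zeros up to the circle.\<close>

lemma explicit_disc_general:
  assumes m: "0 < m" and s: "0 < s" "s < 1" and \<nu>: "cmod \<nu> < 1" and u: "(cmod u)\<^sup>2 = 1 - s * (cmod \<nu>)\<^sup>2"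
    and c: "cmod c powr (2 * m) = s"
    and BK: "B \<in> disc_algebra" "K \<in> disc_algebra" "\<And>z. cmod z = 1 \<Longrightarrow> cmod (B z) = 1"
      "\<And>z. cmod z = 1 \<Longrightarrow> z + cnj \<nu> = K z * B z"
    and f: "\<And>z. cmod z < 1 \<Longrightarrow> f z = of_real (sqrt (1 - s)) * u * z / (1 + of_real s * \<nu> * z)"
    and g: "\<And>z. cmod z < 1 \<Longrightarrow> g z = B z * (c * exp ((Ln (1 + \<nu> * z) - Ln (1 + of_real s * \<nu> * z)) / of_real m))"
  shows "explicit_disc m f g"
proof -
  define M where "M z = 1 + \<nu> * z" for z
  define D where "D z = 1 + of_real s * \<nu> * z" for z
  define r where "r = sqrt (1 - s)"
  define G where "G z = c * exp ((Ln (M z) - Ln (D z)) / of_real m)" for z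
  have c0: "c \<noteq> 0" using c s by auto
  have pos: "0 < Re (M z)" "0 < Re (D z)" if z: "cmod z \<le> 1" for z
  proof -
    have 1: "cmod (\<nu> * z) < 1" using \<nu> z by (simp add: norm_mult) (smt (verit) mult_left_le norm_ge_zero)
    have "cmod (of_real s * (\<nu> * z)) \<le> cmod (\<nu> * z)"
      using s by (simp add: norm_mult[of "of_real s"] mult_left_le_one_le)
    then have "cmod (of_real s * \<nu> * z) < 1" using 1 by (simp add: mult.assoc)
    then show "0 < Re (M z)" "0 < Re (D z)" unfolding M_def D_def using 1 Re_one_plus_pos by blast+
  qed
  have nz: "M z \<noteq> 0" "D z \<noteq> 0" if z: "cmod z \<le> 1" for z by (intro nonzero_if_Re_pos pos z)+
  have Gnz: "G z \<noteq> 0" for z using c0 by (simp add: G_def)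
  have zM: "z * cnj (M z) = z + cnj \<nu>" and zD: "z * cnj (D z) = z + of_real s * cnj \<nu>" if "cmod z = 1" for z
    using that by (simp_all add: M_def D_def distrib_left mult_mult_cnj)
  have zP: "z * cnj (of_real r * u * z) = of_real r * cnj u" if "cmod z = 1" for z
    using that by (simp add: mult_mult_cnj mult.assoc[of "of_real r" u z])
  have Gn: "cmod (G z) powr (2 * m) = s * (cmod (M z) / cmod (D z))\<^sup>2" if z: "cmod z \<le> 1" for z
    unfolding G_def norm_mult using cmod_exp_Ln_diff_powr[OF m nz[OF z]] c by (simp add: powr_mult)
  define S where "S z = B z * G z" for z
  have Sn: "cmod (S z) powr (2 * m) = s * (cmod (M z) / cmod (D z))\<^sup>2" if z: "cmod z = 1" for z
    using Gn[of z] BK(3)[OF z] z by (simp add: S_def norm_mult)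
  have Snz: "S z \<noteq> 0" if "cmod z = 1" for z using Gnz BK(3)[OF that] by (auto simp: S_def)
  have eg: "egauge m (of_real r * u * z / D z) (S z) = 1" if z: "cmod z = 1" for z
  proof -
    have id: "(cmod (1 + of_real s * w))\<^sup>2 - s * (cmod (1 + w))\<^sup>2 = (1 - s) * (1 - s * (cmod w)\<^sup>2)" for w
      unfolding cmod_power2 by (simp add: power2_eq_square algebra_simps)
    have "(cmod (D z))\<^sup>2 = (1 - s) * (1 - s * (cmod \<nu>)\<^sup>2) + s * (cmod (M z))\<^sup>2"
      using id[of "\<nu> * z"] z unfolding M_def D_def by (simp add: norm_mult mult.assoc)
    moreover have "(cmod (of_real r * u * z / D z))\<^sup>2 = (1 - s) * (1 - s * (cmod \<nu>)\<^sup>2) / (cmod (D z))\<^sup>2"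
      using s z u by (simp add: norm_mult norm_divide power_divide power_mult_distrib r_def)
    ultimately show ?thesis
      unfolding egauge_def Sn[OF z] power_divide times_divide_eq_right
      using nz(2)[of z] z by (simp only: add_divide_distrib[symmetric]) (metis divide_self norm_eq_zero order_refl zero_eq_power2)
  qed
  have F: "z * of_real (m * (cmod (D z))\<^sup>2 * cmod (S z) powr (2 * m - 2)) * cnj (S z)
     = of_real (m * s) * (M z * K z / G z)" if z: "cmod z = 1" for z
  proof -
    have "z * of_real (m * (cmod (D z))\<^sup>2 * cmod (S z) powr (2 * m - 2)) * cnj (S z)
      = z * of_real (m * (cmod (D z))\<^sup>2) * (of_real (cmod (S z) powr (2 * m - 2)) * cnj (S z))" by simp
    also have "\<dots> = z * of_real (m * (cmod (D z))\<^sup>2 * (s * (cmod (M z) / cmod (D z))\<^sup>2)) / S z"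
      unfolding powr_mult_cnj[OF Snz[OF z]] Sn[OF z] by simp
    also have "m * (cmod (D z))\<^sup>2 * (s * (cmod (M z) / cmod (D z))\<^sup>2) = m * s * (cmod (M z))\<^sup>2"
      using nz[of z] z by (simp add: power_divide)
    also have "z * of_real (m * s * (cmod (M z))\<^sup>2) / S z = of_real (m * s) * (M z * (z * cnj (M z)) / S z)"
      using complex_norm_square[of "M z"] by (simp del: of_real_power)
    also have "\<dots> = of_real (m * s) * (M z * K z / G z)"
      unfolding zM[OF z] BK(4)[OF z] S_def using BK(3)[OF z] by (cases "B z = 0") auto
    finally show ?thesis .
  qed
  have MD: "M \<in> disc_algebra" "D \<in> disc_algebra" unfolding M_def D_def by (intro disc_algebra_intros)+
  have GA: "G \<in> disc_algebra" unfolding G_def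
    by (intro disc_algebra_intros disc_algebra_divide disc_algebra_Ln MD pos) (use m in auto)
  show ?thesis
  proof (rule explicit_discI[of "\<lambda>z. of_real r * u * z" D "\<lambda>z. of_real r * cnj u" "\<lambda>z. z + of_real s * cnj \<nu>"
        S "\<lambda>z. of_real (m * s) * (M z * K z / G z)"])
    show "f z = of_real r * u * z / D z" if "cmod z < 1" for z using f[OF that] by (simp only: r_def D_def)
    show "g z = S z" if "cmod z < 1" for z using g[OF that] by (simp only: S_def G_def M_def D_def)
    show "S \<in> disc_algebra" unfolding S_def by (intro disc_algebra_intros BK GA)
  qed (intro disc_algebra_intros disc_algebra_divide MD GA BK Gnz nz zD zP eg F | assumption)+
qed

section \<open>Maximal discs are explicit\<close>

text \<open>Extremality measured against the derivative of the disc itself instead of v, because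
  automorphisms change v.\<close>

definition emaximal :: "real \<Rightarrow> (complex \<Rightarrow> complex) \<Rightarrow> (complex \<Rightarrow> complex) \<Rightarrow> bool" where
  "emaximal m f g \<longleftrightarrow> edisc m f g \<and> (\<forall>p q. \<forall>\<mu>>0. edisc m p q \<and> p 0 = f 0 \<and> q 0 = g 0 \<and>
    deriv p 0 = of_real \<mu> * deriv f 0 \<and> deriv q 0 = of_real \<mu> * deriv g 0 \<longrightarrow> \<mu> \<le> 1)"

lemma emaximalD:
  assumes "emaximal m f g" "edisc m p q" "p 0 = f 0" "q 0 = g 0" "0 < \<mu>"
    "deriv p 0 = of_real \<mu> * deriv f 0" "deriv q 0 = of_real \<mu> * deriv g 0"
  shows "\<mu> \<le> 1"
  using assms unfolding emaximal_def by blast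

lemma emaximal_edisc: "emaximal m f g \<Longrightarrow> edisc m f g"
  by (simp add: emaximal_def)

lemma edisc_holomorphic:
  assumes "edisc m f g" shows "f holomorphic_on ball 0 1" "g holomorphic_on ball 0 1"
  using assms by (auto simp: edisc_def)

lemma edisc_less: "edisc m f g \<Longrightarrow> cmod z < 1 \<Longrightarrow> egauge m (f z) (g z) < 1"
  by (auto simp: edisc_def)

text \<open>f / z and g / z still obey the gauge bound. A gauge below 1 at 0 would leave room for a
  longer linear disc, so equality holds there and the strict maximum principle makes both quotients
  constant.\<close>

lemma emaximal_through_0:
  assumes m: "0 < m" and max: "emaximal m f g" and f0: "f 0 = 0" and g0: "g 0 = 0"
  shows "explicit_disc m f g"
proof -
  have ed: "edisc m f g" using emaximal_edisc[OF max] .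
  note hol = edisc_holomorphic[OF ed]
  obtain \<phi> where \<phi>: "\<phi> holomorphic_on ball 0 1" "\<And>z. cmod z < 1 \<Longrightarrow> f z = z * \<phi> z" "deriv f 0 = \<phi> 0"
    using Schwarz3[OF hol(1) f0] by blast
  obtain \<gamma> where \<gamma>: "\<gamma> holomorphic_on ball 0 1" "\<And>z. cmod z < 1 \<Longrightarrow> g z = z * \<gamma> z" "deriv g 0 = \<gamma> 0"
    using Schwarz3[OF hol(2) g0] by blast
  have le1: "egauge m (\<phi> z) (\<gamma> z) \<le> 1" if "cmod z < 1" for z
  proof (rule egauge_le_1_if_boundary[OF m \<phi>(1) \<gamma>(1) _ that])
    fix e :: real assume e: "e > 0"
    \<comment> \<open>The two terms scale with different powers of |z|; \<open>\<rho> powr M\<close>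
      lies below both of these powers for \<rho> < 1.\<close>
    define M where "M = max 2 (2 * m)"
    have "((\<lambda>r. r powr (- M)) \<longlongrightarrow> 1 powr (- M)) (at_left (1::real))" by (intro tendsto_intros) auto
    then have "\<forall>\<^sub>F r in at_left (1::real). r powr (- M) < 1 + e" using e by (intro order_tendstoD) auto
    then obtain r0 where r0: "r0 < 1" "\<And>r. r0 < r \<Longrightarrow> r < 1 \<Longrightarrow> r powr (- M) < 1 + e"
      by (auto simp: eventually_at_left_field)
    have "egauge m (\<phi> z) (\<gamma> z) \<le> 1 + e" if z: "max r0 0 < cmod z" "cmod z < 1" for z
    proof -
      define \<rho> where "\<rho> = cmod z"
      have \<rho>: "0 < \<rho>" "\<rho> < 1" using z by (auto simp: \<rho>_def)
      have 1: "\<rho> powr M \<le> \<rho>\<^sup>2"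
        using \<rho> powr_mono'[of 2 M \<rho>] by (simp add: M_def)
      have 2: "\<rho> powr M \<le> \<rho> powr (2 * m)" using \<rho> by (intro powr_mono') (auto simp: M_def)
      have "\<rho> powr M * egauge m (\<phi> z) (\<gamma> z) \<le> \<rho>\<^sup>2 * (cmod (\<phi> z))\<^sup>2 + \<rho> powr (2 * m) * cmod (\<gamma> z) powr (2 * m)"
        unfolding egauge_def distrib_left using 1 2 by (intro add_mono mult_right_mono) auto
      also have "\<dots> = egauge m (f z) (g z)"
        unfolding egauge_def \<phi>(2)[OF z(2)] \<gamma>(2)[OF z(2)] norm_mult \<rho>_def by (simp add: power_mult_distrib powr_mult)
      also have "\<dots> \<le> 1" using edisc_less[OF ed z(2)] by simp
      finally have "egauge m (\<phi> z) (\<gamma> z) \<le> \<rho> powr (- M)" using \<rho> by (simp add: powr_minus field_simps)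
      then show ?thesis using r0(2)[of \<rho>] z by (simp add: \<rho>_def)
    qed
    then show "\<exists>r0<1. \<forall>z. r0 < cmod z \<and> cmod z < 1 \<longrightarrow> egauge m (\<phi> z) (\<gamma> z) \<le> 1 + e"
      using r0(1) by (intro exI[of _ "max r0 0"]) auto
  qed
  have eq: "egauge m (\<phi> 0) (\<gamma> 0) = 1"
  proof (rule ccontr)
    assume "egauge m (\<phi> 0) (\<gamma> 0) \<noteq> 1"
    then have lt: "egauge m (\<phi> 0) (\<gamma> 0) < 1" using le1[of 0] by simp
    have "((\<lambda>\<mu>. (\<mu> * cmod (\<phi> 0))\<^sup>2 + (\<mu> * cmod (\<gamma> 0)) powr (2 * m)) \<longlongrightarrow> (1 * cmod (\<phi> 0))\<^sup>2 + (1 * cmod (\<gamma> 0)) powr (2 * m)) (at_right (1::real))"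
      using m by (intro tendsto_add tendsto_power tendsto_mult tendsto_powr' tendsto_intros)
        (auto simp: eventually_at_right_field intro!: exI[of _ 2])
    from order_tendstoD(2)[OF this, of 1]
    obtain \<mu>0 where \<mu>0: "1 < \<mu>0" "\<And>\<mu>. 1 < \<mu> \<Longrightarrow> \<mu> < \<mu>0 \<Longrightarrow> (\<mu> * cmod (\<phi> 0))\<^sup>2 + (\<mu> * cmod (\<gamma> 0)) powr (2 * m) < 1"
      using lt by (auto simp: egauge_def eventually_at_right_field)
    obtain \<mu> where \<mu>: "1 < \<mu>" "\<mu> < \<mu>0" using \<mu>0(1) dense by blast
    define p q where "p z = of_real \<mu> * \<phi> 0 * z" and "q z = of_real \<mu> * \<gamma> 0 * z" for z
    have "egauge m (p z) (q z) < 1" if z: "cmod z < 1" for z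
    proof -
      have "cmod (p z) \<le> \<mu> * cmod (\<phi> 0)" "cmod (q z) \<le> \<mu> * cmod (\<gamma> 0)"
        using \<mu> z by (auto simp: p_def q_def norm_mult mult_left_le)
      then have "egauge m (p z) (q z) \<le> (\<mu> * cmod (\<phi> 0))\<^sup>2 + (\<mu> * cmod (\<gamma> 0)) powr (2 * m)"
        unfolding egauge_def using m by (intro add_mono power_mono powr_mono2) auto
      then show ?thesis using \<mu>0(2)[OF \<mu>] by linarith
    qed
    then have "edisc m p q" unfolding edisc_def p_def q_def by (auto intro!: holomorphic_intros)
    moreover have "deriv p 0 = of_real \<mu> * deriv f 0" "deriv q 0 = of_real \<mu> * deriv g 0"
      unfolding p_def q_def \<phi>(3) \<gamma>(3) by (auto intro!: DERIV_imp_deriv derivative_eq_intros)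
    ultimately have "\<mu> \<le> 1" using \<mu> by (intro emaximalD[OF max, of p q]) (auto simp: p_def q_def f0 g0)
    then show False using \<mu> by simp
  qed
  have c: "\<phi> z = \<phi> 0" "\<gamma> z = \<gamma> 0" if "cmod z < 1" for z
    using egauge_strict_max[OF m \<phi>(1) \<gamma>(1), of 0 z] le1 eq that by auto
  show ?thesis
  proof (rule explicit_disc_linear[OF m])
    show "(cmod (\<phi> 0))\<^sup>2 + cmod (\<gamma> 0) powr (2 * m) = 1" using eq by (simp add: egauge_def)
    show "f z = \<phi> 0 * z" "g z = \<gamma> 0 * z" if "cmod z < 1" for z
      using \<phi>(2)[OF that] \<gamma>(2)[OF that] unfolding c(1)[OF that] c(2)[OF that] by (simp_all add: mult.commute)
  qed
qed

text \<open>Selects the branch when logarithms of the same function are compared: exp of the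
  difference is constantly 1, so the difference has derivative 0.\<close>

lemma eq_if_exp_eq:
  assumes p: "p holomorphic_on ball 0 1" and q: "q holomorphic_on ball 0 1" and 0: "p 0 = q 0"
    and eq: "\<And>z. cmod z < 1 \<Longrightarrow> exp (p z) = exp (q z)" and z: "cmod z < 1"
  shows "p z = q z"
proof -
  define d where "d z = p z - q z" for z
  have d: "d holomorphic_on ball 0 1" unfolding d_def by (intro holomorphic_intros p q)
  have e1: "exp (d z) = 1" if "cmod z < 1" for z using eq[OF that] by (simp add: d_def exp_diff)
  have "(d has_field_derivative 0) (at w within ball 0 1)" if w: "w \<in> ball 0 1" for w
  proof -
    have dw: "(d has_field_derivative deriv d w) (at w)" using holomorphic_derivI[OF d open_ball w] .
    have "((\<lambda>z. exp (d z)) has_field_derivative exp (d w) * deriv d w) (at w)"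
      by (rule DERIV_chain2[OF DERIV_exp dw])
    moreover have "((\<lambda>z. exp (d z)) has_field_derivative 0) (at w)"
      by (rule has_field_derivative_transform_within_open[OF DERIV_const[of 1] open_ball w]) (simp add: e1)
    ultimately have "exp (d w) * deriv d w = 0" by (rule DERIV_unique)
    then have "deriv d w = 0" by simp
    then show ?thesis using dw by (metis DERIV_subset subset_UNIV)
  qed
  then obtain c where "\<And>z. z \<in> ball 0 1 \<Longrightarrow> d z = c"
    using has_field_derivative_zero_constant[OF convex_ball] by blast
  then have "d z = d 0" using z by simp
  then show ?thesis using 0 by (simp add: d_def)
qed

text \<open>Strict domination leaves room for a factor \<mu> > 1, and
  \<open>edisc_through_point\<close> realizes \<mu> times the derivative of the disc, against
  maximality.\<close>

lemma emaximal_undominated: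
  assumes m: "0 < m" "m < 1/2" and max: "emaximal m f g" and f0: "f 0 = 0" and g0: "g 0 \<noteq> 0"
    and L_eq: "L = cmod (deriv f 0)" and R_eq: "R = cmod (deriv g 0 / g 0)" and s0_eq: "s0 = cmod (g 0) powr (2 * m)"
  shows "two_parameter_region.undominated m s0 L R"
proof -
  interpret two_parameter_region m s0 L R
    using m g0 by unfold_locales (auto simp: s0_eq L_eq)
  show ?thesis unfolding undominated_def
  proof (intro allI impI, rule ccontr)
    fix x t :: real
    assume x: "0 \<le> x" and t: "0 \<le> t" "t \<le> 1" and sg: "sg x < 1" and "\<not> (P x t \<le> L\<^sup>2 \<or> E x t \<le> R)"
    then have lt: "L\<^sup>2 < P x t" "R < E x t" by auto
    have "((\<lambda>\<mu>. (\<mu> * L)\<^sup>2) \<longlongrightarrow> (1 * L)\<^sup>2) (at_right (1::real))" "((\<lambda>\<mu>. \<mu> * R) \<longlongrightarrow> 1 * R) (at_right (1::real))"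
      by (intro tendsto_intros)+
    then have "\<forall>\<^sub>F \<mu> in at_right (1::real). (\<mu> * L)\<^sup>2 < P x t" "\<forall>\<^sub>F \<mu> in at_right (1::real). \<mu> * R < E x t"
      using lt by (auto dest: order_tendstoD(2))
    then have "\<forall>\<^sub>F \<mu> in at_right (1::real). (\<mu> * L)\<^sup>2 < P x t \<and> \<mu> * R < E x t" by (rule eventually_conj)
    then obtain \<mu>0 where \<mu>0: "1 < \<mu>0" "\<And>\<mu>. 1 < \<mu> \<Longrightarrow> \<mu> < \<mu>0 \<Longrightarrow> (\<mu> * L)\<^sup>2 < P x t \<and> \<mu> * R < E x t"
      by (auto simp: eventually_at_right_field)
    obtain \<mu> where \<mu>: "1 < \<mu>" "\<mu> < \<mu>0" using \<mu>0(1) dense by blast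
    have "\<exists>p q. edisc m p q \<and> p 0 = 0 \<and> q 0 = g 0 \<and> deriv p 0 = of_real \<mu> * deriv f 0 \<and>
        deriv q 0 = g 0 * (of_real \<mu> * (deriv g 0 / g 0))"
    proof (rule edisc_through_point[where \<tau> = "exp (- x)" and s = "sg x" and t = t])
      show "cmod (g 0) powr (2 * m) = sg x * exp (- x) powr (2 * m)"
      proof -
        have "sg x * exp (- x) powr (2 * m) = s0 * (exp (2 * m * x) * exp (- (2 * m * x)))"
          by (simp add: sg_def powr_def mult.assoc)
        then show ?thesis by (simp add: s0_eq flip: exp_add)
      qed
      show "(cmod (of_real \<mu> * deriv f 0))\<^sup>2 \<le> (1 - sg x) * (1 - sg x * t\<^sup>2)"
        using \<mu>0(2)[OF \<mu>] \<mu> by (simp add: norm_mult L_eq P_def)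
      have "1 / exp (- x) - exp (- x) = 2 * sinh x" by (simp add: sinh_field_def exp_minus field_simps)
      then show "cmod (of_real \<mu> * (deriv g 0 / g 0)) \<le> 1 / exp (- x) - exp (- x) + (1 - sg x) * t / m"
        using \<mu>0(2)[OF \<mu>] \<mu> unfolding norm_mult R_eq[symmetric] E_def by simp
    qed (use m x t sg sg_pos[of x] in auto)
    then obtain p q where pq: "edisc m p q" "p 0 = 0" "q 0 = g 0" "deriv p 0 = of_real \<mu> * deriv f 0"
        "deriv q 0 = g 0 * (of_real \<mu> * (deriv g 0 / g 0))" by blast
    have "\<mu> \<le> 1" using emaximalD[OF max pq(1), of \<mu>] pq f0 g0 \<mu> by simp
    then show False using \<mu> by simp
  qed
qed

text \<open>The factorization g = B G determines a parameter point: exp (- x) = |B 0|, and t = |h'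
  0| / (1 - s) with h = m log G and s = |G 0| powr (2 m). Optimality turns the Schwarz-type bounds
  into equalities, whose rigidity statements recover f, G and, if x > 0, B.\<close>

lemma emaximal_centered:
  assumes m: "0 < m" "m < 1/2" and max: "emaximal m f g" and f0: "f 0 = 0" and g0: "g 0 \<noteq> 0"
  shows "explicit_disc m f g"
proof -
  have ed: "edisc m f g" using emaximal_edisc[OF max] .
  note hol = edisc_holomorphic[OF ed]
  obtain B G where B: "B holomorphic_on ball 0 1" and G: "G holomorphic_on ball 0 1"
    and gBG: "\<And>z. cmod z < 1 \<Longrightarrow> g z = B z * G z" and B1: "\<And>z. cmod z < 1 \<Longrightarrow> cmod (B z) \<le> 1"
    and Gnz: "\<And>z. cmod z < 1 \<Longrightarrow> G z \<noteq> 0" and eg: "\<And>z. cmod z < 1 \<Longrightarrow> egauge m (f z) (G z) \<le> 1"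
    by (rule zero_free_factor[OF m(1) hol _ g0]) (use edisc_less[OF ed] in \<open>auto intro: less_imp_le\<close>)
  obtain l where l: "l holomorphic_on ball 0 1" "\<And>z. cmod z < 1 \<Longrightarrow> exp (l z) = G z"
    using holomorphic_logarithm_exists[OF convex_ball open_ball G, of 0] Gnz by auto
  define h where "h z = of_real m * l z" for z
  have h: "h holomorphic_on ball 0 1" unfolding h_def by (intro holomorphic_intros l(1))
  have Gh: "cmod (G z) powr (2 * m) = exp (2 * Re (h z))" if "cmod z < 1" for z
  proof -
    have "cmod (G z) = exp (Re (l z))" using l(2)[OF that] by (metis norm_exp_eq_Re)
    then show ?thesis by (simp add: powr_def h_def)
  qed
  have fh: "(cmod (f z))\<^sup>2 + exp (2 * Re (h z)) \<le> 1" if "cmod z < 1" for z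
    using eg[OF that] Gh[OF that] by (simp add: egauge_def)
  define \<tau> x s L R y \<kappa> where "\<tau> = cmod (B 0)" and "x = - ln \<tau>" and "s = exp (2 * Re (h 0))"
    and "L = cmod (deriv f 0)" and "R = cmod (deriv g 0 / g 0)" and "y = deriv h 0" and "\<kappa> = deriv B 0 / B 0"
  define s0 where "s0 = cmod (g 0) powr (2 * m)"
  interpret two_parameter_region m s0 L R
    using m g0 by unfold_locales (auto simp: s0_def L_def)
  have nd: undominated using emaximal_undominated[OF m max f0 g0 L_def R_def s0_def] .
  have B0: "B 0 \<noteq> 0" and G0: "G 0 \<noteq> 0" using gBG[of 0] g0 by auto
  have \<tau>: "0 < \<tau>" "\<tau> \<le> 1" using B0 B1[of 0] by (auto simp: \<tau>_def)
  have x0: "0 \<le> x" using \<tau> by (simp add: x_def)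
  have ex: "exp (- x) = \<tau>" "exp x = 1 / \<tau>" using \<tau> by (simp_all add: x_def exp_minus field_simps)
  have sinh2: "2 * sinh x = 1 / \<tau> - \<tau>" by (simp add: sinh_field_def ex)
  have s_G: "s = cmod (G 0) powr (2 * m)" using Gh[of 0] by (simp add: s_def)
  have s0s: "s0 = \<tau> powr (2 * m) * s"
    unfolding s0_def s_G using gBG[of 0] by (simp add: \<tau>_def norm_mult powr_mult)
  have sgx: "sg x = s"
  proof -
    have "exp (2 * m * x) = inverse (\<tau> powr (2 * m))"
      using \<tau> by (simp add: powr_def x_def exp_minus[symmetric])
    then have "sg x = s0 * inverse (\<tau> powr (2 * m))" by (simp add: sg_def)
    also have "\<dots> = s" unfolding s0s using \<tau> by simp
    finally show ?thesis .
  qed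
  have s1: "s \<le> 1" using fh[of 0] zero_le_power2[of "cmod (f 0)"] by (simp add: s_def f0)
  have \<kappa>_le: "cmod \<kappa> \<le> 2 * sinh x" and \<kappa>_eq: "cmod \<kappa> = 2 * sinh x \<Longrightarrow> cmod (deriv B 0) = 1 - (cmod (B 0))\<^sup>2"
  proof -
    have e: "2 * sinh x = (1 - (cmod (B 0))\<^sup>2) / cmod (B 0)"
      unfolding sinh2 using B0 by (simp add: \<tau>_def power2_eq_square field_simps)
    show "cmod \<kappa> \<le> 2 * sinh x" unfolding e \<kappa>_def norm_divide
      using Schwarz_Pick_at_0(1)[OF B B1] B0 by (intro divide_right_mono) auto
    show "cmod (deriv B 0) = 1 - (cmod (B 0))\<^sup>2" if "cmod \<kappa> = 2 * sinh x"
      using that B0 unfolding e \<kappa>_def norm_divide by simp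
  qed
  have dB: "(B has_field_derivative deriv B 0) (at 0)" and dl: "(l has_field_derivative deriv l 0) (at 0)"
    using holomorphic_derivI[OF B open_ball, of 0] holomorphic_derivI[OF l(1) open_ball, of 0] by simp_all
  have yl: "y = of_real m * deriv l 0"
    unfolding y_def h_def by (rule DERIV_imp_deriv[OF DERIV_cmult[OF dl]])
  have "deriv g 0 / g 0 = \<kappa> + y / of_real m"
  proof -
    have "(g has_field_derivative deriv B 0 * exp (l 0) + exp (l 0) * deriv l 0 * B 0) (at 0)"
      by (rule has_field_derivative_transform_within_open[OF DERIV_mult[OF dB DERIV_chain2[OF DERIV_exp dl]] open_ball[of 0 1]])
         (use gBG l(2) in auto)
    then have "deriv g 0 = deriv B 0 * exp (l 0) + exp (l 0) * deriv l 0 * B 0" by (rule DERIV_imp_deriv)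
    moreover have "g 0 = B 0 * exp (l 0)" using gBG[of 0] l(2)[of 0] by simp
    ultimately show ?thesis using B0 m by (simp add: \<kappa>_def yl field_simps)
  qed
  then have R: "R = cmod (\<kappa> + y / of_real m)" by (simp add: R_def)
  have moebius: "\<exists>\<omega>. cmod \<omega> = 1 \<and> (\<forall>z. cmod z < 1 \<longrightarrow> B z = (B 0 + \<omega> * z) / (1 + cnj (B 0) * \<omega> * z))"
    if "cmod \<kappa> = 2 * sinh x" "0 < x"
    using Schwarz_Pick_at_0(2)[OF B B1 \<kappa>_eq[OF that(1)]] that(2) \<tau>
    by (auto simp: x_def \<tau>_def[symmetric])
  show ?thesis
  proof (cases "s = 1")
    \<comment> \<open>(f, G) attains gauge 1 at the origin, so f = 0 and G is constant: the disc
      stays in a vertical line.\<close>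
    case True
    have eq1: "egauge m (f 0) (G 0) = 1" using True by (simp add: egauge_def f0 s_G)
    have c: "f z = 0" "G z = G 0" if "cmod z < 1" for z
      using egauge_strict_max[OF m(1) hol(1) G, of 0 z] eg eq1 that f0 by auto
    have x_pos: "0 < x"
    proof (rule ccontr)
      assume "\<not> 0 < x"
      then have "x = 0" using x0 by simp
      then have "s0 = 1" using sgx True by (simp add: sg_def)
      then show False using edisc_less[OF ed, of 0] by (simp add: s0_def egauge_def f0)
    qed
    have "(f has_field_derivative 0) (at 0)"
      by (rule has_field_derivative_transform_within_open[OF DERIV_const[of 0] open_ball[of 0 1]]) (use c(1) in auto)
    then have L0: "L = 0" by (simp add: L_def DERIV_imp_deriv)
    have "(g has_field_derivative deriv B 0 * G 0) (at 0)"
    proof (rule has_field_derivative_transform_within_open[OF DERIV_cmult_right[OF dB] open_ball[of 0 1]])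
      fix z :: complex assume "z \<in> ball 0 1"
      then show "B z * G 0 = g z" using gBG[of z] c(2)[of z] by simp
    qed simp
    then have "R = cmod \<kappa>" using gBG[of 0] G0 by (simp add: R_def \<kappa>_def DERIV_imp_deriv)
    \<comment> \<open>\<open>sg x = 1\<close> is not admissible, so x is approached from below with
      t = 0; there P u 0 = 1 - sg u is positive while L = 0.\<close>
    moreover have "2 * sinh x \<le> R"
    proof (rule ccontr)
      assume lt: "\<not> 2 * sinh x \<le> R"
      have "((\<lambda>u. 2 * sinh u) \<longlongrightarrow> 2 * sinh x) (at_left x)"
        by (intro tendsto_intros)
      from order_tendstoD(1)[OF this, of R] obtain u0 where u0: "u0 < x" "\<And>u. u0 < u \<Longrightarrow> u < x \<Longrightarrow> R < 2 * sinh u"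
        using lt by (auto simp: eventually_at_left_field)
      obtain u where u: "max 0 u0 < u" "u < x" using u0(1) x_pos dense[of "max 0 u0" x] by auto
      have "sg u < 1" using u sgx True m s0 by (simp add: sg_def flip: True sgx)
      then have "E u 0 \<le> R" using u by (intro undominatedD[OF nd]) (auto simp: P_def L0)
      then show False using u0(2)[of u] u by (simp add: E_def)
    qed
    ultimately have "cmod \<kappa> = 2 * sinh x" using \<kappa>_le by simp
    from moebius[OF this x_pos] obtain \<omega> where \<omega>: "cmod \<omega> = 1"
      "\<And>z. cmod z < 1 \<Longrightarrow> B z = (B 0 + \<omega> * z) / (1 + cnj (B 0) * \<omega> * z)" by blast
    show ?thesis
    proof (rule explicit_disc_vertical[OF m(1) _ \<omega>(1)])
      have "(cmod (G 0) powr (2 * m)) powr (1 / (2 * m)) = 1" using True by (simp add: s_G)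
      then show "cmod (G 0) = 1" using m by (simp add: powr_powr)
      show "cmod (B 0) < 1" using x_pos \<tau> by (simp add: x_def \<tau>_def)
      show "f z = 0" "g z = G 0 * ((B 0 + \<omega> * z) / (1 + cnj (B 0) * \<omega> * z))" if "cmod z < 1" for z
        using c[OF that] gBG[OF that] \<omega>(2)[OF that] by (simp_all add: mult.commute)
    qed
  next
    case False
    then have s: "0 < s" "s < 1" using s1 by (auto simp: s_def)
    define H where "H z = exp (h z)" for z
    have H: "H holomorphic_on ball 0 1" unfolding H_def by (intro holomorphic_intros h)
    define q where "q = H 0"
    have q0: "q \<noteq> 0" by (simp add: q_def H_def)
    have sq: "s = (cmod q)\<^sup>2" by (simp add: s_def q_def H_def exp_double)
    have fH: "(cmod (f z))\<^sup>2 + (cmod (H z))\<^sup>2 \<le> 1" if "cmod z < 1" for z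
      using fh[OF that] by (simp add: H_def exp_double)
    have dh: "(h has_field_derivative y) (at 0)"
      using holomorphic_derivI[OF h open_ball, of 0] by (simp add: y_def)
    have dH: "(H has_field_derivative q * y) (at 0)"
      unfolding H_def q_def by (rule DERIV_chain2[OF DERIV_exp dh])
    \<comment> \<open>Normalized so that, with H' 0 = q y, the two terms of the ball Schwarz lemma
      become L^2 / (1 - s) and s t^2.\<close>
    define t where "t = cmod y / (1 - s)"
    have t: "0 \<le> t" "cmod y = (1 - s) * t" using s by (auto simp: t_def)
    note BS = ball_Schwarz[OF hol(1) H f0 q_def[symmetric] sq s(2) fH]
    have "(cmod (deriv H 0))\<^sup>2 = s * ((1 - s) * t)\<^sup>2"
      by (simp only: DERIV_imp_deriv[OF dH] norm_mult power_mult_distrib[of "cmod q"] sq[symmetric] t(2))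
    then have dH2: "(cmod (deriv H 0))\<^sup>2 / (1 - s)\<^sup>2 = s * t\<^sup>2" using s by (simp add: power_mult_distrib)
    have LP_iff: "L\<^sup>2 / (1 - s) + s * t\<^sup>2 \<le> 1 \<longleftrightarrow> L\<^sup>2 \<le> P x t" "L\<^sup>2 / (1 - s) + s * t\<^sup>2 = 1 \<longleftrightarrow> L\<^sup>2 = P x t"
      unfolding P_def sgx using s by (auto simp: field_simps)
    have LP: "L\<^sup>2 \<le> P x t" using BS(1) unfolding dH2 L_def[symmetric] LP_iff by blast
    have cy: "cmod (y / of_real m) = (1 - s) * t / m" using t m by (simp add: norm_divide)
    have RE: "R \<le> E x t"
      unfolding R E_def sgx using norm_triangle_ineq[of \<kappa> "y / of_real m"] \<kappa>_le cy by linarith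
    have L1: "L < 1"
    proof -
      have "0 \<le> s * t\<^sup>2" using s by simp
      then have "L\<^sup>2 / (1 - s) \<le> 1" using LP LP_iff(1) by linarith
      then have "L\<^sup>2 < 1" using s by (simp add: field_simps)
      then show ?thesis using L by (simp add: abs_square_less_1)
    qed
    have zf: "(1 - sg x) * t \<le> L + ln ((1 - L) / sg x)"
    proof -
      have "ln s = 2 * Re (h 0)" by (simp add: s_def)
      then show ?thesis using zero_free_bound[OF hol(1) h f0 _ fh] L1 s
        by (simp add: sgx t(2)[symmetric] L_def[symmetric] y_def[symmetric] ln_div)
    qed
    have R0: "0 \<le> R" by (simp add: R_def)
    have sx: "sg x < 1" using sgx s by simp
    note par = undominated_parameters[OF nd x0 sx t(1) R0 LP RE zf]
    have "L\<^sup>2 / (1 - s) + s * t\<^sup>2 = 1" using par(2) LP_iff(2) by blast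
    then obtain u w where uw: "(cmod u)\<^sup>2 + (cmod w)\<^sup>2 = 1"
      "\<And>z. cmod z < 1 \<Longrightarrow> f z = of_real (sqrt (1 - s)) * u * z / (1 - cnj q * w * z)"
      "\<And>z. cmod z < 1 \<Longrightarrow> H z = (q - w * z) / (1 - cnj q * w * z)"
      using BS(2) unfolding dH2 L_def[symmetric] by blast
    \<comment> \<open>The coefficient in H z = q (1 + \<nu> z) / (1 + s \<nu> z), read off from the
      derivative at 0.\<close>
    define \<nu> where "\<nu> = y / of_real (1 - s)"
    have \<nu>t: "cmod \<nu> = t" using t s by (simp add: \<nu>_def norm_divide del: of_real_diff)
    have "(cmod w)\<^sup>2 \<le> 1" using uw(1) zero_le_power2[of "cmod u"] by linarith
    then have w1: "cmod w \<le> 1" by (simp add: abs_square_le_1)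
    have q1: "cmod q < 1" using s(2) unfolding sq by (simp add: abs_square_less_1)
    have nz: "1 - cnj q * w * z \<noteq> 0" if "cmod z < 1" for z
      using one_minus_mult_neq_0[of "cnj q" "w * z"] q1 w1 that by (simp add: norm_mult mult_le_one mult.assoc)
    have w\<nu>: "w = - q * \<nu>"
    proof -
      have d1: "((\<lambda>z. H z * (1 - cnj q * w * z)) has_field_derivative q * y * (1 - cnj q * w * 0) + - (cnj q * w) * H 0) (at 0)"
        by (rule DERIV_mult[OF dH]) (auto intro!: derivative_eq_intros)
      have "((\<lambda>z. H z * (1 - cnj q * w * z)) has_field_derivative - w) (at 0)"
        by (rule has_field_derivative_transform_within_open[of "\<lambda>z. q - w * z" _ _ "ball 0 1"])
           (use uw(3) nz in \<open>auto intro!: derivative_eq_intros\<close>)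
      from DERIV_unique[OF d1 this] have "q * y = - w * (1 - cnj q * q)"
        by (simp add: q_def[symmetric] algebra_simps)
      also have "1 - cnj q * q = of_real (1 - s)"
        by (simp add: sq complex_norm_square mult.commute del: of_real_power)
      finally show ?thesis using s by (simp add: \<nu>_def field_simps del: of_real_diff)
    qed
    have qw: "cnj q * w = - of_real s * \<nu>"
      unfolding w\<nu> sq by (simp add: complex_norm_square mult.commute mult.left_commute del: of_real_power)
    have u2: "(cmod u)\<^sup>2 = 1 - s * (cmod \<nu>)\<^sup>2"
      using uw(1) unfolding w\<nu> sq by (simp add: norm_mult power_mult_distrib)
    have \<nu>1: "cmod \<nu> < 1"
      using par(4,5) x0 unfolding \<nu>t by (cases "x = 0") auto
    have f_eq: "f z = of_real (sqrt (1 - s)) * u * z / (1 + of_real s * \<nu> * z)" if "cmod z < 1" for z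
      using uw(2)[OF that] unfolding qw by simp
    \<comment> \<open>H is an m-th power of G and determines G only up to a branch; logarithms that
      agree at 0 settle it.\<close>
    have G_eq: "G z = G 0 * exp ((Ln (1 + \<nu> * z) - Ln (1 + of_real s * \<nu> * z)) / of_real m)" if z: "cmod z < 1" for z
    proof -
      have pos: "0 < Re (1 + \<nu> * z)" "0 < Re (1 + of_real s * \<nu> * z)" if "cmod z < 1" for z
      proof -
        have 1: "cmod (\<nu> * z) < 1" using \<nu>1 that by (simp add: norm_mult) (smt (verit) mult_left_le norm_ge_zero)
        have "cmod (of_real s * (\<nu> * z)) \<le> cmod (\<nu> * z)"
          using s by (simp add: norm_mult[of "of_real s"] mult_left_le_one_le)
        then have "cmod (of_real s * \<nu> * z) < 1" using 1 by (simp add: mult.assoc)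
        then show "0 < Re (1 + \<nu> * z)" "0 < Re (1 + of_real s * \<nu> * z)" using 1 Re_one_plus_pos by blast+
      qed
      define k where "k z = Ln (1 + \<nu> * z) - Ln (1 + of_real s * \<nu> * z) + h 0" for z
      have k: "k holomorphic_on ball 0 1" unfolding k_def
        by (intro holomorphic_intros)
           (use not_nonpos_Reals_if_Re_pos[OF pos(1)] not_nonpos_Reals_if_Re_pos[OF pos(2)] in auto)
      have hk: "exp (h z) = exp (k z)" if z: "cmod z < 1" for z
      proof -
        have n: "1 + \<nu> * z \<noteq> 0" "1 + of_real s * \<nu> * z \<noteq> 0" by (intro nonzero_if_Re_pos pos z)+
        have "exp (k z) = (1 + \<nu> * z) / (1 + of_real s * \<nu> * z) * q"
          using n by (simp add: k_def exp_add exp_diff q_def H_def)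
        moreover have "H z = (q + q * \<nu> * z) / (1 + of_real s * \<nu> * z)"
          using uw(3)[OF z] unfolding qw unfolding w\<nu> by simp
        ultimately have "H z = exp (k z)" by (simp add: distrib_left mult.commute mult.left_commute)
        then show ?thesis by (simp only: H_def)
      qed
      have "h 0 = k 0" by (simp add: k_def)
      from eq_if_exp_eq[OF h k this hk z] have "h z = k z" .
      then have "l z = (Ln (1 + \<nu> * z) - Ln (1 + of_real s * \<nu> * z)) / of_real m + l 0"
        using m by (simp add: h_def k_def field_simps)
      then show ?thesis using l(2)[OF z] l(2)[of 0] by (simp add: exp_add mult.commute)
    qed
    show ?thesis
    proof (cases "x = 0")
      case True
      then have b1: "cmod (B 0) = 1" using ex(1) by (simp add: \<tau>_def)
      have Bc: "B z = B 0" if "cmod z < 1" for z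
      proof -
        have "(\<forall>z. cmod z < 1 \<longrightarrow> cmod (B z) < 1) \<or> (\<forall>z. cmod z < 1 \<longrightarrow> B z = B 0) \<and> cmod (B 0) = 1"
          by (rule norm_less_1_or_constant[OF B B1])
        moreover have "\<not> (\<forall>z. cmod z < 1 \<longrightarrow> cmod (B z) < 1)" using b1 by (intro notI) (drule spec[of _ 0], simp)
        ultimately show ?thesis using that by blast
      qed
      show ?thesis
      proof (rule explicit_disc_general[where B = "\<lambda>_. B 0" and K = "\<lambda>z. (z + cnj \<nu>) / B 0", OF m(1) s \<nu>1 u2 s_G[symmetric] _ _ _ _ f_eq])
        show "(\<lambda>z. (z + cnj \<nu>) / B 0) \<in> disc_algebra" using B0 by (intro disc_algebra_intros disc_algebra_divide)
        show "g z = B 0 * (G 0 * exp ((Ln (1 + \<nu> * z) - Ln (1 + of_real s * \<nu> * z)) / of_real m))" if "cmod z < 1" for z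
          using gBG[OF that] unfolding Bc[OF that] G_eq[OF that] .
        show "(\<lambda>_. B 0) \<in> disc_algebra" by (rule disc_algebra_const)
      qed (use b1 B0 in simp_all)
    next
      case False
      then have x_pos: "0 < x" using x0 by simp
      have tau: "t = \<tau>" using par(5)[OF x_pos] ex by simp
      have eqn: "cmod (\<kappa> + y / of_real m) = 2 * sinh x + (1 - s) * t / m"
        using par(3) unfolding R E_def sgx .
      then have \<kappa>n: "cmod \<kappa> = 2 * sinh x"
        using norm_triangle_ineq[of \<kappa> "y / of_real m"] \<kappa>_le cy by linarith
      then have "cmod (\<kappa> + y / of_real m) = cmod \<kappa> + cmod (y / of_real m)" using eqn cy by simp
      \<comment> \<open>Equality in the triangle inequality makes \<kappa> and y / m parallel;
        together with |\<nu>| = \<tau> this determines \<nu> including its argument.\<close>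
      then have al: "cmod \<kappa> *\<^sub>R (y / of_real m) = cmod (y / of_real m) *\<^sub>R \<kappa>" using norm_triangle_eq by blast
      from moebius[OF \<kappa>n x_pos] obtain \<omega> where \<omega>: "cmod \<omega> = 1"
        "\<And>z. cmod z < 1 \<Longrightarrow> B z = (B 0 + \<omega> * z) / (1 + cnj (B 0) * \<omega> * z)" by blast
      have bb: "B 0 * cnj (B 0) = of_real (\<tau>\<^sup>2)" unfolding \<tau>_def complex_norm_square ..
      have \<tau>1: "\<tau> < 1" using x_pos \<tau> by (simp add: x_def)
      have "deriv B 0 = \<omega> * of_real (1 - \<tau>\<^sup>2)"
      proof -
        have "((\<lambda>z. (B 0 + \<omega> * z) / (1 + cnj (B 0) * \<omega> * z)) has_field_derivative \<omega> - B 0 * (cnj (B 0) * \<omega>)) (at 0)"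
          by (auto intro!: derivative_eq_intros)
        then have "(B has_field_derivative \<omega> - B 0 * (cnj (B 0) * \<omega>)) (at 0)"
        proof (rule has_field_derivative_transform_within_open[OF _ open_ball[of 0 1]])
          fix z :: complex assume "z \<in> ball 0 1"
          then show "(B 0 + \<omega> * z) / (1 + cnj (B 0) * \<omega> * z) = B z" by (intro \<omega>(2)[symmetric]) simp
        qed simp
        then have "deriv B 0 = \<omega> - (B 0 * cnj (B 0)) * \<omega>" by (simp add: DERIV_imp_deriv mult.assoc)
        then show ?thesis unfolding bb by (simp add: algebra_simps)
      qed
      then have kap: "\<kappa> = \<omega> * of_real (1 - \<tau>\<^sup>2) / B 0" by (simp add: \<kappa>_def)
      \<comment> \<open>Equivalent to z + cnj \<nu> = cnj \<omega> (B 0 + \<omega> z): B and the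
        reflected numerator share their zero.\<close>
      have \<nu>\<omega>: "\<nu> = cnj (B 0) * \<omega>"
      proof -
        have kc: "cmod \<kappa> = (1 - \<tau>\<^sup>2) / \<tau>" unfolding \<kappa>n sinh2 using \<tau> by (simp add: field_simps power2_eq_square)
        have t2: "0 < 1 - \<tau>\<^sup>2" using \<tau> \<tau>1 by (simp add: power_less_one_iff)
        have "y = of_real (1 - s) * \<nu>" using s by (simp add: \<nu>_def del: of_real_diff)
        then have "of_real ((1 - \<tau>\<^sup>2) / \<tau>) * (of_real (1 - s) * \<nu> / of_real m) = of_real ((1 - s) * \<tau> / m) * (\<omega> * of_real (1 - \<tau>\<^sup>2) / B 0)"
          using al unfolding cy kc tau scaleR_conv_of_real unfolding kap by simp
        moreover define e k T M where "e = complex_of_real (1 - s)" and "k = complex_of_real (1 - \<tau>\<^sup>2)"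
          and "T = complex_of_real \<tau>" and "M = complex_of_real m"
        ultimately have eq: "k / T * (e * \<nu> / M) = e * T / M * (\<omega> * k / B 0)"
          by (simp only: of_real_divide of_real_mult)
        have nz: "e \<noteq> 0" "k \<noteq> 0" "T \<noteq> 0" "M \<noteq> 0"
          using s t2 \<tau> m unfolding e_def k_def T_def M_def of_real_eq_0_iff by auto
        have "(e * k / M) * (\<nu> / T) = k / T * (e * \<nu> / M)" by (simp add: mult_ac)
        also note eq
        also have "e * T / M * (\<omega> * k / B 0) = (e * k / M) * (T * \<omega> / B 0)" by (simp add: mult_ac)
        finally have "(e * k / M) * (\<nu> / T) = (e * k / M) * (T * \<omega> / B 0)" .
        moreover have "e * k / M \<noteq> 0" using nz by simp
        ultimately have "\<nu> / T = T * \<omega> / B 0" using mult_left_cancel by blast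
        then have "\<nu> / of_real \<tau> = of_real \<tau> * \<omega> / B 0" unfolding T_def .
        then have "\<nu> = of_real (\<tau>\<^sup>2) * \<omega> / B 0" using \<tau> by (simp add: power2_eq_square field_simps)
        then show ?thesis unfolding bb[symmetric] using B0 by simp
      qed
      define M where "M z = 1 + cnj (B 0) * \<omega> * z" for z
      have Mnz: "M z \<noteq> 0" if "cmod z \<le> 1" for z
        unfolding M_def using one_plus_mult_neq_0[of "cnj (B 0) * \<omega>" z] \<tau>1 \<omega>(1) that by (simp add: norm_mult \<tau>_def)
      have MA: "M \<in> disc_algebra" unfolding M_def by (intro disc_algebra_intros)
      have \<omega>\<omega>: "cnj \<omega> * \<omega> = 1" using mult_cnj_eq_1[OF \<omega>(1)] by (simp add: mult.commute)
      have NM: "z + cnj \<nu> = cnj \<omega> * M z * ((B 0 + \<omega> * z) / M z)" if "cmod z = 1" for z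
      proof -
        have "cnj \<omega> * (B 0 + \<omega> * z) = cnj \<nu> + cnj \<omega> * \<omega> * z" unfolding \<nu>\<omega> by (simp add: algebra_simps)
        then show ?thesis using Mnz[of z] that unfolding \<omega>\<omega> by (simp add: add.commute)
      qed
      show ?thesis
      proof (rule explicit_disc_general[where B = "\<lambda>z. (B 0 + \<omega> * z) / M z" and K = "\<lambda>z. cnj \<omega> * M z", OF m(1) s \<nu>1 u2 s_G[symmetric] _ _ _ NM f_eq])
        show "(\<lambda>z. (B 0 + \<omega> * z) / M z) \<in> disc_algebra"
          by (intro disc_algebra_intros disc_algebra_divide MA Mnz)
        show "(\<lambda>z. cnj \<omega> * M z) \<in> disc_algebra" by (intro disc_algebra_intros MA)
        show "cmod ((B 0 + \<omega> * z) / M z) = 1" if z: "cmod z = 1" for z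
        proof -
          have "cmod (z * cnj (B 0 + \<omega> * z)) = cmod (cnj \<omega> * M z)"
          proof -
            have "z * cnj (B 0 + \<omega> * z) = z * cnj (B 0) + cnj \<omega>" using z by (simp add: distrib_left mult_mult_cnj)
            moreover have "cnj \<omega> * M z = cnj \<omega> + (cnj \<omega> * \<omega>) * (z * cnj (B 0))"
              by (simp add: M_def algebra_simps)
            ultimately have "z * cnj (B 0 + \<omega> * z) = cnj \<omega> * M z" unfolding \<omega>\<omega> by (simp add: add.commute)
            then show ?thesis by (rule arg_cong)
          qed
          then have "cmod (B 0 + \<omega> * z) = cmod (M z)" using z \<omega>(1) by (simp only: norm_mult complex_mod_cnj mult_1_left mult_1_right)
          then show ?thesis using Mnz[of z] z by (simp add: norm_divide)
        qed
        show "g z = (B 0 + \<omega> * z) / M z * (G 0 * exp ((Ln (1 + \<nu> * z) - Ln (1 + of_real s * \<nu> * z)) / of_real m))" if "cmod z < 1" for z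
          using gBG[OF that] \<omega>(2)[OF that] unfolding M_def[symmetric] G_eq[OF that] by simp
      qed
    qed
  qed
qed

section \<open>Automorphisms of the ellipsoid\<close>

definition shift1 :: "complex \<Rightarrow> complex \<Rightarrow> complex" where
  "shift1 a w = (w + a) / (1 + cnj a * w)"

text \<open>A branch of v ((1 - |a|^2) / (1 + cnj a w)^2) powr (1 / (2 m)), the second coordinate of
  the automorphism lying over \<open>shift1 a\<close>.\<close>

definition shift2 :: "real \<Rightarrow> complex \<Rightarrow> complex \<Rightarrow> complex \<Rightarrow> complex" where
  "shift2 m a w v = of_real ((1 - (cmod a)\<^sup>2) powr (1 / (2 * m))) * v * exp (- Ln (1 + cnj a * w) / of_real m)"

context
  fixes m :: real and a :: complex
  assumes m: "0 < m" and a: "cmod a < 1"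
begin

lemma one_minus_a2_pos: "0 < 1 - (cmod a)\<^sup>2"
  using a by (simp add: power_less_one_iff)

lemma Re_one_plus_cnj_mult_pos: "cmod w \<le> 1 \<Longrightarrow> 0 < Re (1 + cnj a * w)"
proof -
  assume "cmod w \<le> 1"
  then have "cmod (cnj a * w) \<le> cmod a" by (simp add: norm_mult mult_left_le)
  then show ?thesis using a by (intro Re_one_plus_pos) simp
qed

lemma cmod_shift2_powr:
  assumes "cmod w \<le> 1"
  shows "cmod (shift2 m a w v) powr (2 * m) = (1 - (cmod a)\<^sup>2) * cmod v powr (2 * m) / (cmod (1 + cnj a * w))\<^sup>2"
proof -
  have W: "1 + cnj a * w \<noteq> 0" by (intro nonzero_if_Re_pos Re_one_plus_cnj_mult_pos assms)
  have "cmod (exp (- Ln (1 + cnj a * w) / of_real m)) powr (2 * m) = exp (- (2 * ln (cmod (1 + cnj a * w))))"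
    using W m by (simp add: powr_def)
  also have "\<dots> = 1 / (cmod (1 + cnj a * w))\<^sup>2"
    using W by (simp add: exp_minus exp_double field_simps)
  finally show ?thesis unfolding shift2_def norm_mult
    using one_minus_a2_pos m by (simp add: powr_mult powr_powr)
qed

text \<open>Both terms of the Moebius identity acquire the same positive factor, so the shift
  preserves the domain as well as its boundary.\<close>

lemma one_minus_egauge_shift:
  assumes "cmod w \<le> 1"
  shows "1 - egauge m (shift1 a w) (shift2 m a w v) = (1 - (cmod a)\<^sup>2) * (1 - egauge m w v) / (cmod (1 + cnj a * w))\<^sup>2"
proof -
  define d where "d = (cmod (1 + cnj a * w))\<^sup>2"
  have "1 + cnj a * w \<noteq> 0" by (intro nonzero_if_Re_pos Re_one_plus_cnj_mult_pos assms)
  then have d: "d \<noteq> 0" by (simp add: d_def)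
  have "d - (cmod (w + a))\<^sup>2 = (1 - (cmod a)\<^sup>2) * (1 - (cmod w)\<^sup>2)"
    unfolding d_def cmod_power2 by (simp add: power2_eq_square algebra_simps)
  moreover have "(cmod (shift1 a w))\<^sup>2 = (cmod (w + a))\<^sup>2 / d"
    by (simp add: shift1_def norm_divide power_divide d_def)
  ultimately show ?thesis unfolding egauge_def cmod_shift2_powr[OF assms] d_def[symmetric]
    using d by (simp add: field_simps)
qed

text \<open>The branches fit together because 1 - cnj a * shift1 a w is (1 - |a|^2) / W with W in
  the right half-plane, where the logarithm of the quotient splits.\<close>

lemma shift1_inverse: "cmod w < 1 \<Longrightarrow> shift1 (- a) (shift1 a w) = w"
  and shift2_inverse: "cmod w < 1 \<Longrightarrow> shift2 m (- a) (shift1 a w) (shift2 m a w v) = v"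
proof -
  assume w: "cmod w < 1"
  define W where "W = 1 + cnj a * w"
  define \<kappa> where "\<kappa> = 1 - (cmod a)\<^sup>2"
  have \<kappa>: "0 < \<kappa>" using one_minus_a2_pos by (simp add: \<kappa>_def)
  have ReW: "0 < Re W" unfolding W_def using w by (intro Re_one_plus_cnj_mult_pos) simp
  have W: "W \<noteq> 0" using ReW by (rule nonzero_if_Re_pos)
  have \<kappa>c: "of_real \<kappa> = 1 - cnj a * a" by (simp add: \<kappa>_def complex_norm_square mult.commute del: of_real_power)
  have s1: "shift1 a w = (w + a) / W" by (simp add: shift1_def W_def)
  have V: "1 + cnj (- a) * shift1 a w = of_real \<kappa> * inverse W"
    unfolding s1 \<kappa>c using W by (simp add: field_simps) (simp add: W_def algebra_simps)
  have "shift1 a w + - a = of_real \<kappa> * inverse W * w"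
    unfolding s1 \<kappa>c using W by (simp add: field_simps) (simp add: W_def algebra_simps)
  then show "shift1 (- a) (shift1 a w) = w"
    unfolding shift1_def[of "- a"] V using W \<kappa> by simp
  have LV: "Ln (of_real \<kappa> * inverse W) = of_real (ln \<kappa>) - Ln W"
    using Ln_times_of_real[OF \<kappa>, of "inverse W"] Ln_inverse[OF not_nonpos_Reals_if_Re_pos[OF ReW]] W Ln_of_real[OF \<kappa>] by simp
  have "of_real (\<kappa> powr (1 / (2 * m))) * of_real (\<kappa> powr (1 / (2 * m))) = complex_of_real (exp (ln \<kappa> / m))"
    unfolding of_real_mult[symmetric] using \<kappa> m by (simp add: powr_def flip: exp_add)
  then have CC: "of_real (\<kappa> powr (1 / (2 * m))) * of_real (\<kappa> powr (1 / (2 * m))) = exp (complex_of_real (ln \<kappa>) / of_real m)"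
    by (simp add: exp_of_real[symmetric])
  have "shift2 m (- a) (shift1 a w) (shift2 m a w v) =
    (of_real (\<kappa> powr (1 / (2 * m))) * of_real (\<kappa> powr (1 / (2 * m)))) * v * (exp (- Ln W / of_real m) * exp (- (of_real (ln \<kappa>) - Ln W) / of_real m))"
    unfolding shift2_def[of _ "- a"] V LV by (simp add: shift2_def W_def[symmetric] \<kappa>_def[symmetric])
  also have "\<dots> = v * (exp (complex_of_real (ln \<kappa>) / of_real m) * (exp (- Ln W / of_real m) * exp (- (of_real (ln \<kappa>) - Ln W) / of_real m)))"
    unfolding CC by simp
  also have "exp (complex_of_real (ln \<kappa>) / of_real m) * (exp (- Ln W / of_real m) * exp (- (of_real (ln \<kappa>) - Ln W) / of_real m)) = 1"
    unfolding exp_add[symmetric] by (simp add: diff_divide_distrib add_divide_distrib[symmetric])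
  finally show "shift2 m (- a) (shift1 a w) (shift2 m a w v) = v" by simp
qed

text \<open>Written so as to be linear in (p', q') with coefficients depending only on the values at
  0; a common factor \<mu> therefore passes through.\<close>

lemma shift_deriv:
  assumes p: "(p has_field_derivative p') (at 0)" and q: "(q has_field_derivative q') (at 0)" and p0: "cmod (p 0) < 1"
  shows "((\<lambda>z. shift1 a (p z)) has_field_derivative (1 - a * cnj a) / (1 + cnj a * p 0)\<^sup>2 * p') (at 0)"
    and "((\<lambda>z. shift2 m a (p z) (q z)) has_field_derivative
      shift2 m a (p 0) q' - shift2 m a (p 0) (q 0) * (cnj a / (of_real m * (1 + cnj a * p 0))) * p') (at 0)"
proof -
  have pos: "0 < Re (1 + cnj a * p 0)" using p0 by (intro Re_one_plus_cnj_mult_pos) simp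
  have nz: "1 + cnj a * p 0 \<noteq> 0" using pos by (rule nonzero_if_Re_pos)
  have d1: "((\<lambda>z. 1 + cnj a * p z) has_field_derivative cnj a * p') (at 0)"
    using DERIV_add[OF DERIV_const[of 1] DERIV_cmult[OF p, of "cnj a"]] by simp
  have d2: "((\<lambda>z. p z + a) has_field_derivative p') (at 0)"
    using DERIV_add[OF p DERIV_const[of a]] by simp
  show "((\<lambda>z. shift1 a (p z)) has_field_derivative (1 - a * cnj a) / (1 + cnj a * p 0)\<^sup>2 * p') (at 0)"
    unfolding shift1_def
    by (rule DERIV_cong[OF DERIV_divide[OF d2 d1 nz]]) (use nz in \<open>simp add: divide_simps power2_eq_square, simp add: algebra_simps\<close>)
  have "((\<lambda>z. Ln (1 + cnj a * p z)) has_field_derivative inverse (1 + cnj a * p 0) * (cnj a * p')) (at 0)"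
    by (rule DERIV_chain2[OF has_field_derivative_Ln[OF not_nonpos_Reals_if_Re_pos[OF pos]] d1])
  from DERIV_cdivide[OF DERIV_minus[OF this], of "of_real m"]
  have "((\<lambda>z. exp (- Ln (1 + cnj a * p z) / of_real m)) has_field_derivative
     exp (- Ln (1 + cnj a * p 0) / of_real m) * (- (inverse (1 + cnj a * p 0) * (cnj a * p')) / of_real m)) (at 0)"
    by (rule DERIV_chain2[OF DERIV_exp])
  from DERIV_mult[OF DERIV_cmult[OF q, of "of_real ((1 - (cmod a)\<^sup>2) powr (1 / (2 * m)))"] this]
  show "((\<lambda>z. shift2 m a (p z) (q z)) has_field_derivative
      shift2 m a (p 0) q' - shift2 m a (p 0) (q 0) * (cnj a / (of_real m * (1 + cnj a * p 0))) * p') (at 0)"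
    unfolding shift2_def by (rule DERIV_cong) (use nz m in \<open>simp add: field_simps\<close>)
qed

lemma edisc_shift:
  assumes ed: "edisc m f g"
  shows "edisc m (\<lambda>z. shift1 a (f z)) (\<lambda>z. shift2 m a (f z) (g z))"
proof -
  note hol = edisc_holomorphic[OF ed]
  have f1: "cmod (f z) \<le> 1" if "cmod z < 1" for z
    using egauge_le_1D(1)[OF m] edisc_less[OF ed that] by (meson less_imp_le)
  have pos: "0 < Re (1 + cnj a * f z)" if "cmod z < 1" for z by (intro Re_one_plus_cnj_mult_pos f1 that)
  have "egauge m (shift1 a (f z)) (shift2 m a (f z) (g z)) < 1" if z: "cmod z < 1" for z
  proof -
    have "0 < (1 - (cmod a)\<^sup>2) * (1 - egauge m (f z) (g z)) / (cmod (1 + cnj a * f z))\<^sup>2"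
      using one_minus_a2_pos edisc_less[OF ed z] nonzero_if_Re_pos[OF pos[OF z]] by (intro divide_pos_pos mult_pos_pos) auto
    then show ?thesis unfolding one_minus_egauge_shift[OF f1[OF z], symmetric] by simp
  qed
  moreover have "(\<lambda>z. shift1 a (f z)) holomorphic_on ball 0 1" unfolding shift1_def
    by (intro holomorphic_intros hol) (use nonzero_if_Re_pos[OF pos] in auto)
  moreover have "(\<lambda>z. shift2 m a (f z) (g z)) holomorphic_on ball 0 1" unfolding shift2_def
    by (intro holomorphic_intros hol) (use m not_nonpos_Reals_if_Re_pos[OF pos] in auto)
  ultimately show ?thesis by (simp add: edisc_def)
qed

end

text \<open>A competitor is pulled back by the shift with - a, which keeps the factor \<mu> between
  the derivatives.\<close>

lemma emaximal_shift:
  assumes m: "0 < m" and a: "cmod a < 1" and max: "emaximal m f g"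
  shows "emaximal m (\<lambda>z. shift1 a (f z)) (\<lambda>z. shift2 m a (f z) (g z))"
  unfolding emaximal_def
proof (intro conjI allI impI, goal_cases)
  case 1
  show ?case by (intro edisc_shift m a emaximal_edisc[OF max])
next
  case (2 p q \<mu>)
  then have pq: "edisc m p q" "p 0 = shift1 a (f 0)" "q 0 = shift2 m a (f 0) (g 0)" "0 < \<mu>"
    "deriv p 0 = of_real \<mu> * deriv (\<lambda>z. shift1 a (f z)) 0"
    "deriv q 0 = of_real \<mu> * deriv (\<lambda>z. shift2 m a (f z) (g z)) 0" by auto
  have ed: "edisc m f g" using emaximal_edisc[OF max] .
  have a': "cmod (- a) < 1" using a by simp
  have lt1: "cmod (p z) < 1" if "edisc m p q" "cmod z < 1" for p q z
  proof -
    have "(cmod (p z))\<^sup>2 < 1"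
      using edisc_less[OF that] powr_ge_zero[of "cmod (q z)" "2*m"] unfolding egauge_def by linarith
    then show ?thesis by (simp add: abs_square_less_1)
  qed
  define F G where "F z = shift1 a (f z)" and "G z = shift2 m a (f z) (g z)" for z
  have edF: "edisc m F G" unfolding F_def G_def by (intro edisc_shift m a ed)
  have undo: "shift1 (- a) (F z) = f z" "shift2 m (- a) (F z) (G z) = g z" if "cmod z < 1" for z
    unfolding F_def G_def by (intro shift1_inverse[OF m a] shift2_inverse[OF m a] lt1[OF ed that])+
  have D: "(h has_field_derivative deriv h 0) (at 0)" if "h holomorphic_on ball 0 1" for h
    using holomorphic_derivI[OF that open_ball, of 0] by simp
  note dp = D[OF edisc_holomorphic(1)[OF pq(1)]] and dq = D[OF edisc_holomorphic(2)[OF pq(1)]]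
  note dF = D[OF edisc_holomorphic(1)[OF edF]] and dG = D[OF edisc_holomorphic(2)[OF edF]]
  have z0: "cmod (0::complex) < 1" by simp
  note S = shift_deriv[OF m a' dp dq lt1[OF pq(1) z0]] and SF = shift_deriv[OF m a' dF dG lt1[OF edF z0]]
  have eqs: "p 0 = F 0" "q 0 = G 0" "deriv p 0 = of_real \<mu> * deriv F 0" "deriv q 0 = of_real \<mu> * deriv G 0"
    using pq unfolding F_def G_def by auto
  have df: "deriv f 0 = (1 - - a * cnj (- a)) / (1 + cnj (- a) * F 0)\<^sup>2 * deriv F 0"
    by (rule DERIV_imp_deriv, rule has_field_derivative_transform_within_open[OF SF(1) open_ball[of 0 1]]) (use undo in auto)
  have dg: "deriv g 0 = shift2 m (- a) (F 0) (deriv G 0) - shift2 m (- a) (F 0) (G 0) * (cnj (- a) / (of_real m * (1 + cnj (- a) * F 0))) * deriv F 0"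
    by (rule DERIV_imp_deriv, rule has_field_derivative_transform_within_open[OF SF(2) open_ball[of 0 1]]) (use undo in auto)
  have lin: "shift2 m (- a) w (c * v) = c * shift2 m (- a) w v" for w c v by (simp add: shift2_def)
  show "\<mu> \<le> 1"
  proof (rule emaximalD[OF max edisc_shift[OF m a' pq(1)] _ _ pq(4)])
    show "shift1 (- a) (p 0) = f 0" "shift2 m (- a) (p 0) (q 0) = g 0" using undo[OF z0] eqs by auto
    show "deriv (\<lambda>z. shift1 (- a) (p z)) 0 = of_real \<mu> * deriv f 0"
      unfolding DERIV_imp_deriv[OF S(1)] df eqs by simp
    show "deriv (\<lambda>z. shift2 m (- a) (p z) (q z)) 0 = of_real \<mu> * deriv g 0"
      unfolding DERIV_imp_deriv[OF S(2)] dg eqs lin by (simp only: right_diff_distrib mult_ac)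
  qed
qed

text \<open>P and D mix linearly, and so do their reflections. On the circle |D'|^2 |S'| powr (2 m)
  is (1 - |a|^2) |D|^2 |S| powr (2 m), so |D'|^2 is again a multiplier, and 1 / S' contributes exp X
  / C.\<close>

lemma explicit_disc_shift:
  assumes m: "0 < m" and a: "cmod a < 1" and ex: "explicit_disc m f g" and ed: "edisc m f g"
  shows "explicit_disc m (\<lambda>z. shift1 a (f z)) (\<lambda>z. shift2 m a (f z) (g z))"
proof -
  obtain P D PS DS S F where A: "P \<in> disc_algebra" "D \<in> disc_algebra" "PS \<in> disc_algebra" "DS \<in> disc_algebra"
      "S \<in> disc_algebra" "F \<in> disc_algebra"
    and D: "\<And>z. cmod z \<le> 1 \<Longrightarrow> D z \<noteq> 0"
    and PS: "\<And>z. cmod z = 1 \<Longrightarrow> z * cnj (P z) = PS z" and DS: "\<And>z. cmod z = 1 \<Longrightarrow> z * cnj (D z) = DS z"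
    and eg: "\<And>z. cmod z = 1 \<Longrightarrow> egauge m (P z / D z) (S z) = 1"
    and F: "\<And>z. cmod z = 1 \<Longrightarrow> z * of_real (m * (cmod (D z))\<^sup>2 * cmod (S z) powr (2 * m - 2)) * cnj (S z) = F z"
    and fg: "\<And>z. cmod z < 1 \<Longrightarrow> f z = P z / D z" "\<And>z. cmod z < 1 \<Longrightarrow> g z = S z"
    using ex unfolding explicit_disc_def by auto
  define C where "C = (1 - (cmod a)\<^sup>2) powr (1 / (2 * m))"
  have C: "C > 0" using one_minus_a2_pos[OF m a] by (simp add: C_def)
  have PD1: "cmod (P z / D z) \<le> 1" if "cmod z \<le> 1" for z
  proof (cases "cmod z = 1")
    case True
    then show ?thesis using egauge_le_1D(1)[OF m, of "P z / D z" "S z"] eg[OF True] by simp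
  next
    case False
    then have "cmod z < 1" using that by simp
    then show ?thesis using egauge_le_1D(1)[OF m, of "f z" "g z"] edisc_less[OF ed] fg by (simp add: less_imp_le)
  qed
  define P' D' X where "P' z = P z + a * D z" and "D' z = D z + cnj a * P z" and "X z = Ln (1 + cnj a * (P z / D z)) / of_real m" for z
  have pos: "0 < Re (1 + cnj a * (P z / D z))" if "cmod z \<le> 1" for z
    by (intro Re_one_plus_cnj_mult_pos[OF m a] PD1 that)
  have W: "1 + cnj a * (P z / D z) = D' z / D z" if "cmod z \<le> 1" for z
    using D[OF that] by (simp add: D'_def divide_simps)
  have D': "D' z \<noteq> 0" if "cmod z \<le> 1" for z
    using nonzero_if_Re_pos[OF pos[OF that]] unfolding W[OF that] by auto
  have sh1: "shift1 a (P z / D z) = P' z / D' z" if "cmod z \<le> 1" for z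
    unfolding shift1_def W[OF that] using D[OF that] D'[OF that] by (simp add: P'_def divide_simps)
  define S' where "S' z = of_real C * (S z * exp (- X z))" for z
  have sh2: "shift2 m a (P z / D z) (S z) = S' z" for z
    by (simp add: shift2_def S'_def X_def C_def)
  have XA: "X \<in> disc_algebra" unfolding X_def
    by (intro disc_algebra_intros disc_algebra_divide disc_algebra_Ln A D pos) (use m in auto)
  have XA': "(\<lambda>z. - X z) \<in> disc_algebra"
    using disc_algebra_diff[OF disc_algebra_const[of 0] XA] by simp
  show ?thesis
  proof (rule explicit_discI[of P' D' "\<lambda>z. PS z + cnj a * DS z" "\<lambda>z. DS z + a * PS z" S'
        "\<lambda>z. of_real ((1 - (cmod a)\<^sup>2) / C) * (F z * exp (X z))"])
    show "P' \<in> disc_algebra" "D' \<in> disc_algebra" "S' \<in> disc_algebra" unfolding P'_def D'_def S'_def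
      by (intro disc_algebra_intros A XA')+
    show "(\<lambda>z. PS z + cnj a * DS z) \<in> disc_algebra" "(\<lambda>z. DS z + a * PS z) \<in> disc_algebra"
      "(\<lambda>z. of_real ((1 - (cmod a)\<^sup>2) / C) * (F z * exp (X z))) \<in> disc_algebra"
      by (intro disc_algebra_intros A XA)+
    show "D' z \<noteq> 0" if "cmod z \<le> 1" for z using D'[OF that] .
    show "shift1 a (f z) = P' z / D' z" "shift2 m a (f z) (g z) = S' z" if "cmod z < 1" for z
      using sh1[of z] sh2[of z] fg that by auto
    fix z :: complex assume z: "cmod z = 1"
    show "z * cnj (P' z) = PS z + cnj a * DS z" "z * cnj (D' z) = DS z + a * PS z"
      unfolding PS[OF z, symmetric] DS[OF z, symmetric] by (simp_all add: P'_def D'_def algebra_simps)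
    show "egauge m (P' z / D' z) (S' z) = 1"
      using one_minus_egauge_shift[OF m a PD1, of z "S z"] z eg[OF z] sh1[of z] sh2[of z] by simp
    show "z * of_real (m * (cmod (D' z))\<^sup>2 * cmod (S' z) powr (2 * m - 2)) * cnj (S' z) = of_real ((1 - (cmod a)\<^sup>2) / C) * (F z * exp (X z))"
    \<comment> \<open>The computation divides by S; at a zero of S the function F vanishes
      too.\<close>
    proof (cases "S z = 0")
      case True
      then show ?thesis using F[OF z] by (simp add: S'_def)
    next
      case False
      then have S'0: "S' z \<noteq> 0" using C by (simp add: S'_def)
      have S'n: "cmod (S' z) powr (2 * m) = (1 - (cmod a)\<^sup>2) * cmod (S z) powr (2 * m) / (cmod (D' z / D z))\<^sup>2"
        using cmod_shift2_powr[OF m a PD1, of z "S z"] sh2[of z] W[of z] z by simp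
      have 1: "m * (cmod (D' z))\<^sup>2 * cmod (S' z) powr (2 * m) = (1 - (cmod a)\<^sup>2) * (m * (cmod (D z))\<^sup>2 * cmod (S z) powr (2 * m))"
        unfolding S'n using D[of z] D'[of z] z by (simp add: norm_divide power_divide)
      have "z * of_real (m * (cmod (D' z))\<^sup>2 * cmod (S' z) powr (2 * m - 2)) * cnj (S' z)
        = z * of_real (m * (cmod (D' z))\<^sup>2) * (of_real (cmod (S' z) powr (2 * m - 2)) * cnj (S' z))" by simp
      also have "\<dots> = z * of_real (m * (cmod (D' z))\<^sup>2 * cmod (S' z) powr (2 * m)) / S' z"
        unfolding powr_mult_cnj[OF S'0] by simp
      also have "\<dots> = of_real ((1 - (cmod a)\<^sup>2) / C) * ((z * of_real (m * (cmod (D z))\<^sup>2) * (of_real (cmod (S z) powr (2 * m)) / S z)) * exp (X z))"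
        unfolding 1 unfolding S'_def using C False by (simp add: exp_minus field_simps)
      also have "z * of_real (m * (cmod (D z))\<^sup>2) * (of_real (cmod (S z) powr (2 * m)) / S z) = F z"
        unfolding powr_mult_cnj[OF False, symmetric] F[OF z, symmetric] by simp
      finally show ?thesis .
    qed
  qed
qed

section \<open>Stationarity\<close>

lemma holomorphic_power_compose:
  assumes "h holomorphic_on ball 0 1" "0 < k"
  shows "(\<lambda>z. h (z ^ k)) holomorphic_on ball 0 1"
proof (rule holomorphic_on_compose_gen[OF _ assms(1), of "\<lambda>z. z ^ k", unfolded o_def])
  show "(\<lambda>z::complex. z ^ k) ` ball 0 1 \<subseteq> ball 0 1"
    using assms(2) by (auto simp: norm_power power_less_one_iff)
qed (intro holomorphic_intros)

lemma disc_algebra_bounded: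
  assumes "h \<in> disc_algebra" obtains M where "\<And>z. cmod z \<le> 1 \<Longrightarrow> cmod (h z) \<le> M"
proof -
  have "compact (h ` cball 0 1)"
    using assms by (intro compact_continuous_image) (auto simp: disc_algebra_def)
  then obtain M where "\<forall>x\<in>h ` cball 0 1. cmod x \<le> M" using compact_imp_bounded[of "h ` cball 0 1"] by (auto simp: bounded_iff)
  then show ?thesis by (intro that[of M]) simp
qed

lemma disc_algebra_radial_limit:
  assumes h: "h \<in> disc_algebra" and z: "cmod z = 1"
  shows "((\<lambda>r::real. h ((of_real r * z) ^ k)) \<longlongrightarrow> h (z ^ k)) (at_left 1)"
proof (rule continuous_on_tendsto_compose[of "cball 0 1" h])
  show "continuous_on (cball 0 1) h" using h by (simp add: disc_algebra_def)
  have "((\<lambda>r::real. (of_real r * z) ^ k) \<longlongrightarrow> (of_real 1 * z) ^ k) (at_left 1)" by (intro tendsto_intros)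
  then show "((\<lambda>r::real. (of_real r * z) ^ k) \<longlongrightarrow> z ^ k) (at_left 1)" by simp
  show "\<forall>\<^sub>F r in at_left (1::real). (of_real r * z) ^ k \<in> cball 0 1"
    unfolding eventually_at_left_field
    by (rule exI[of _ 0]) (auto simp: norm_mult norm_power z power_le_one)
qed (auto simp: norm_power z)

lemma eventually_radius_at_left_1: "\<forall>\<^sub>F r in at_left (1::real). 0 < r \<and> r < 1"
  unfolding eventually_at_left_field by (rule exI[of _ 0]) auto

lemma continuous_on_circle_measurable:
  fixes c :: "complex \<Rightarrow> real"
  assumes "continuous_on (sphere 0 1) c" shows "c \<in> borel_measurable circle_measure"
  unfolding circle_measure_def measurable_distr_eq1
  by (rule borel_measurable_continuous_on_restrict[OF assms])

lemma tendsto_vec2: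
  fixes f :: "'b \<Rightarrow> complex ^ 2" and l :: "complex ^ 2"
  assumes "((\<lambda>x. f x $ 1) \<longlongrightarrow> l $ 1) F" "((\<lambda>x. f x $ 2) \<longlongrightarrow> l $ 2) F"
  shows "(f \<longlongrightarrow> l) F"
proof (rule vec_tendstoI)
  fix i :: 2
  show "((\<lambda>x. f x $ i) \<longlongrightarrow> l $ i) F" using exhaust_2[of i] assms by (elim disjE) simp_all
qed

lemma bounded_vec2:
  fixes f :: "'b \<Rightarrow> complex ^ 2"
  assumes "\<And>x. x \<in> A \<Longrightarrow> cmod (f x $ 1) \<le> M1" "\<And>x. x \<in> A \<Longrightarrow> cmod (f x $ 2) \<le> M2"
  shows "bounded (f ` A)"
proof -
  have "norm (f x) \<le> M1 + M2" if "x \<in> A" for x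
  proof -
    have "norm (f x) \<le> (\<Sum>i\<in>UNIV. norm (f x $ i))" unfolding norm_vec_def by (rule L2_set_le_sum) simp
    also have "\<dots> \<le> M1 + M2" using assms[OF that] by (simp add: sum_2)
    finally show ?thesis .
  qed
  then show ?thesis by (auto simp: bounded_iff)
qed

lemma ellipsoid_iff_egauge: "z \<in> ellipsoid m \<longleftrightarrow> egauge m (z $ 1) (z $ 2) < 1"
  by (simp add: ellipsoid_def egauge_def)

text \<open>At w = z^k the factor w in the relations of the explicit disc is the z^k that
  k-stationarity asks for, so substitution gives the claim with c z = |D (z^k)|^2.\<close>

lemma k_stationary_if_explicit_disc:
  fixes f :: "complex \<Rightarrow> complex ^ 2"
  assumes m: "0 < m" "m < 1/2" and k: "0 < k"
    and ed: "edisc m (\<lambda>z. f z $ 1) (\<lambda>z. f z $ 2)" and ex: "explicit_disc m (\<lambda>z. f z $ 1) (\<lambda>z. f z $ 2)"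
  shows "k_stationary_Linf k (ellipsoid_rho m) (\<lambda>z. f (z ^ k))"
proof -
  obtain P D PS DS S F where A: "P \<in> disc_algebra" "D \<in> disc_algebra" "PS \<in> disc_algebra"
      "S \<in> disc_algebra" "F \<in> disc_algebra"
    and D: "\<And>z. cmod z \<le> 1 \<Longrightarrow> D z \<noteq> 0" and PS: "\<And>z. cmod z = 1 \<Longrightarrow> z * cnj (P z) = PS z"
    and eg: "\<And>z. cmod z = 1 \<Longrightarrow> egauge m (P z / D z) (S z) = 1"
    and F: "\<And>z. cmod z = 1 \<Longrightarrow> z * of_real (m * (cmod (D z))\<^sup>2 * cmod (S z) powr (2 * m - 2)) * cnj (S z) = F z"
    and fg: "\<And>z. cmod z < 1 \<Longrightarrow> f z $ 1 = P z / D z" "\<And>z. cmod z < 1 \<Longrightarrow> f z $ 2 = S z"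
    using ex unfolding explicit_disc_def by auto
  have PD: "(\<lambda>z. P z / D z) \<in> disc_algebra" by (intro disc_algebra_divide A D)
  define fb :: "complex \<Rightarrow> complex ^ 2" where "fb z = vector [P (z ^ k) / D (z ^ k), S (z ^ k)]" for z
  define c where "c z = (cmod (D (z ^ k)))\<^sup>2" for z
  define H :: "complex \<Rightarrow> complex ^ 2" where "H z = vector [D (z ^ k) * PS (z ^ k), F (z ^ k)]" for z
  have pow: "cmod (z ^ k) < 1 \<longleftrightarrow> cmod z < 1" "cmod (z ^ k) \<le> 1 \<longleftrightarrow> cmod z \<le> 1" for z
    using k by (auto simp: norm_power power_less_one_iff power_le_one_iff)
  have pow1: "cmod z = 1 \<Longrightarrow> cmod (z ^ k) = 1" for z by (simp add: norm_power)
  have all2: "Q 1 \<and> Q 2 \<Longrightarrow> Q j" for Q and j :: 2 using exhaust_2[of j] by auto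
  have hol_f: "holomorphic_disc (\<lambda>z. f (z ^ k))" unfolding holomorphic_disc_def
    by (rule allI, rule all2[of "\<lambda>j. (\<lambda>\<zeta>. f (\<zeta> ^ k) $ j) holomorphic_on ball 0 1"])
       (intro conjI holomorphic_power_compose[OF edisc_holomorphic(1)[OF ed] k] holomorphic_power_compose[OF edisc_holomorphic(2)[OF ed] k])
  have bd_f: "bounded ((\<lambda>z. f (z ^ k)) ` ball 0 1)"
  proof (rule bounded_vec2)
    fix z :: complex assume "z \<in> ball 0 1"
    then have "egauge m (f (z ^ k) $ 1) (f (z ^ k) $ 2) \<le> 1" using edisc_less[OF ed, of "z ^ k"] pow by simp
    then show "cmod (f (z ^ k) $ 1) \<le> 1" "cmod (f (z ^ k) $ 2) \<le> 1" using egauge_le_1D[OF m(1)] by auto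
  qed
  have lim: "((\<lambda>r::real. f ((of_real r * z) ^ k)) \<longlongrightarrow> fb z) (at_left 1)"
    and lt: "\<forall>\<^sub>F r in at_left 1. cmod ((of_real r * z) ^ k) < 1" if z: "cmod z = 1" for z
  proof -
    show lt: "\<forall>\<^sub>F r in at_left 1. cmod ((of_real r * z) ^ k) < 1"
      using eventually_radius_at_left_1 by eventually_elim (simp add: pow norm_mult z)
    show "((\<lambda>r::real. f ((of_real r * z) ^ k)) \<longlongrightarrow> fb z) (at_left 1)"
    proof (rule tendsto_vec2)
      have "((\<lambda>r::real. P ((of_real r * z) ^ k) / D ((of_real r * z) ^ k)) \<longlongrightarrow> fb z $ 1) (at_left 1)"
        using disc_algebra_radial_limit[OF PD z, of k] by (simp add: fb_def)
      then show "((\<lambda>r::real. f ((of_real r * z) ^ k) $ 1) \<longlongrightarrow> fb z $ 1) (at_left 1)"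
        by (rule Lim_transform_eventually) (use lt in eventually_elim, simp add: fg)
      have "((\<lambda>r::real. S ((of_real r * z) ^ k)) \<longlongrightarrow> fb z $ 2) (at_left 1)"
        using disc_algebra_radial_limit[OF A(4) z, of k] by (simp add: fb_def)
      then show "((\<lambda>r::real. f ((of_real r * z) ^ k) $ 2) \<longlongrightarrow> fb z $ 2) (at_left 1)"
        by (rule Lim_transform_eventually) (use lt in eventually_elim, simp add: fg)
    qed
  qed
  have bv_f: "has_boundary_values (\<lambda>z. f (z ^ k)) fb" unfolding has_boundary_values_def
    by (rule AE_I2) (simp add: space_circle_measure lim)
  have rho: "ellipsoid_rho m (fb z) = 0" if "cmod z = 1" for z
    using eg[OF pow1[OF that]] by (simp add: ellipsoid_rho_def egauge_def fb_def)
  \<comment> \<open>As a radial limit of points of the ellipsoid the value lies in the closure, and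
    it is not interior because \<open>ellipsoid_rho\<close> vanishes there.\<close>
  have fr: "fb z \<in> frontier {w. ellipsoid_rho m w < 0}" if z: "cmod z = 1" for z
  proof -
    have "\<forall>\<^sub>F r in at_left 1. f ((of_real r * z) ^ k) \<in> closure {w. ellipsoid_rho m w < 0}"
      using lt[OF z]
    proof eventually_elim
      case (elim r)
      then have "f ((of_real r * z) ^ k) \<in> ellipsoid m"
        unfolding ellipsoid_iff_egauge by (rule edisc_less[OF ed])
      then show ?case unfolding ellipsoid_eq_sublevel by (rule subsetD[OF closure_subset])
    qed
    then have "fb z \<in> closure {w. ellipsoid_rho m w < 0}"
      by (rule Lim_in_closed_set[OF closed_closure _ trivial_limit_at_left_real lim[OF z]])
    moreover have "fb z \<notin> interior {w. ellipsoid_rho m w < 0}"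
      using rho[OF z] interior_subset[of "{w. ellipsoid_rho m w < 0}"] by auto
    ultimately show ?thesis by (simp add: frontier_def)
  qed
  have cpos: "c z > 0" if "cmod z = 1" for z using D[of "z ^ k"] pow1[OF that] by (simp add: c_def)
  obtain MD where MD: "\<And>z. cmod z \<le> 1 \<Longrightarrow> cmod (D z) \<le> MD" using disc_algebra_bounded[OF A(2)] by blast
  have cle: "c z \<le> MD\<^sup>2" if "cmod z = 1" for z
    unfolding c_def using MD[of "z ^ k"] pow1[OF that] by (intro power_mono) auto
  have "continuous_on (sphere 0 1) (\<lambda>z. D (z ^ k))"
  proof (rule continuous_on_compose2[of "cball 0 1" D])
    show "continuous_on (cball 0 1) D" using A(2) by (simp add: disc_algebra_def)
  qed (auto intro!: continuous_intros simp: norm_power)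
  then have cm: "c \<in> borel_measurable circle_measure" unfolding c_def
    by (intro continuous_on_circle_measurable continuous_intros)
  have DP: "(\<lambda>z. D z * PS z) \<in> disc_algebra" by (intro disc_algebra_mult A)
  have H1: "H z $ 1 = D (z ^ k) * PS (z ^ k)" and H2: "H z $ 2 = F (z ^ k)" for z by (simp_all add: H_def)
  have hol_H: "holomorphic_disc H" unfolding holomorphic_disc_def
  proof (rule allI, rule all2[of "\<lambda>j. (\<lambda>\<zeta>. H \<zeta> $ j) holomorphic_on ball 0 1"], rule conjI)
    show "(\<lambda>z. H z $ 1) holomorphic_on ball 0 1" unfolding H1
      using holomorphic_power_compose[OF _ k, of "\<lambda>z. D z * PS z"] DP by (simp add: disc_algebra_def)
    show "(\<lambda>z. H z $ 2) holomorphic_on ball 0 1" unfolding H2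
      using holomorphic_power_compose[OF _ k, of F] A(5) by (simp add: disc_algebra_def)
  qed
  obtain M1 where M1: "\<And>z. cmod z \<le> 1 \<Longrightarrow> cmod (D z * PS z) \<le> M1" using disc_algebra_bounded[OF DP] by blast
  obtain M2 where M2: "\<And>z. cmod z \<le> 1 \<Longrightarrow> cmod (F z) \<le> M2" using disc_algebra_bounded[OF A(5)] by blast
  have bd_H: "bounded (H ` ball 0 1)"
    by (rule bounded_vec2[of _ _ M1 M2]) (use M1 M2 pow in \<open>auto simp: H1 H2 less_imp_le\<close>)
  have grad: "(z ^ k * of_real (c z)) *s complex_gradient (ellipsoid_rho m) (fb z) = H z" if z: "cmod z = 1" for z
  proof -
    define w where "w = z ^ k"
    have w: "cmod w = 1" using pow1[OF z] by (simp add: w_def)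
    have Dw: "D w \<noteq> 0" using D w by simp
    \<comment> \<open>One factor of |D|^2 = D cnj D cancels the denominator of cnj (P / D).\<close>
    have "w * of_real ((cmod (D w))\<^sup>2) * cnj (P w / D w) = (w * cnj (P w)) * D w"
      unfolding complex_norm_square using Dw by simp
    also have "\<dots> = D w * PS w" unfolding PS[OF w] by simp
    finally have 1: "w * of_real ((cmod (D w))\<^sup>2) * cnj (P w / D w) = D w * PS w" .
    have 2: "w * of_real ((cmod (D w))\<^sup>2) * (of_real (m * cmod (S w) powr (2 * m - 2)) * cnj (S w)) = F w"
      unfolding F[OF w, symmetric] by simp
    show ?thesis unfolding complex_gradient_ellipsoid_rho[OF m]
      using 1 2 by (simp add: vec_eq_iff forall_2 fb_def c_def H_def w_def[symmetric])
  qed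
  have "((\<lambda>r::real. H (of_real r * z)) \<longlongrightarrow> H z) (at_left 1)" if z: "cmod z = 1" for z
    using disc_algebra_radial_limit[OF DP z, of k] disc_algebra_radial_limit[OF A(5) z, of k]
    by (intro tendsto_vec2) (simp_all only: H1 H2)
  then have bv_H: "has_boundary_values H (\<lambda>z. (z ^ k * of_real (c z)) *s complex_gradient (ellipsoid_rho m) (fb z))"
    unfolding has_boundary_values_def by (intro AE_I2) (simp add: space_circle_measure grad)
  have AE_fr: "AE z in circle_measure. fb z \<in> frontier {w. ellipsoid_rho m w < 0}"
    by (rule AE_I2) (simp add: space_circle_measure fr)
  have AE_c: "AE z in circle_measure. c z \<le> MD\<^sup>2"
    by (rule AE_I2) (simp add: space_circle_measure cle)
  show ?thesis unfolding k_stationary_Linf_def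
    by (intro conjI hol_f bd_f, rule exI[of _ fb], intro conjI bv_f AE_fr, rule exI[of _ c],
        intro conjI cm exI[of _ "MD\<^sup>2"] AE_c ballI, simp add: cpos, rule exI[of _ H], intro conjI hol_H bd_H bv_H)
qed

text \<open>Maximality is carried to the centred disc by one shift, and the explicit form is carried
  back by its inverse.\<close>

lemma emaximal_explicit:
  assumes m: "0 < m" "m < 1/2" and max: "emaximal m f g"
  shows "explicit_disc m f g"
proof -
  have ed: "edisc m f g" using emaximal_edisc[OF max] .
  define a where "a = f 0"
  have lt1: "cmod (f z) < 1" if "cmod z < 1" for z
  proof -
    have "(cmod (f z))\<^sup>2 < 1"
      using edisc_less[OF ed that] powr_ge_zero[of "cmod (g z)" "2*m"] unfolding egauge_def by linarith
    then show ?thesis by (simp add: abs_square_less_1)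
  qed
  then have a: "cmod a < 1" and a': "cmod (- a) < 1" by (simp_all add: a_def)
  define F G where "F z = shift1 (- a) (f z)" and "G z = shift2 m (- a) (f z) (g z)" for z
  have max': "emaximal m F G" unfolding F_def G_def by (rule emaximal_shift[OF m(1) a' max])
  have F0: "F 0 = 0" by (simp add: F_def a_def shift1_def)
  have ex: "explicit_disc m F G"
  proof (cases "G 0 = 0")
    case True
    then show ?thesis using emaximal_through_0[OF m(1) max' F0] by simp
  next
    case False
    then show ?thesis using emaximal_centered[OF m max' F0] by simp
  qed
  have undo: "shift1 a (F z) = f z" "shift2 m a (F z) (G z) = g z" if "cmod z < 1" for z
    using shift1_inverse[OF m(1) a' lt1[OF that]] shift2_inverse[OF m(1) a' lt1[OF that]]
    by (simp_all add: F_def G_def)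
  have "explicit_disc m (\<lambda>z. shift1 a (F z)) (\<lambda>z. shift2 m a (F z) (G z))"
    by (rule explicit_disc_shift[OF m(1) a ex emaximal_edisc[OF max']])
  then show ?thesis unfolding explicit_disc_def using undo by simp
qed

text \<open>With the derivative of f equal to l v, a competitor whose derivative is \<mu> times that
  of f has parameter \<mu> l, and extremality gives \<mu> l \<le> l.\<close>

lemma extremal_disc_emaximal:
  fixes f :: "complex \<Rightarrow> complex ^ 2"
  assumes "f \<in> extremal_discs (ellipsoid m) p v"
  shows "emaximal m (\<lambda>z. f z $ 1) (\<lambda>z. f z $ 2)"
proof -
  have all2: "(\<forall>j::2. Q j) \<longleftrightarrow> Q 1 \<and> Q 2" for Q by (rule forall_2)
  have disc_iff: "holomorphic_disc g \<and> g ` ball 0 1 \<subseteq> ellipsoid m \<longleftrightarrow> edisc m (\<lambda>z. g z $ 1) (\<lambda>z. g z $ 2)" for g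
    unfolding holomorphic_disc_def edisc_def all2 by (auto simp: image_subset_iff ellipsoid_iff_egauge)
  obtain l where f: "edisc m (\<lambda>z. f z $ 1) (\<lambda>z. f z $ 2)" and f0: "f 0 = p" and l: "0 < l" "deriv_at_0 f = l *\<^sub>R v"
    and max: "\<And>g \<mu>. edisc m (\<lambda>z. g z $ 1) (\<lambda>z. g z $ 2) \<Longrightarrow> g 0 = p \<Longrightarrow> 0 < \<mu> \<Longrightarrow> deriv_at_0 g = \<mu> *\<^sub>R v \<Longrightarrow> \<mu> \<le> l"
    using assms unfolding extremal_discs_def disc_iff[symmetric] by blast
  show ?thesis unfolding emaximal_def
  proof (intro conjI allI impI f)
    fix q1 q2 and \<mu> :: real
    assume \<mu>: "\<mu> > 0"
    assume q: "edisc m q1 q2 \<and> q1 0 = f 0 $ 1 \<and> q2 0 = f 0 $ 2 \<and>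
      deriv q1 0 = of_real \<mu> * deriv (\<lambda>z. f z $ 1) 0 \<and> deriv q2 0 = of_real \<mu> * deriv (\<lambda>z. f z $ 2) 0"
    define g :: "complex \<Rightarrow> complex ^ 2" where "g z = vector [q1 z, q2 z]" for z
    have g12: "g z $ 1 = q1 z" "g z $ 2 = q2 z" for z by (simp_all add: g_def)
    have "deriv_at_0 g = \<mu> *\<^sub>R deriv_at_0 f"
      using q by (simp add: vec_eq_iff forall_2 deriv_at_0_def g12 scaleR_conv_of_real[where 'a = complex])
    then have "\<mu> * l \<le> l"
      using q \<mu> l by (intro max[of g]) (auto simp: g12 f0[symmetric] vec_eq_iff forall_2)
    then show "\<mu> \<le> 1" using l by simp
  qed
qed

theorem theorem3p4:
  fixes m :: real and k :: nat and a b :: complex and v :: "complex^2"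
    and f :: "complex \<Rightarrow> complex^2"
  assumes "0 < m" and "m < 1/2"
    and "k > 0"
    and "vector [a, b] \<in> ellipsoid m"
    and "f \<in> extremal_discs (ellipsoid m) (vector [a, b]) v"
  shows "k_stationary_Linf k (ellipsoid_rho m) (\<lambda>\<zeta>. f (\<zeta> ^ k))"
proof -
  have "emaximal m (\<lambda>z. f z $ 1) (\<lambda>z. f z $ 2)" using extremal_disc_emaximal[OF assms(5)] .
  then show ?thesis
    using emaximal_explicit emaximal_edisc assms(1-3) by (intro k_stationary_if_explicit_disc)
qed

end
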